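(* Let $G$ be a finite simple $2$-degenerate graph with maximum degree at most $4$ and with $|E(G)|\geq 2|V(G)|-5$. Then $G$ has a $2$-linear coloring in which there is at most one monochromatic vertex.
   Context: A graph is $2$-degenerate if every subgraph of it has a vertex of degree at most $2$. A linear forest is a forest each of whose components is a path. A $2$-linear coloring of $G$ is a map $c:E(G)\to\{1,2\}$ such that each color class forms a linear forest. Given a $2$-linear coloring of $G$, a vertex is called monochromatic if it has degree exactly $2$ in $G$ and both edges incident with it receive the same color. *)

theory Defs
  imports Main
begin

record 'a ugraph =
  verts :: "'a set"
  edges :: "'a set set"

definition finite_simple_graph :: "'a ugraph \<Rightarrow> bool" where
  "finite_simple_graph G \<longleftrightarrow>
     finite (verts G) \<and> (\<forall>e\<in>edges G. e \<subseteq> verts G \<and> card e = 2)"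

definition incident_edges :: "'a ugraph \<Rightarrow> 'a \<Rightarrow> 'a set set" where
  "incident_edges G v = {e \<in> edges G. v \<in> e}"

definition degree :: "'a ugraph \<Rightarrow> 'a \<Rightarrow> nat" where
  "degree G v = card (incident_edges G v)"

definition subgraph :: "'a ugraph \<Rightarrow> 'a ugraph \<Rightarrow> bool" where
  "subgraph H G \<longleftrightarrow>
     finite_simple_graph H \<and> verts H \<subseteq> verts G \<and> edges H \<subseteq> edges G"

(* Subgraphs without vertices have to be excluded: they contain no vertex of any degree. *)
definition two_degenerate :: "'a ugraph \<Rightarrow> bool" where
  "two_degenerate G \<longleftrightarrow>
     (\<forall>H. subgraph H G \<and> verts H \<noteq> {} \<longrightarrow> (\<exists>v\<in>verts H. degree H v \<le> 2))"

definition is_cycle :: "'a ugraph \<Rightarrow> 'a list \<Rightarrow> bool" where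
  "is_cycle G xs \<longleftrightarrow>
     length xs \<ge> 3 \<and> distinct xs \<and>
     (\<forall>i<length xs. {xs ! i, xs ! (Suc i mod length xs)} \<in> edges G)"

definition forest :: "'a ugraph \<Rightarrow> bool" where
  "forest G \<longleftrightarrow> (\<nexists>xs. is_cycle G xs)"

definition adjacency :: "'a ugraph \<Rightarrow> ('a \<times> 'a) set" where
  "adjacency G = {(u, v). {u, v} \<in> edges G}"

definition induced_subgraph :: "'a ugraph \<Rightarrow> 'a set \<Rightarrow> 'a ugraph" where
  "induced_subgraph G U = \<lparr>verts = U, edges = {e \<in> edges G. e \<subseteq> U}\<rparr>"

definition components :: "'a ugraph \<Rightarrow> 'a ugraph set" where
  "components G = (\<lambda>v. induced_subgraph G ((adjacency G)\<^sup>* `` {v})) ` verts G"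

(* A single vertex counts as a path. *)
definition path_graph :: "'a ugraph \<Rightarrow> bool" where
  "path_graph G \<longleftrightarrow>
     (\<exists>xs. xs \<noteq> [] \<and> distinct xs \<and> verts G = set xs \<and>
           edges G = {{xs ! i, xs ! Suc i} | i. Suc i < length xs})"

definition linear_forest :: "'a ugraph \<Rightarrow> bool" where
  "linear_forest G \<longleftrightarrow> forest G \<and> (\<forall>C\<in>components G. path_graph C)"

(* The color class is taken as a spanning subgraph: vertices that meet no edge of
   the color become one-vertex components, which are paths. *)
definition color_class :: "'a ugraph \<Rightarrow> ('a set \<Rightarrow> nat) \<Rightarrow> nat \<Rightarrow> 'a ugraph" where
  "color_class G c k = \<lparr>verts = verts G, edges = {e \<in> edges G. c e = k}\<rparr>"

(* The values of c outside the edge set are irrelevant. *)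
definition two_linear_coloring :: "'a ugraph \<Rightarrow> ('a set \<Rightarrow> nat) \<Rightarrow> bool" where
  "two_linear_coloring G c \<longleftrightarrow>
     c ` edges G \<subseteq> {1, 2} \<and> (\<forall>k\<in>{1, 2}. linear_forest (color_class G c k))"

definition monochromatic :: "'a ugraph \<Rightarrow> ('a set \<Rightarrow> nat) \<Rightarrow> 'a \<Rightarrow> bool" where
  "monochromatic G c v \<longleftrightarrow>
     degree G v = 2 \<and>
     (\<forall>e\<in>incident_edges G v. \<forall>f\<in>incident_edges G v. c e = c f)"

end

theory Submission
  imports Defs
begin

text \<open>Build the graph up by adding vertices of degree 2, and remember of a 2-linear coloring only the
  degrees \<open>D b x\<close> of the vertices in each colour \<open>b\<close> and the map \<open>s b\<close> that sends one end of a path of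
  colour \<open>b\<close> to the other; this decides which edges may be added.  A new vertex that receives one edge
  of each colour never closes a cycle.  It must be arranged that the colours available at the two
  neighbours differ, and this is possible once the vertices of degree 3 are matched in pairs with
  opposite colours available: the induction hypothesis is that for a suitable matching every such
  prescription is realised by a coloring with at most one violation, which travels along as vertices are
  added.  With defect \<open>2n - 3 - |E| = 1\<close> there is even no violation at all.  Peeling off a
  vertex of degree 2 preserves the defect, unless it is adjacent to another vertex of degree 2; there the
  defect drops, and putting the vertices back either repairs a violation, provided it sits at a prescribed
  vertex, or creates one.  Hence defect 0 needs the stronger claim that the violation can be placed at any
  vertex of degree 2; this is tractable because only three distributions of open degrees occur.\<close>

section \<open>Partitions into paths\<close>

text \<open>Let n count the vertices that meet an edge. From |E| >= 2n - 5 the defect is at most 2,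
  and it is never negative, because a 2-degenerate graph with an edge has at most 2n - 3 edges; so
  three stages suffice. At defect 0, when no vertex has degree 1, the sum of 4 - deg(x) is 4n - 2(2n
  - 3) = 6. Six vertices of degree 3 are excluded by 2-degeneracy, which leaves three, two or one
  vertices of degree 2 together with none, two or four of degree 3. The obstacle at defect 0 is
  parity: a vertex of degree 4 has degree 2 in each colour, and the number of vertices of odd degree
  in a colour is even. Hence three vertices of degree 2 cannot all see both colours, and a violation
  is unavoidable, already in the triangle. That is why the violation has to be movable there. When a
  new vertex receives two edges of one colour, it becomes monochromatic and carries the violation.
  Only then can a cycle threaten, and knowing \<open>s\<close> at one neighbour is enough to exclude
  it.\<close>

definition dg :: "'a set set \<Rightarrow> 'a \<Rightarrow> nat" where
  "dg E x = card {e \<in> E. x \<in> e}"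

fun path_edges :: "'a list \<Rightarrow> 'a set set" where
  "path_edges (x # y # ps) = insert {x, y} (path_edges (y # ps))"
| "path_edges _ = {}"

text \<open>Paths are lists, so that joining and cutting paths become \<open>@\<close> and its
  inverse. The lists cover the whole type, isolated vertices being one-element lists, and the
  disjointness condition lets each path occur in one orientation only.\<close>

definition path_partition :: "'a list set \<Rightarrow> 'a set set \<Rightarrow> bool" where
  "path_partition L E \<longleftrightarrow>
     (\<forall>p\<in>L. p \<noteq> [] \<and> distinct p) \<and>
     (\<forall>p\<in>L. \<forall>q\<in>L. \<forall>x. x \<in> set p \<longrightarrow> x \<in> set q \<longrightarrow> p = q) \<and>
     (\<Union>p\<in>L. set p) = UNIV \<and> E = (\<Union>p\<in>L. path_edges p)"

text \<open>The orientation of the paths is forgotten again: \<open>s\<close> is prescribed at path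
  ends only, symmetrically, and an isolated vertex is its own partner.\<close>

definition path_cover :: "'a set set \<Rightarrow> ('a \<Rightarrow> 'a) \<Rightarrow> bool" where
  "path_cover E s \<longleftrightarrow> (\<exists>L. path_partition L E \<and> (\<forall>p\<in>L. s (hd p) = last p \<and> s (last p) = hd p))"

lemma path_partition_unique:
  assumes "path_partition L E" "p \<in> L" "q \<in> L" "x \<in> set p" "x \<in> set q"
  shows "p = q"
  using assms unfolding path_partition_def by blast

lemma path_partition_path:
  assumes "path_partition L E"
  obtains p where "p \<in> L" "x \<in> set p"
proof -
  have "x \<in> (\<Union>p\<in>L. set p)" using assms unfolding path_partition_def by simp
  then show ?thesis using that by blast
qed

lemma path_edges_subset: "e \<in> path_edges p \<Longrightarrow> e \<subseteq> set p"
  by (induction p rule: path_edges.induct) auto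

lemma path_partition_edge:
  assumes "path_partition L E" "p \<in> L" "e \<in> E" "x \<in> e" "x \<in> set p"
  shows "e \<in> path_edges p"
proof -
  obtain q where q: "q \<in> L" "e \<in> path_edges q"
    using assms(1,3) unfolding path_partition_def by blast
  then have "x \<in> set q" using path_edges_subset assms(4) by blast
  then have "q = p" using assms(5) path_partition_unique[OF assms(1) q(1) assms(2)] by blast
  then show ?thesis using q by simp
qed

lemma path_partition_sub: "path_partition L E \<Longrightarrow> p \<in> L \<Longrightarrow> path_edges p \<subseteq> E"
  unfolding path_partition_def by simp blast

lemma path_partitionI:
  assumes "\<And>p. p \<in> L \<Longrightarrow> p \<noteq> []" "\<And>p. p \<in> L \<Longrightarrow> distinct p"
    "\<And>p q x. p \<in> L \<Longrightarrow> q \<in> L \<Longrightarrow> x \<in> set p \<Longrightarrow> x \<in> set q \<Longrightarrow> p = q"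
    "\<And>x. \<exists>p\<in>L. x \<in> set p" "E = (\<Union>p\<in>L. path_edges p)"
  shows "path_partition L E"
  unfolding path_partition_def
proof (intro conjI)
  show "\<forall>p\<in>L. p \<noteq> [] \<and> distinct p" using assms(1,2) by simp
  show "\<forall>p\<in>L. \<forall>q\<in>L. \<forall>x. x \<in> set p \<longrightarrow> x \<in> set q \<longrightarrow> p = q" using assms(3) by simp
  show "(\<Union>p\<in>L. set p) = UNIV" using assms(4) by auto
  show "E = (\<Union>p\<in>L. path_edges p)" by (rule assms(5))
qed

lemma path_edges_append:
  "path_edges (xs @ ys) =
     path_edges xs \<union> path_edges ys \<union> (if xs \<noteq> [] \<and> ys \<noteq> [] then {{last xs, hd ys}} else {})"
proof (induction xs rule: path_edges.induct)
  case (1 x y ps)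
  then show ?case by auto
next
  case "2_1"
  then show ?case by simp
next
  case ("2_2" v)
  then show ?case by (cases ys) auto
qed

lemma path_edges_rev: "path_edges (rev p) = path_edges p"
proof (induction p rule: path_edges.induct)
  case (1 x y ps)
  have "path_edges (rev (x # y # ps)) = path_edges (rev (y # ps) @ [x])" by simp
  also have "\<dots> = insert {y, x} (path_edges (rev (y # ps)))"
    unfolding path_edges_append[of "rev (y # ps)" "[x]"] by simp
  finally show ?case using 1 by (simp add: insert_commute)
qed auto

lemma path_edges_split:
  "e \<in> path_edges p \<Longrightarrow> \<exists>xs ys. p = xs @ ys \<and> xs \<noteq> [] \<and> ys \<noteq> [] \<and> e = {last xs, hd ys}"
proof (induction p rule: path_edges.induct)
  case (1 x y ps)
  show ?case
  proof (cases "e = {x, y}")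
    case True
    then have "x # y # ps = [x] @ (y # ps) \<and> e = {last [x], hd (y # ps)}" by simp
    then show ?thesis by blast
  next
    case False
    then obtain xs ys where "y # ps = xs @ ys" "xs \<noteq> []" "ys \<noteq> []" "e = {last xs, hd ys}"
      using 1 by auto
    then have "x # y # ps = (x # xs) @ ys \<and> ys \<noteq> [] \<and> e = {last (x # xs), hd ys}" by simp
    then show ?thesis by blast
  qed
qed auto

lemma path_edges_at:
  assumes "distinct (xs @ x # ys)"
  shows "{e \<in> path_edges (xs @ x # ys). x \<in> e} =
    (if xs = [] then {} else {{last xs, x}}) \<union> (if ys = [] then {} else {{x, hd ys}})"
proof -
  have 1: "{e \<in> path_edges xs. x \<in> e} = {}"
    using assms path_edges_subset[of _ xs] by auto
  have 2: "{e \<in> path_edges ys. x \<in> e} = {}"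
    using assms path_edges_subset[of _ ys] by auto
  have 3: "path_edges (x # ys) = path_edges ys \<union> (if ys = [] then {} else {{x, hd ys}})"
    by (cases ys) auto
  show ?thesis
    using 1 2 unfolding path_edges_append 3 by auto
qed

text \<open>Disjointness of the lists puts every edge at \<open>x\<close> into \<open>p\<close>, and
  distinctness keeps the edge to the left apart from the edge to the right. Thus degree at most 1
  means being an end of a path, which is the bridge from degrees to lists.\<close>

lemma dg_path:
  assumes "path_partition L E" "p \<in> L" "p = xs @ x # ys"
  shows "dg E x = (if xs = [] then 0 else 1) + (if ys = [] then 0 else 1)"
proof -
  have d: "distinct (xs @ x # ys)" using assms(1,2) unfolding assms(3) path_partition_def by blast
  have "x \<in> set p" using assms(3) by simp
  then have "e \<in> E \<longleftrightarrow> e \<in> path_edges p" if "x \<in> e" for e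
    using path_partition_edge[OF assms(1,2) _ that] path_partition_sub[OF assms(1,2)] by (meson subsetD)
  then have "{e \<in> E. x \<in> e} = {e \<in> path_edges p. x \<in> e}" by auto
  then have "{e \<in> E. x \<in> e} = (if xs = [] then {} else {{last xs, x}}) \<union> (if ys = [] then {} else {{x, hd ys}})"
    using path_edges_at[OF d] assms(3) by simp
  moreover have "{last xs, x} \<noteq> {x, hd ys}" if "xs \<noteq> []" "ys \<noteq> []"
  proof -
    have "last xs \<in> set xs" "hd ys \<in> set ys" using that by auto
    then show ?thesis using d by (auto simp: doubleton_eq_iff)
  qed
  ultimately show ?thesis unfolding dg_def by (cases "xs = []"; cases "ys = []") (simp_all del: Collect_empty_eq)
qed

text \<open>Serves to turn a given end of a path to the side where concatenation needs it.\<close>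

lemma path_partition_rev:
  assumes "path_partition L E" "p \<in> L"
  shows "path_partition (insert (rev p) (L - {p})) E"
proof (rule path_partitionI)
  let ?M = "insert (rev p) (L - {p})"
  show "q \<noteq> []" "distinct q" if "q \<in> ?M" for q
    using that assms unfolding path_partition_def by auto
  show "q = r" if "q \<in> ?M" "r \<in> ?M" "x \<in> set q" "x \<in> set r" for q r x
    using that assms path_partition_unique[OF assms(1)] by (metis DiffE insertE insertI1 set_rev)
  show "\<exists>q\<in>?M. x \<in> set q" for x
    using path_partition_path[OF assms(1), of x] by (metis Diff_iff insert_iff set_rev singletonD)
  have "E = path_edges p \<union> (\<Union>q\<in>L-{p}. path_edges q)"
    using assms unfolding path_partition_def by blast
  then show "E = (\<Union>q\<in>?M. path_edges q)" by (simp add: path_edges_rev)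
qed

lemma path_partition_ends:
  assumes "path_partition L E" "dg E x \<le> 1"
  obtains p where "p \<in> L" "x = hd p \<or> x = last p" "x \<in> set p"
proof -
  obtain p where p: "p \<in> L" "x \<in> set p" by (rule path_partition_path[OF assms(1)])
  then obtain xs ys where s: "p = xs @ x # ys" by (meson split_list)
  have "xs = [] \<or> ys = []"
    using dg_path[OF assms(1) p(1) s] assms(2) by (auto split: if_splits)
  then have "x = hd p \<or> x = last p" using s by auto
  then show ?thesis using that p by blast
qed

lemma path_partition_exists_partner:
  assumes "path_partition L E"
  shows "\<exists>s. path_cover E s"
proof -
  define P where "P z = (THE p. p \<in> L \<and> z \<in> set p)" for z
  define s where "s z = (if z = hd (P z) then last (P z) else hd (P z))" for z
  have P: "P z = p" if "p \<in> L" "z \<in> set p" for p z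
    unfolding P_def by (rule the_equality) (use that path_partition_unique[OF assms] in auto)
  have "s (hd p) = last p \<and> s (last p) = hd p" if "p \<in> L" for p
  proof -
    have "p \<noteq> []" using that assms by (auto simp: path_partition_def)
    then have "P (hd p) = p" "P (last p) = p" using P[OF that] by auto
    then show ?thesis by (auto simp: s_def)
  qed
  then show ?thesis using assms unfolding path_cover_def by blast
qed

lemma path_cover_partner:
  assumes "path_cover E s" "dg E x \<le> 1"
  shows "dg E (s x) = dg E x" "s (s x) = x" "s x = x \<longleftrightarrow> dg E x = 0"
proof -
  obtain L where L: "path_partition L E" "\<forall>p\<in>L. s (hd p) = last p \<and> s (last p) = hd p"
    using assms(1) unfolding path_cover_def by blast
  obtain p where p: "p \<in> L" "x = hd p \<or> x = last p" "x \<in> set p"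
    by (rule path_partition_ends[OF L(1) assms(2)])
  have d: "p \<noteq> []" "distinct p" using L(1) p(1) by (auto simp: path_partition_def)
  show "s (s x) = x" using L(2) p by auto
  have h: "dg E (hd p) = (if length p = 1 then 0 else 1)"
    using dg_path[OF L(1) p(1), of "[]" "hd p" "tl p"] d by (cases p) auto
  have l: "dg E (last p) = (if length p = 1 then 0 else 1)"
    using dg_path[OF L(1) p(1), of "butlast p" "last p" "[]"] d by (cases p rule: rev_cases) auto
  have e: "hd p = last p \<longleftrightarrow> length p = 1"
  proof (cases p)
    case (Cons a l)
    then have "last l \<noteq> a" if "l \<noteq> []" using d(2) that by (metis distinct.simps(2) last_in_set)
    then show ?thesis using Cons by auto
  qed (use d in simp)
  show "dg E (s x) = dg E x" using p(2) h l L(2) p(1) by auto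
  show "s x = x \<longleftrightarrow> dg E x = 0" using p(2) h l e L(2) p(1) by (auto split: if_splits)
qed

lemma path_cover_dg_le2:
  assumes "path_cover E s" shows "dg E x \<le> 2"
proof -
  obtain L where L: "path_partition L E" using assms unfolding path_cover_def by blast
  obtain p where p: "p \<in> L" "x \<in> set p" by (rule path_partition_path[OF L])
  then obtain xs ys where s: "p = xs @ x # ys" by (meson split_list)
  show ?thesis using dg_path[OF L p(1) s] by auto
qed

text \<open>After reversals \<open>x\<close> is the last vertex of a path \<open>p\<close> and
  \<open>y\<close> the first vertex of a path \<open>q\<close>. The condition
  \<open>s x \<noteq> y\<close> makes \<open>p\<close> and \<open>q\<close> different, so
  \<open>p @ q\<close> is a path and no cycle arises. Its ends are \<open>s x\<close> and
  \<open>s y\<close>; this remains right for one-element paths, where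
  \<open>s x = x\<close>.\<close>

lemma path_cover_add:
  assumes "path_cover E s" "x \<noteq> y" "dg E x \<le> 1" "dg E y \<le> 1" "s x \<noteq> y"
  shows "path_cover (insert {x, y} E) (s(s x := s y, s y := s x))"
proof -
  let ?S = "\<lambda>L. \<forall>p\<in>L. s (hd p) = last p \<and> s (last p) = hd p"
  obtain L0 where L0: "path_partition L0 E" "?S L0"
    using assms(1) unfolding path_cover_def by blast
  obtain p0 where p0: "p0 \<in> L0" "x = hd p0 \<or> x = last p0" "x \<in> set p0"
    by (rule path_partition_ends[OF L0(1) assms(3)])
  have "\<exists>L p. path_partition L E \<and> ?S L \<and> p \<in> L \<and> x = last p"
  proof (cases "x = last p0")
    case True then show ?thesis using L0 p0 by blast
  next
    case False
    have "p0 \<noteq> []" using p0 by auto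
    then have "?S (insert (rev p0) (L0 - {p0}))" using L0(2) p0(1) by (auto simp: hd_rev last_rev)
    moreover have "x = last (rev p0)" using False p0 by (auto simp: last_rev)
    ultimately show ?thesis using path_partition_rev[OF L0(1) p0(1)] by blast
  qed
  then obtain L1 p where L1: "path_partition L1 E" "?S L1" and p: "p \<in> L1" "x = last p" by blast
  obtain q0 where q0: "q0 \<in> L1" "y = hd q0 \<or> y = last q0" "y \<in> set q0"
    by (rule path_partition_ends[OF L1(1) assms(4)])
  have pq0: "q0 \<noteq> p" using q0 p L1(2) assms(2,5) by auto
  have "\<exists>L q. path_partition L E \<and> ?S L \<and> p \<in> L \<and> q \<in> L \<and> p \<noteq> q \<and> y = hd q"
  proof (cases "y = hd q0")
    case True then show ?thesis using L1 q0 p pq0 by blast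
  next
    case False
    have ne: "q0 \<noteq> []" "p \<noteq> []" using q0 L1(1) p by (auto simp: path_partition_def)
    then have "?S (insert (rev q0) (L1 - {q0}))" using L1(2) q0(1) by (auto simp: hd_rev last_rev)
    moreover have "y = hd (rev q0)" using False q0 by (auto simp: hd_rev)
    moreover have "p \<noteq> rev q0"
    proof
      assume "p = rev q0"
      then show False
        using path_partition_unique[OF L1(1) p(1) q0(1), of "hd q0"] ne pq0 by simp
    qed
    ultimately show ?thesis using path_partition_rev[OF L1(1) q0(1)] p(1) pq0 by blast
  qed
  then obtain L q where L: "path_partition L E" "?S L" and pq: "p \<in> L" "q \<in> L" "p \<noteq> q" "y = hd q"
    by blast
  have ne: "p \<noteq> []" "q \<noteq> []" and dis: "distinct p" "distinct q"
    using L(1) pq unfolding path_partition_def by blast+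
  have dj: "r = r'" if "r \<in> L" "r' \<in> L" "z \<in> set r" "z \<in> set r'" for r r' z
    using path_partition_unique[OF L(1)] that by blast
  have dis3: "set p \<inter> set q = {}" using dj pq(1-3) by blast
  define M where "M = insert (p @ q) (L - {p, q})"
  have "path_partition M (insert {x, y} E)"
  proof (rule path_partitionI)
    show "r \<noteq> []" "distinct r" if "r \<in> M" for r
      using that L(1) ne dis dis3 unfolding M_def path_partition_def by auto
    show "r = r'" if "r \<in> M" "r' \<in> M" "z \<in> set r" "z \<in> set r'" for r r' z
    proof -
      have "z \<notin> set (p @ q)" if "r \<in> L - {p, q}" "z \<in> set r" for r
        using that dj pq(1,2) by auto
      then show ?thesis using that dj unfolding M_def by blast
    qed
    show "\<exists>r\<in>M. z \<in> set r" for z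
    proof -
      obtain r where "r \<in> L" "z \<in> set r" by (rule path_partition_path[OF L(1)])
      then show ?thesis unfolding M_def by (cases "r = p \<or> r = q") auto
    qed
    have "E = path_edges p \<union> path_edges q \<union> (\<Union>r\<in>L - {p, q}. path_edges r)"
      using L(1) pq unfolding path_partition_def by blast
    then show "insert {x, y} E = (\<Union>p\<in>M. path_edges p)"
      unfolding M_def using ne p(2) pq(4) by (auto simp: path_edges_append)
  qed
  moreover have "(s(s x := s y, s y := s x)) (hd r) = last r \<and> (s(s x := s y, s y := s x)) (last r) = hd r"
    if "r \<in> M" for r
  proof -
    have sx: "s x = hd p" and sy: "s y = last q" using L(2) pq p(2) by auto
    have hl: "hd p \<noteq> last q" using dis3 ne by (metis disjoint_iff hd_in_set last_in_set)
    show ?thesis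
    proof (cases "r = p @ q")
      case True then show ?thesis using sx sy hl ne by simp
    next
      case False
      then have r: "r \<in> L" "r \<noteq> p" "r \<noteq> q" using that by (auto simp: M_def)
      then have "r \<noteq> []" "set r \<inter> set p = {}" "set r \<inter> set q = {}"
        using L(1) dj pq(1,2) unfolding path_partition_def by blast+
      then have "hd r \<noteq> hd p" "hd r \<noteq> last q" "last r \<noteq> hd p" "last r \<noteq> last q"
        using ne by (metis disjoint_iff hd_in_set last_in_set)+
      then show ?thesis using sx sy L(2) r(1) by simp
    qed
  qed
  ultimately show ?thesis unfolding path_cover_def by blast
qed

text \<open>The partner map is merely claimed to exist: cutting a path turns two neighbours into
  ends, and the old \<open>s\<close> does not tell which of the old ends belongs to which
  half.\<close>

lemma path_cover_delete:
  assumes "path_cover E s"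
  shows "\<exists>s'. path_cover (E - {e}) s'"
proof (cases "e \<in> E")
  case False then show ?thesis using assms by auto
next
  case True
  obtain L where L: "path_partition L E" using assms unfolding path_cover_def by blast
  obtain p where p: "p \<in> L" "e \<in> path_edges p" using L True unfolding path_partition_def by blast
  obtain xs ys where s: "p = xs @ ys" "xs \<noteq> []" "ys \<noteq> []" "e = {last xs, hd ys}"
    using path_edges_split[OF p(2)] by blast
  have d: "distinct p" using L p(1) by (auto simp: path_partition_def)
  have lh: "last xs \<in> set xs" "hd ys \<in> set ys" using s by auto
  have ex: "e \<notin> path_edges xs" "e \<notin> path_edges ys"
    using path_edges_subset[of e xs] path_edges_subset[of e ys] lh d s(1,4)
    unfolding distinct_append s(1) by blast+
  have dj: "r = r'" if "r \<in> L" "r' \<in> L" "z \<in> set r" "z \<in> set r'" for r r' z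
    using path_partition_unique[OF L] that by blast
  have eo: "e \<notin> path_edges q" if "q \<in> L - {p}" for q
    using dj[of p q "last xs"] that p(1) s lh path_edges_subset[of e q] by auto
  define M where "M = insert xs (insert ys (L - {p}))"
  have "path_partition M (E - {e})"
  proof (rule path_partitionI)
    show "r \<noteq> []" "distinct r" if "r \<in> M" for r
      using that L s d unfolding M_def path_partition_def by auto
    have "set xs \<inter> set ys = {}" using d s by auto
    moreover have "z \<notin> set xs" "z \<notin> set ys" if "r \<in> L - {p}" "z \<in> set r" for r z
      using that dj[of r p z] p(1) s(1) by auto
    ultimately show "r = r'" if "r \<in> M" "r' \<in> M" "z \<in> set r" "z \<in> set r'" for r r' z
      using that dj unfolding M_def by blast
    show "\<exists>r\<in>M. z \<in> set r" for z
    proof -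
      obtain r where "r \<in> L" "z \<in> set r" by (rule path_partition_path[OF L])
      then show ?thesis unfolding M_def using s(1) by (cases "r = p") auto
    qed
    have "E = path_edges p \<union> (\<Union>r\<in>L - {p}. path_edges r)"
      using L p unfolding path_partition_def by blast
    then show "E - {e} = (\<Union>p\<in>M. path_edges p)"
      unfolding M_def using s ex eo by (auto simp: path_edges_append)
  qed
  then show ?thesis by (rule path_partition_exists_partner)
qed

lemma path_cover_empty: "path_cover {} id"
proof -
  have "path_partition (range (\<lambda>x. [x])) {}" by (auto simp: path_partition_def)
  then show ?thesis unfolding path_cover_def by (intro exI[of _ "range (\<lambda>x. [x])"]) auto
qed

lemma dg_insert:
  assumes "finite E" "{x, y} \<notin> E"
  shows "dg (insert {x, y} E) z = dg E z + (if z = x \<or> z = y then 1 else 0)"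
proof -
  have "{e \<in> insert {x, y} E. z \<in> e} = (if z = x \<or> z = y then insert {x, y} {e \<in> E. z \<in> e} else {e \<in> E. z \<in> e})"
    by auto
  then show ?thesis using assms by (simp add: dg_def)
qed

section \<open>Path partitions yield linear forests\<close>

lemma path_edges_nth: "path_edges p = {{p ! i, p ! Suc i} | i. Suc i < length p}"
proof (induction p rule: path_edges.induct)
  case (1 x y ps)
  have "{{(x # y # ps) ! i, (x # y # ps) ! Suc i} | i. Suc i < length (x # y # ps)} =
     insert {x, y} {{(y # ps) ! i, (y # ps) ! Suc i} | i. Suc i < length (y # ps)}" (is "?l = ?r")
  proof
    show "?l \<subseteq> ?r"
    proof
      fix e assume "e \<in> ?l"
      then obtain i where i: "e = {(x # y # ps) ! i, (x # y # ps) ! Suc i}" "Suc i < length (x # y # ps)" by blast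
      show "e \<in> ?r"
      proof (cases i)
        case 0 then show ?thesis using i by simp
      next
        case (Suc j)
        then have "e = {(y # ps) ! j, (y # ps) ! Suc j}" "Suc j < length (y # ps)" using i by auto
        then show ?thesis by blast
      qed
    qed
    show "?r \<subseteq> ?l"
    proof
      fix e assume "e \<in> ?r"
      then consider "e = {x, y}" | j where "e = {(y # ps) ! j, (y # ps) ! Suc j}" "Suc j < length (y # ps)" by blast
      then show "e \<in> ?l"
      proof cases
        case 1 then show ?thesis by (intro CollectI exI[of _ 0]) simp
      next
        case 2 then show ?thesis by (intro CollectI exI[of _ "Suc j"]) simp
      qed
    qed
  qed
  then show ?case using 1 by simp
qed auto

lemma path_edges_reachable:
  assumes "x \<in> set p" "y \<in> set p"
  shows "(x, y) \<in> {(u, v). {u, v} \<in> path_edges p}\<^sup>*"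
proof -
  let ?R = "\<lambda>p. {(u, v). {u, v} \<in> path_edges p}\<^sup>*"
  have s: "sym (?R p)" for p :: "'a list"
    by (rule sym_rtrancl) (auto simp: sym_def insert_commute)
  have h: "z \<in> set p \<Longrightarrow> (hd p, z) \<in> ?R p" for z
  proof (induction p rule: path_edges.induct)
    case (1 u v ps)
    show ?case
    proof (cases "z = u")
      case False
      then have "(v, z) \<in> ?R (v # ps)" using 1 by auto
      then have "(v, z) \<in> ?R (u # v # ps)" by (rule rtrancl_mono[THEN subsetD, rotated]) auto
      moreover have "(u, v) \<in> {(a, b). {a, b} \<in> path_edges (u # v # ps)}" by simp
      ultimately show ?thesis by (metis (no_types, lifting) converse_rtrancl_into_rtrancl list.sel(1))
    qed auto
  qed auto
  show ?thesis using h[OF assms(1)] h[OF assms(2)] s[of p] by (meson rtrancl_trans symD)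
qed

text \<open>The leftmost vertex of a cycle in a path would need two neighbours to its right.\<close>

lemma path_edges_no_cycle:
  assumes "distinct p" "length xs \<ge> 3" "distinct xs"
    "\<forall>i<length xs. {xs ! i, xs ! (Suc i mod length xs)} \<in> path_edges p"
  shows False
  using assms
proof (induction p rule: path_edges.induct)
  case (1 x y ps)
  let ?n = "length xs"
  show ?case
  proof (cases "x \<in> set xs")
    case True
    then obtain i where i: "i < ?n" "xs ! i = x" by (metis in_set_conv_nth)
    have out: "b = y" if "{x, b} \<in> path_edges (x # y # ps)" for b
    proof -
      have "{x, b} \<notin> path_edges (y # ps)" using path_edges_subset[of "{x, b}" "y # ps"] 1(2) by auto
      then show ?thesis using that by (auto simp: doubleton_eq_iff)
    qed
    \<comment> \<open>The predecessor of position \<open>i\<close> on the cycle. Both neighbours of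
      \<open>x\<close> must be \<open>y\<close>, but predecessor and successor are different
      positions as the cycle has length at least 3.\<close>
    define j where "j = (if i = 0 then ?n - 1 else i - 1)"
    have j: "j < ?n" "Suc j mod ?n = i" using i 1(3) by (auto simp: j_def)
    have "{x, xs ! (Suc i mod ?n)} \<in> path_edges (x # y # ps)" using 1(5) i by auto
    then have a: "xs ! (Suc i mod ?n) = y" by (rule out)
    have "{xs ! j, x} \<in> path_edges (x # y # ps)" using 1(5) j i by auto
    then have b: "xs ! j = y" by (intro out) (simp add: insert_commute)
    have "Suc i mod ?n < ?n" using i by (auto intro: mod_less_divisor)
    then have "Suc i mod ?n = j" using a b j 1(4) by (metis nth_eq_iff_index_eq)
    moreover have "Suc i mod ?n = (if Suc i = ?n then 0 else Suc i)" using i by (simp add: mod_if)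
    ultimately show False using i 1(3) by (auto simp: j_def split: if_splits)
  next
    case False
    have "{xs ! i, xs ! (Suc i mod ?n)} \<in> path_edges (y # ps)" if "i < ?n" for i
    proof -
      have "{xs ! i, xs ! (Suc i mod ?n)} \<noteq> {x, y}" using False that by (metis doubleton_eq_iff nth_mem length_pos_if_in_set mod_less_divisor)
      then show ?thesis using 1(5) that by auto
    qed
    then show False using 1 by auto
  qed
next
  case "2_1"
  then show ?case by (metis empty_iff length_greater_0_conv list.size(3) not_numeral_le_zero path_edges.simps(2))
next
  case ("2_2" v)
  then show ?case by (metis empty_iff length_greater_0_conv list.size(3) not_numeral_le_zero path_edges.simps(3))
qed

text \<open>An edge that meets a path of the partition belongs to it, so a cycle or a walk never
  leaves the path where it starts. Hence a cycle would lie inside one path, and the components are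
  exactly the vertex sets of the lists.\<close>

lemma path_cover_linear_forest:
  assumes "path_cover E s" "\<forall>e\<in>E. e \<subseteq> V"
  shows "linear_forest \<lparr>verts = V, edges = E\<rparr>"
proof -
  let ?G = "\<lparr>verts = V, edges = E\<rparr>"
  obtain L where L: "path_partition L E" using assms(1) unfolding path_cover_def by blast
  have own: "e \<in> path_edges p" if "e \<in> E" "p \<in> L" "x \<in> e" "x \<in> set p" for e p x
    using path_partition_edge[OF L that(2,1,3,4)] .
  have path: "\<exists>p\<in>L. x \<in> set p" for x using path_partition_path[OF L, of x] by blast
  have sub: "path_edges p \<subseteq> E" if "p \<in> L" for p using L that unfolding path_partition_def by blast
  have "forest ?G"
    unfolding forest_def
  proof
    assume "\<exists>xs. is_cycle ?G xs"
    then obtain xs where xs: "length xs \<ge> 3" "distinct xs"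
      "\<And>i. i < length xs \<Longrightarrow> {xs ! i, xs ! (Suc i mod length xs)} \<in> E"
      by (auto simp: is_cycle_def)
    obtain p where p: "p \<in> L" "xs ! 0 \<in> set p" using path by blast
    have all: "i < length xs \<Longrightarrow> xs ! i \<in> set p" for i
    proof (induction i)
      case 0 then show ?case using p by simp
    next
      case (Suc i)
      then have "{xs ! i, xs ! Suc i} \<in> E" using xs(3)[of i] by (simp add: mod_if)
      then have "{xs ! i, xs ! Suc i} \<in> path_edges p" using own p(1) Suc by auto
      then show ?case using path_edges_subset by fastforce
    qed
    have "\<forall>i<length xs. {xs ! i, xs ! (Suc i mod length xs)} \<in> path_edges p"
      using own[OF xs(3) p(1)] all by blast
    then show False using path_edges_no_cycle[of p xs] xs L p(1) by (auto simp: path_partition_def)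
  qed
  moreover have "path_graph C" if C: "C \<in> components ?G" for C
  proof -
    obtain v where v: "v \<in> V" "C = induced_subgraph ?G ((adjacency ?G)\<^sup>* `` {v})"
      using C by (auto simp: components_def)
    obtain p where p: "p \<in> L" "v \<in> set p" using path by blast
    have "(adjacency ?G)\<^sup>* `` {v} = set p"
    proof
      have "w \<in> set p" if "(v, w) \<in> (adjacency ?G)\<^sup>*" for w
        using that
      proof (induction rule: rtrancl_induct)
        case base then show ?case using p by simp
      next
        case (step y z)
        then have "{y, z} \<in> path_edges p" using own[of "{y, z}" p y] p(1) by (auto simp: adjacency_def)
        then show ?case using path_edges_subset by fastforce
      qed
      then show "(adjacency ?G)\<^sup>* `` {v} \<subseteq> set p" by auto
      show "set p \<subseteq> (adjacency ?G)\<^sup>* `` {v}"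
      proof
        fix w assume "w \<in> set p"
        then have "(v, w) \<in> {(a, b). {a, b} \<in> path_edges p}\<^sup>*" using p(2) by (intro path_edges_reachable)
        moreover have "{(a, b). {a, b} \<in> path_edges p} \<subseteq> adjacency ?G"
          using sub[OF p(1)] by (auto simp: adjacency_def)
        ultimately show "w \<in> (adjacency ?G)\<^sup>* `` {v}" using rtrancl_mono by blast
      qed
    qed
    moreover have "{e \<in> E. e \<subseteq> set p} = path_edges p"
    proof
      show "path_edges p \<subseteq> {e \<in> E. e \<subseteq> set p}" using sub[OF p(1)] path_edges_subset by blast
      show "{e \<in> E. e \<subseteq> set p} \<subseteq> path_edges p"
      proof
        fix e assume e: "e \<in> {e \<in> E. e \<subseteq> set p}"
        then obtain q where q: "q \<in> L" "e \<in> path_edges q" using L unfolding path_partition_def by blast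
        then obtain a where "a \<in> e" using path_edges_split[of e q] by auto
        then show "e \<in> path_edges p" using own e p(1) by auto
      qed
    qed
    moreover have "p \<noteq> []" "distinct p" using L p(1) by (auto simp: path_partition_def)
    ultimately show ?thesis
      unfolding path_graph_def v(2) induced_subgraph_def by (intro exI[of _ p]) (simp add: path_edges_nth)
  qed
  ultimately show ?thesis by (simp add: linear_forest_def)
qed

section \<open>States of colorings\<close>

definition sgraph :: "'a set set \<Rightarrow> bool" where
  "sgraph E \<longleftrightarrow> finite E \<and> (\<forall>e\<in>E. card e = 2)"

text \<open>Colours are booleans, so \<open>\<not> b\<close> is the other colour and a choice up to
  swapping colours needs no case distinction. The classes \<open>K\<close> stay bound: all later
  steps argue with \<open>D\<close> and \<open>s\<close> alone.\<close>

definition coloring_state :: "'a set set \<Rightarrow> (bool \<Rightarrow> 'a \<Rightarrow> nat) \<Rightarrow> (bool \<Rightarrow> 'a \<Rightarrow> 'a) \<Rightarrow> bool" where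
  "coloring_state E D s \<longleftrightarrow>
     (\<exists>K. E = K True \<union> K False \<and> K True \<inter> K False = {} \<and>
          (\<forall>b. path_cover (K b) (s b) \<and> D b = dg (K b)))"

lemma dg_eq_0_iff: "finite E \<Longrightarrow> dg E x = 0 \<longleftrightarrow> x \<notin> \<Union>E"
  by (auto simp: dg_def)

lemma state_degree:
  assumes "coloring_state E D s" "finite E"
  shows "D b x + D (\<not> b) x = dg E x"
proof -
  obtain K where K: "E = K True \<union> K False" "K True \<inter> K False = {}" "\<And>b. D b = dg (K b)"
    using assms(1) unfolding coloring_state_def by blast
  have f: "finite (K b)" for b using assms(2) K(1) by (cases b) auto
  have "{e \<in> E. x \<in> e} = {e \<in> K True. x \<in> e} \<union> {e \<in> K False. x \<in> e}" using K(1) by blast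
  moreover have "{e \<in> K True. x \<in> e} \<inter> {e \<in> K False. x \<in> e} = {}" using K(2) by blast
  ultimately have "dg E x = dg (K True) x + dg (K False) x"
    using f by (simp add: dg_def card_Un_disjoint)
  then show ?thesis using K(3) by (cases b) auto
qed

lemma state_le2: "coloring_state E D s \<Longrightarrow> D b x \<le> 2"
  unfolding coloring_state_def using path_cover_dg_le2 by fastforce

lemma state_partner:
  assumes "coloring_state E D s" "D b x \<le> 1"
  shows "D b (s b x) = D b x" "s b (s b x) = x" "s b x = x \<longleftrightarrow> D b x = 0"
proof -
  obtain K where "\<And>b. path_cover (K b) (s b)" "\<And>b. D b = dg (K b)"
    using assms(1) unfolding coloring_state_def by blast
  then show "D b (s b x) = D b x" "s b (s b x) = x" "s b x = x \<longleftrightarrow> D b x = 0"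
    using path_cover_partner[of "K b" "s b" x] assms(2) by auto
qed

lemma state_add:
  assumes "coloring_state E D s" "finite E" "x \<noteq> y" "{x, y} \<notin> E" "D b x \<le> 1" "D b y \<le> 1" "s b x \<noteq> y"
  shows "coloring_state (insert {x, y} E) (D(b := (D b)(x := Suc (D b x), y := Suc (D b y))))
     (s(b := (s b)(s b x := s b y, s b y := s b x)))"
proof -
  obtain K where K: "E = K True \<union> K False" "K True \<inter> K False = {}" "\<And>b. path_cover (K b) (s b)" "\<And>b. D b = dg (K b)"
    using assms(1) unfolding coloring_state_def by blast
  have f: "finite (K c)" for c using assms(2) K(1) by (cases c) auto
  have n: "{x, y} \<notin> K c" for c using assms(4) K(1) by (cases c) auto
  let ?K = "K(b := insert {x, y} (K b))"
  have "insert {x, y} E = ?K True \<union> ?K False" "?K True \<inter> ?K False = {}"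
    using K(1,2) n by (cases b; auto)+
  moreover have "path_cover (insert {x, y} (K b)) ((s b)(s b x := s b y, s b y := s b x))"
    by (rule path_cover_add) (use K(3,4) assms in auto)
  moreover have "dg (insert {x, y} (K b)) = (D b)(x := Suc (D b x), y := Suc (D b y))"
    using dg_insert[OF f n[of b], of ] K(4) assms(3) by (auto simp: fun_eq_iff)
  ultimately show ?thesis
    unfolding coloring_state_def by (intro exI[of _ ?K]) (use K(3,4) in auto)
qed

text \<open>The colour of the deleted edge is whatever the state gave it, hence existential. The
  lower bounds in the conclusion make the subtractions on natural numbers exact.\<close>

lemma state_delete:
  assumes "coloring_state E D s" "finite E" "x \<noteq> y" "{x, y} \<in> E"
  shows "\<exists>b s'. coloring_state (E - {{x, y}}) (D(b := (D b)(x := D b x - 1, y := D b y - 1))) s'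
     \<and> D b x \<ge> 1 \<and> D b y \<ge> 1"
proof -
  obtain K where K: "E = K True \<union> K False" "K True \<inter> K False = {}" "\<And>b. path_cover (K b) (s b)" "\<And>b. D b = dg (K b)"
    using assms(1) unfolding coloring_state_def by blast
  have f: "finite (K c)" for c using assms(2) K(1) by (cases c) auto
  obtain b where b: "{x, y} \<in> K b" using assms(4) K(1) by blast
  have n: "{x, y} \<notin> K (\<not> b)" using b K(2) by (cases b) auto
  obtain t where t: "path_cover (K b - {{x, y}}) t" using path_cover_delete[OF K(3)] by blast
  let ?K = "K(b := K b - {{x, y}})"
  have u: "E - {{x, y}} = ?K True \<union> ?K False" "?K True \<inter> ?K False = {}"
    using K(1,2) n by (cases b; auto)+
  have d: "D b z = dg (K b - {{x, y}}) z + (if z = x \<or> z = y then 1 else 0)" for z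
    using dg_insert[of "K b - {{x, y}}" x y z] f b K(4) by (simp add: insert_absorb)
  have "dg (K b - {{x, y}}) z = ((D b)(x := D b x - 1, y := D b y - 1)) z" for z
    using d[of z] assms(3) by (cases "z = x"; cases "z = y") simp_all
  then have D: "(D b)(x := D b x - 1, y := D b y - 1) = dg (K b - {{x, y}})" by (intro ext) simp
  have "coloring_state (E - {{x, y}}) (D(b := (D b)(x := D b x - 1, y := D b y - 1))) (s(b := t))"
    unfolding coloring_state_def D
    by (intro exI[of _ ?K] conjI allI u) (use K(3,4) t in simp_all)
  moreover have "D b x \<ge> 1" "D b y \<ge> 1" using d[of x] d[of y] by simp_all
  ultimately show ?thesis by blast
qed

lemma state_zero:
  assumes "coloring_state E D s" "finite E" "dg E u = 0"
  shows "D b u = 0" "s b u = u"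
  using state_degree[OF assms(1,2), of b u] state_partner(3)[OF assms(1), of b u] assms(3) by auto

definition attach :: "'a \<Rightarrow> 'a \<Rightarrow> 'a \<Rightarrow> 'a set set \<Rightarrow> 'a set set" where
  "attach u p q E = insert {u, p} (insert {u, q} E)"

lemma attach_commute: "attach u p q E = attach u q p E"
  by (auto simp: attach_def)

lemma attach_facts:
  assumes "sgraph E" "dg E u = 0" "u \<noteq> p" "u \<noteq> q" "p \<noteq> q"
  shows "sgraph (attach u p q E)"
    and "dg (attach u p q E) x = (if x = u then 2 else if x = p \<or> x = q then Suc (dg E x) else dg E x)"
    and "{u, p} \<notin> insert {u, q} E" "{u, q} \<notin> E"
proof -
  have f: "finite E" using assms by (auto simp: sgraph_def)
  have n: "{u, z} \<notin> E" for z using assms(2) dg_eq_0_iff[OF f, of u] by blast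
  show 1: "{u, p} \<notin> insert {u, q} E" "{u, q} \<notin> E" using n assms by (auto simp: doubleton_eq_iff)
  show "sgraph (attach u p q E)" using assms by (auto simp: sgraph_def attach_def)
  show "dg (attach u p q E) x = (if x = u then 2 else if x = p \<or> x = q then Suc (dg E x) else dg E x)"
    unfolding attach_def using dg_insert[OF _ 1(1), of x] dg_insert[OF f 1(2), of x] f assms(2-5) by auto
qed

text \<open>As \<open>u\<close> is isolated, it is its own partner in both colours and neither edge
  can close a cycle. In colour \<open>b\<close> it takes over from \<open>p\<close> as the end of
  the path of \<open>p\<close>, in the other colour from \<open>q\<close>.\<close>

lemma state_attach:
  assumes st: "coloring_state E D s" and E: "sgraph E" "dg E u = 0" "u \<noteq> p" "u \<noteq> q" "p \<noteq> q"
    and pq: "D b p \<le> 1" "D (\<not> b) q \<le> 1"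
  shows "coloring_state (attach u p q E)
     (\<lambda>c. if c = b then (D c)(u := 1, p := Suc (D c p)) else (D c)(u := 1, q := Suc (D c q)))
     (\<lambda>c. if c = b then (s c)(u := s c p, s c p := u) else (s c)(u := s c q, s c q := u))"
proof -
  have f: "finite E" using E(1) by (auto simp: sgraph_def)
  note n = attach_facts(3,4)[OF E]
  note z = state_zero[OF st f E(2)]
  let ?D = "D(\<not> b := (D (\<not> b))(u := Suc (D (\<not> b) u), q := Suc (D (\<not> b) q)))"
  let ?s = "s(\<not> b := (s (\<not> b))(s (\<not> b) u := s (\<not> b) q, s (\<not> b) q := s (\<not> b) u))"
  have "coloring_state (insert {u, q} E) ?D ?s"
    by (rule state_add[OF st f]) (use E n z pq in auto)
  then have "coloring_state (insert {u, p} (insert {u, q} E))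
      (?D(b := (?D b)(u := Suc (?D b u), p := Suc (?D b p))))
      (?s(b := (?s b)(?s b u := ?s b p, ?s b p := ?s b u)))"
    by (rule state_add) (use E n z pq f in auto)
  moreover have "?D(b := (?D b)(u := Suc (?D b u), p := Suc (?D b p))) =
    (\<lambda>c. if c = b then (D c)(u := 1, p := Suc (D c p)) else (D c)(u := 1, q := Suc (D c q)))"
    using z by (auto simp: fun_eq_iff)
  moreover have "?s(b := (?s b)(?s b u := ?s b p, ?s b p := ?s b u)) =
    (\<lambda>c. if c = b then (s c)(u := s c p, s c p := u) else (s c)(u := s c q, s c q := u))"
    using z by (auto simp: fun_eq_iff)
  ultimately show ?thesis unfolding attach_def by simp
qed

text \<open>Here a cycle can arise, namely if \<open>p\<close> and \<open>q\<close> are the two ends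
  of one path of colour \<open>b\<close>; this is what \<open>s b p \<noteq> q\<close> rules
  out.\<close>

lemma state_attach_same:
  assumes st: "coloring_state E D s" and E: "sgraph E" "dg E u = 0" "u \<noteq> p" "u \<noteq> q" "p \<noteq> q"
    and pq: "D b p \<le> 1" "D b q \<le> 1" "s b p \<noteq> q"
  shows "\<exists>s'. coloring_state (attach u p q E)
     (D(b := (D b)(u := 2, p := Suc (D b p), q := Suc (D b q)))) s'"
proof -
  have f: "finite E" using E(1) by (auto simp: sgraph_def)
  note n = attach_facts(3,4)[OF E]
  note z = state_zero[OF st f E(2)]
  have sq: "s b q \<noteq> p" using state_partner(2)[OF st pq(2)] pq(3) by auto
  let ?D = "D(b := (D b)(u := Suc (D b u), q := Suc (D b q)))"
  let ?s = "s(b := (s b)(s b u := s b q, s b q := s b u))"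
  have "coloring_state (insert {u, q} E) ?D ?s"
    by (rule state_add[OF st f]) (use E n z pq in auto)
  then have "coloring_state (insert {u, p} (insert {u, q} E))
      (?D(b := (?D b)(u := Suc (?D b u), p := Suc (?D b p))))
      (?s(b := (?s b)(?s b u := ?s b p, ?s b p := ?s b u)))"
    by (rule state_add) (use E n z pq f sq in auto)
  moreover have "?D(b := (?D b)(u := Suc (?D b u), p := Suc (?D b p))) =
    D(b := (D b)(u := 2, p := Suc (D b p), q := Suc (D b q)))"
    using z E by (auto simp: fun_eq_iff)
  ultimately show ?thesis unfolding attach_def by metis
qed

text \<open>Colour degrees after attaching \<open>u\<close> to \<open>p\<close> and
  \<open>q\<close>: \<open>split_degree\<close> if the edge to \<open>p\<close> has colour
  \<open>b\<close> and the edge to \<open>q\<close> the other one, \<open>join_degree\<close> below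
  if both have colour \<open>b\<close>.\<close>

abbreviation split_degree :: "bool \<Rightarrow> 'a \<Rightarrow> 'a \<Rightarrow> 'a \<Rightarrow> (bool \<Rightarrow> 'a \<Rightarrow> nat) \<Rightarrow> bool \<Rightarrow> 'a \<Rightarrow> nat" where
  "split_degree b u p q D c x \<equiv> (if x = u then 1 else if x = p then (if c = b then Suc (D c x) else D c x)
     else if x = q then (if c = b then D c x else Suc (D c x)) else D c x)"

abbreviation join_degree :: "bool \<Rightarrow> 'a \<Rightarrow> 'a \<Rightarrow> 'a \<Rightarrow> (bool \<Rightarrow> 'a \<Rightarrow> nat) \<Rightarrow> bool \<Rightarrow> 'a \<Rightarrow> nat" where
  "join_degree b u p q D c x \<equiv> (if x = u then (if c = b then 2 else 0)
     else if x = p \<or> x = q then (if c = b then Suc (D c x) else D c x) else D c x)"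

lemma state_attachE:
  assumes "coloring_state E D s" "sgraph E" "dg E u = 0" "u \<noteq> p" "u \<noteq> q" "p \<noteq> q"
    "D b p \<le> 1" "D (\<not> b) q \<le> 1"
  obtains D' s' where "coloring_state (attach u p q E) D' s'"
    "\<And>c x. D' c x = split_degree b u p q D c x"
    "\<And>c. s' c = (if c = b then (s c)(u := s c p, s c p := u) else (s c)(u := s c q, s c q := u))"
  by (rule that[OF state_attach[OF assms]]) (use assms in auto)

lemma state_attach_sameE:
  assumes "coloring_state E D s" "sgraph E" "dg E u = 0" "u \<noteq> p" "u \<noteq> q" "p \<noteq> q"
    "D b p \<le> 1" "D b q \<le> 1" "s b p \<noteq> q"
  obtains D' s' where "coloring_state (attach u p q E) D' s'"
    "\<And>c x. D' c x = join_degree b u p q D c x"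
proof -
  have "finite E" using assms(2) by (simp add: sgraph_def)
  note z = state_zero(1)[OF assms(1) this assms(3)]
  obtain s' where s': "coloring_state (attach u p q E) (D(b := (D b)(u := 2, p := Suc (D b p), q := Suc (D b q)))) s'"
    using state_attach_same[OF assms] by blast
  show ?thesis by (rule that[OF s']) (use assms(4-6) z in auto)
qed

abbreviation is_open :: "'a set set \<Rightarrow> 'a \<Rightarrow> bool" where
  "is_open E x \<equiv> dg E x = 2 \<or> dg E x = 3"

text \<open>Vertices of degree 2 or 3 are open.  The function \<open>f\<close> prescribes for each open vertex the
  colour in which it has degree 1; for a vertex of degree 3 this is the colour of its next edge, and
  a vertex of degree 2 violates the prescription iff it is monochromatic.\<close>

definition obeys :: "bool \<Rightarrow> 'a set set \<Rightarrow> (bool \<Rightarrow> 'a \<Rightarrow> nat) \<Rightarrow> ('a \<Rightarrow> bool) \<Rightarrow> 'a \<Rightarrow> bool" where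
  "obeys Z E D f d \<longleftrightarrow> (\<forall>x. is_open E x \<longrightarrow> D (f x) x = 1 \<or> (\<not> Z \<and> x = d))"

abbreviation colorable :: "bool \<Rightarrow> 'a set set \<Rightarrow> ('a \<Rightarrow> bool) \<Rightarrow> bool" where
  "colorable Z E f \<equiv> \<exists>D s d. coloring_state E D s \<and> obeys Z E D f d"

definition matching :: "('a \<Rightarrow> 'a) \<Rightarrow> 'a set \<Rightarrow> bool" where
  "matching m S \<longleftrightarrow> (\<forall>x\<in>S. m x \<in> S \<and> m x \<noteq> x \<and> m (m x) = x)"

definition separates :: "('a \<Rightarrow> 'a) \<Rightarrow> 'a set \<Rightarrow> ('a \<Rightarrow> bool) \<Rightarrow> bool" where
  "separates m S f \<longleftrightarrow> (\<forall>x\<in>S. f (m x) = (\<not> f x))"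

text \<open>The flag \<open>Z\<close> lets one set of extension lemmas serve two defects: with
  \<open>True\<close> no violation is tolerated (defect 1), with \<open>False\<close> a single one
  at an uncontrolled vertex (defect 2). The matching is chosen before \<open>f\<close>, so every
  extension step has to rewire it uniformly for all prescriptions.\<close>

definition flexible :: "bool \<Rightarrow> 'a set set \<Rightarrow> bool" where
  "flexible Z E \<longleftrightarrow> (\<exists>m. matching m {x. dg E x = 3} \<and>
     (\<forall>f. separates m {x. dg E x = 3} f \<longrightarrow> colorable Z E f))"

lemma obeys_at: "obeys Z E D f d \<Longrightarrow> is_open E x \<Longrightarrow> x \<noteq> d \<Longrightarrow> D (f x) x = 1"
  by (auto simp: obeys_def)

text \<open>A frame rule: only the vertices of \<open>S\<close> have to be checked. If the old
  violation \<open>d\<close> lies in \<open>S\<close>, it may have been repaired or moved, so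
  \<open>Z\<close> may even be stricter than \<open>Z0\<close>; otherwise it stays where it is and
  is tolerated as before.\<close>

lemma obeysI:
  assumes "obeys Z0 E D g d" "d \<in> S \<or> (d' = d \<and> (Z \<longrightarrow> Z0))"
    and "\<And>x. x \<notin> S \<Longrightarrow> dg E' x = dg E x" "\<And>c x. x \<notin> S \<Longrightarrow> D' c x = D c x" "\<And>x. x \<notin> S \<Longrightarrow> g x = f x"
    and "\<And>x. x \<in> S \<Longrightarrow> is_open E' x \<Longrightarrow> D' (f x) x = 1 \<or> (\<not> Z \<and> x = d')"
  shows "obeys Z E' D' f d'"
  unfolding obeys_def
proof (intro allI impI)
  fix x assume x: "is_open E' x"
  show "D' (f x) x = 1 \<or> (\<not> Z \<and> x = d')"
  proof (cases "x \<in> S")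
    case True then show ?thesis using assms(6) x by blast
  next
    case False
    then have "is_open E x" using assms(3) x by simp
    then have "D (g x) x = 1 \<or> (\<not> Z0 \<and> x = d)" using assms(1) unfolding obeys_def by blast
    then show ?thesis using False assms(2,4,5) by auto
  qed
qed

lemma state_open:
  assumes "coloring_state E D s" "finite E"
  shows "dg E x = 2 \<Longrightarrow> D b x = 1 \<Longrightarrow> D c x = 1"
    and "dg E x = 2 \<Longrightarrow> D b x \<noteq> 1 \<Longrightarrow> (D b x = 0 \<and> D (\<not> b) x = 2) \<or> (D b x = 2 \<and> D (\<not> b) x = 0)"
    and "dg E x = 3 \<Longrightarrow> D b x = 1 \<Longrightarrow> D (\<not> b) x = 2"
    and "dg E x = 3 \<Longrightarrow> D b x \<noteq> 1 \<Longrightarrow> D b x = 2 \<and> D (\<not> b) x = 1"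
  using state_degree[OF assms, of b x] state_le2[OF assms(1), of b x] state_le2[OF assms(1), of "\<not> b" x]
  by (cases "b = c"; auto)+

section \<open>Extending colorings by vertices of degree 2\<close>

text \<open>In the smaller graph \<open>z\<close> is prescribed the colour \<open>f v\<close>, which
  then goes to the edge \<open>uz\<close>, and the other one to \<open>uv\<close>, so that
  \<open>v\<close> stays open in \<open>f v\<close>. If \<open>z\<close> violates this, the two
  colours are exchanged and the violation moves to \<open>v\<close>. If \<open>v\<close> is
  monochromatic and misses \<open>f v\<close>, both edges take \<open>f v\<close> and
  \<open>u\<close> becomes the violation; if it misses the other colour, that one goes to
  \<open>uv\<close> and the violation stays at \<open>v\<close>.\<close>

lemma extend_double_single:
  assumes E: "sgraph E" and st: "coloring_state E D s" and ob: "obeys Z E D (f(z := f v)) d"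
    and u: "dg E u = 0" and v: "dg E v = 2" and z: "dg E z = 3"
  shows "colorable Z (attach u v z E) f"
proof -
  have fin: "finite E" using E by (simp add: sgraph_def)
  have ne: "u \<noteq> v" "u \<noteq> z" "v \<noteq> z" using u v z by auto
  note dg = attach_facts(2)[OF E u ne]
  note so = state_open[OF st fin]
  let ?e = "f v" and ?S = "{u, v, z}"
  show ?thesis
  proof (cases "D True v = 1")
    case True
    then have v1: "D b v = 1" for b using so(1)[OF v] by blast
    show ?thesis
    proof (cases "D ?e z = 1")
      case z1: True
      obtain D' s' where D': "coloring_state (attach u v z E) D' s'"
        "\<And>c x. D' c x = split_degree (\<not> ?e) u v z D c x"
        by (rule state_attachE[OF st E u ne, of "\<not> ?e"]) (use v1 z1 in auto)
      have "obeys Z (attach u v z E) D' f d"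
        by (rule obeysI[OF ob, where S = ?S]) (use D'(2) dg ne v z v1 in auto)
      then show ?thesis using D'(1) by blast
    next
      case False
      then have d: "d = z" "\<not> Z" using z ob by (auto simp: obeys_def)
      have z1: "D (\<not> ?e) z = 1" using so(4)[OF z False] by simp
      obtain D' s' where D': "coloring_state (attach u v z E) D' s'"
        "\<And>c x. D' c x = split_degree ?e u v z D c x"
        by (rule state_attachE[OF st E u ne, of ?e]) (use v1 z1 in auto)
      have "obeys Z (attach u v z E) D' f v"
        by (rule obeysI[OF ob, where S = ?S]) (use D'(2) dg ne v z v1 d in auto)
      then show ?thesis using D'(1) by blast
    qed
  next
    case False
    then have d: "d = v" "\<not> Z" using ob v ne so(1)[OF v] by (auto simp: obeys_def)
    then have z1: "D ?e z = 1" using obeys_at[OF ob, of z] z ne by auto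
    obtain c where c: "D c v = 0" "D (\<not> c) v = 2" using so(2)[OF v False] by (metis (full_types))
    show ?thesis
    proof (cases "c = ?e")
      case True
      have "s c v \<noteq> z" using state_partner(3)[OF st, of c v] c ne by simp
      then obtain D' s' where D': "coloring_state (attach u v z E) D' s'"
        "\<And>b x. D' b x = join_degree c u v z D b x"
        using state_attach_sameE[OF st E u ne, of c] c z1 True by auto
      have "obeys Z (attach u v z E) D' f u"
        by (rule obeysI[OF ob, where S = ?S]) (use D'(2) dg ne v z c True d in auto)
      then show ?thesis using D'(1) by blast
    next
      case False
      then have ce: "(\<not> c) = ?e" by auto
      obtain D' s' where D': "coloring_state (attach u v z E) D' s'"
        "\<And>b x. D' b x = split_degree c u v z D b x"
        by (rule state_attachE[OF st E u ne, of c]) (use z1 c ce in auto)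
      have "obeys Z (attach u v z E) D' f v"
        by (rule obeysI[OF ob, where S = ?S]) (use D'(2) dg ne v z d in auto)
      then show ?thesis using D'(1) by blast
    qed
  qed
qed

text \<open>If one neighbour \<open>p\<close> is monochromatic and misses \<open>c\<close>, its new
  edge takes \<open>c\<close> and that of the other neighbour \<open>q\<close> takes the other
  colour. Then both have degree 1 exactly in \<open>c\<close>, and since
  \<open>f p \<noteq> f q\<close>, precisely one of them violates the prescription.\<close>

lemma extend_double_double:
  assumes E: "sgraph E" and st: "coloring_state E D s" and ob: "obeys Z E D f d"
    and u: "dg E u = 0" and v: "dg E v = 2" and w: "dg E w = 2" and vw: "v \<noteq> w" and f: "f v \<noteq> f w"
  shows "colorable Z (attach u v w E) f"
proof -
  have fin: "finite E" using E by (simp add: sgraph_def)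
  note so = state_open[OF st fin]
  have mono: "colorable Z (attach u p q E) f"
    if p: "dg E p = 2" "dg E q = 2" "p \<noteq> q" "f p \<noteq> f q" "D True p \<noteq> 1" for p q
  proof -
    have ne: "u \<noteq> p" "u \<noteq> q" using u p by auto
    note dg = attach_facts(2)[OF E u ne p(3)]
    have d: "d = p" "\<not> Z" using ob p so(1)[OF p(1)] by (auto simp: obeys_def)
    have q1: "D b q = 1" for b
      using obeys_at[OF ob, of q] p d so(1)[OF p(2)] by auto
    obtain c where c: "D c p = 0" "D (\<not> c) p = 2" using so(2)[OF p(1) p(5)] by (metis (full_types))
    obtain D' s' where D': "coloring_state (attach u p q E) D' s'"
      "\<And>b x. D' b x = split_degree c u p q D b x"
      by (rule state_attachE[OF st E u ne p(3), of c]) (use c q1 in auto)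
    have "obeys Z (attach u p q E) D' f (if f p = c then q else p)"
      by (rule obeysI[OF ob, where S = "{u, p, q}"]) (use D'(2) dg ne p c q1 d in auto)
    then show ?thesis using D'(1) by blast
  qed
  consider "D True v \<noteq> 1" | "D True w \<noteq> 1" | "D True v = 1" "D True w = 1" by blast
  then show ?thesis
  proof cases
    case 1 then show ?thesis using mono[OF v w vw f] by simp
  next
    case 2 then show ?thesis using mono[OF w v] vw f attach_commute[of u v w E] by metis
  next
    case 3
    have ne: "u \<noteq> v" "u \<noteq> w" using u v w by auto
    note dg = attach_facts(2)[OF E u ne vw]
    have v1: "D b v = 1" "D b w = 1" for b using 3 so(1)[OF v] so(1)[OF w] by blast+
    obtain D' s' where D': "coloring_state (attach u v w E) D' s'"
      "\<And>b x. D' b x = split_degree (\<not> f v) u v w D b x"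
      by (rule state_attachE[OF st E u ne vw, of "\<not> f v"]) (use v1 in auto)
    have "obeys Z (attach u v w E) D' f d"
      by (rule obeysI[OF ob, where S = "{u, v, w}"]) (use D'(2) dg ne v1 v w vw f in auto)
    then show ?thesis using D'(1) by blast
  qed
qed

lemma attach_attach_commute: "attach u p q (attach u' p' q' E) = attach u' p' q' (attach u p q E)"
  by (auto simp: attach_def)

lemma attach_branch_facts:
  assumes E: "sgraph E" and u: "dg E u = 0" "dg E u' = 0" "u \<noteq> u'"
    and v: "dg E v = 2" and z: "dg E z = 3" "dg E y = 3" "z \<noteq> y"
  shows "u \<noteq> v" "u \<noteq> z" "v \<noteq> z" "sgraph (attach u v z E)" "dg (attach u v z E) u' = 0"
    "u' \<noteq> v" "u' \<noteq> y" "v \<noteq> y" "u' \<noteq> z" "u \<noteq> y"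
    "dg (attach u' v y (attach u v z E)) x =
      (if x = u \<or> x = u' then 2 else if x = v \<or> x = z \<or> x = y then 4 else dg E x)"
proof -
  show ne: "u \<noteq> v" "u \<noteq> z" "v \<noteq> z" "u' \<noteq> v" "u' \<noteq> y" "v \<noteq> y" "u' \<noteq> z" "u \<noteq> y" using u v z by auto
  note d1 = attach_facts(2)[OF E u(1) ne(1,2,3)]
  show s1: "sgraph (attach u v z E)" by (rule attach_facts(1)[OF E u(1) ne(1,2,3)])
  show u1: "dg (attach u v z E) u' = 0" using d1 u ne by simp
  show "dg (attach u' v y (attach u v z E)) x =
      (if x = u \<or> x = u' then 2 else if x = v \<or> x = z \<or> x = y then 4 else dg E x)"
    using attach_facts(2)[OF s1 u1 ne(4,5,6), of x] d1[of x] u v z ne by auto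
qed

text \<open>The vertices \<open>v\<close>, \<open>z\<close>, \<open>y\<close> all reach degree 4, so
  both colours must be used up at each of them. If \<open>v\<close> is monochromatic, the colour it
  misses is open at \<open>z\<close> or at \<open>y\<close>; the new vertex on that side takes it
  twice and becomes the violation. If \<open>z\<close> is the violation, \<open>z\<close> and
  \<open>y\<close> are open in the same colour, and one of the new vertices must take that colour
  twice.\<close>

lemma extend_branch:
  assumes E: "sgraph E" and st: "coloring_state E D s" and ob: "obeys Z E D f d"
    and u: "dg E u = 0" "dg E u' = 0" "u \<noteq> u'" and v: "dg E v = 2"
    and z: "dg E z = 3" "dg E y = 3" "z \<noteq> y" "f z \<noteq> f y"
  shows "colorable Z (attach u' v y (attach u v z E)) f"
proof -
  have fin: "finite E" using E by (simp add: sgraph_def)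
  note so = state_open[OF st fin]
  let ?A = "\<lambda>u u' z y. attach u' v y (attach u v z E)"
  have mono: "colorable Z (?A u u' z y) f"
    if u: "dg E u = 0" "dg E u' = 0" "u \<noteq> u'" and z: "dg E z = 3" "dg E y = 3" "z \<noteq> y" "f z \<noteq> f y"
      and c: "D (f z) v = 0" for u u' z y
  proof -
    note dd = attach_branch_facts[OF E u v z(1-3)]
    let ?c = "f z"
    have "D (f v) v \<noteq> 1" using c so(1)[OF v, of "f v" "f z"] by auto
    then have d: "d = v" "\<not> Z" using ob v by (auto simp: obeys_def)
    have zy: "D (f z) z = 1" "D (f y) y = 1"
      using obeys_at[OF ob, of z] obeys_at[OF ob, of y] z dd(3,8) d by auto
    have "s ?c v \<noteq> z" using state_partner(3)[OF st, of ?c v] c dd by simp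
    then obtain D1 s1 where D1: "coloring_state (attach u v z E) D1 s1"
      "\<And>b x. D1 b x = join_degree ?c u v z D b x"
      using state_attach_sameE[OF st E u(1) dd(1-3), of ?c] c zy by auto
    obtain D2 s2 where D2: "coloring_state (?A u u' z y) D2 s2"
      "\<And>b x. D2 b x = split_degree ?c u' v y D1 b x"
      by (rule state_attachE[OF D1(1) dd(4-8), of ?c]) (use c zy dd(1-3,6-10) z D1(2) in auto)
    have "obeys Z (?A u u' z y) D2 f u"
      by (rule obeysI[OF ob, where S = "{u, u', v, z, y}"])
        (use D2(2) D1(2) dd(1-3,6-11) u z d in auto)
    then show ?thesis using D2(1) by blast
  qed
  have defect: "colorable Z (?A u u' z y) f"
    if u: "dg E u = 0" "dg E u' = 0" "u \<noteq> u'" and z: "dg E z = 3" "dg E y = 3" "z \<noteq> y" "f z \<noteq> f y"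
      and N: "D True v = 1" and zd: "D (f z) z \<noteq> 1" for u u' z y
  proof -
    note dd = attach_branch_facts[OF E u v z(1-3)]
    let ?c = "f y"
    have d: "d = z" "\<not> Z" using ob zd z by (auto simp: obeys_def)
    have v1: "D b v = 1" for b using N so(1)[OF v] by blast
    have z1: "D ?c z = 1" using so(4)[OF z(1) zd] z(4) by (cases "f z"; cases "f y") auto
    have y1: "D ?c y = 1" using obeys_at[OF ob] z d by auto
    \<comment> \<open>Joining \<open>v\<close> and \<open>z\<close> through \<open>u\<close> in
      colour \<open>?c\<close> closes a cycle just when they are partners. In that case
      \<open>u\<close> is attached with two colours instead; the path of \<open>v\<close> then ends
      in \<open>u\<close>, so \<open>u'\<close> can join \<open>v\<close> and \<open>y\<close> in
      colour \<open>?c\<close>.\<close>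
    show ?thesis
    proof (cases "s ?c v = z")
      case False
      then obtain D1 s1 where D1: "coloring_state (attach u v z E) D1 s1"
        "\<And>b x. D1 b x = join_degree ?c u v z D b x"
        using state_attach_sameE[OF st E u(1) dd(1-3), of ?c] v1 z1 by auto
      obtain D2 s2 where D2: "coloring_state (?A u u' z y) D2 s2"
        "\<And>b x. D2 b x = split_degree (\<not> ?c) u' v y D1 b x"
        by (rule state_attachE[OF D1(1) dd(4-8), of "\<not> ?c"]) (use v1 y1 dd(1-3,6-10) z D1(2) in auto)
      have "obeys Z (?A u u' z y) D2 f u"
        by (rule obeysI[OF ob, where S = "{u, u', v, z, y}"])
          (use D2(2) D1(2) dd(1-3,6-11) u z d in auto)
      then show ?thesis using D2(1) by blast
    next
      case True
      then have zv: "s ?c z = v" using state_partner(2)[OF st, of ?c v] v1 by simp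
      obtain D1 s1 where D1: "coloring_state (attach u v z E) D1 s1"
        "\<And>b x. D1 b x = split_degree (\<not> ?c) u v z D b x"
        "\<And>b. s1 b = (if b = (\<not> ?c) then (s b)(u := s b v, s b v := u) else (s b)(u := s b z, s b z := u))"
        by (rule state_attachE[OF st E u(1) dd(1-3), of "\<not> ?c"]) (use v1 z1 in auto)
      have "s1 ?c v \<noteq> y" using D1(3) zv dd by simp
      then obtain D2 s2 where D2: "coloring_state (?A u u' z y) D2 s2"
        "\<And>b x. D2 b x = join_degree ?c u' v y D1 b x"
        using state_attach_sameE[OF D1(1) dd(4-8), of ?c] v1 y1 D1(2) dd z by auto
      have "obeys Z (?A u u' z y) D2 f u'"
        by (rule obeysI[OF ob, where S = "{u, u', v, z, y}"])
          (use D2(2) D1(2) dd(1-3,6-11) u z d in auto)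
      then show ?thesis using D2(1) by blast
    qed
  qed
  show ?thesis
  proof (cases "D True v = 1")
    case True
    consider "D (f z) z \<noteq> 1" | "D (f y) y \<noteq> 1" | "D (f z) z = 1" "D (f y) y = 1" by blast
    then show ?thesis
    proof cases
      case 1 then show ?thesis using defect[OF u z True] by simp
    next
      case 2 then show ?thesis
        using defect[OF u(2,1) u(3)[symmetric] z(2,1) z(3)[symmetric] z(4)[symmetric] True]
        by (simp add: attach_attach_commute)
    next
      case 3
      note dd = attach_branch_facts[OF E u v z(1-3)]
      have v1: "D b v = 1" for b using True so(1)[OF v] by blast
      obtain D1 s1 where D1: "coloring_state (attach u v z E) D1 s1"
        "\<And>b x. D1 b x = split_degree (\<not> f z) u v z D b x"
        by (rule state_attachE[OF st E u(1) dd(1-3), of "\<not> f z"]) (use v1 3 in auto)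
      obtain D2 s2 where D2: "coloring_state (?A u u' z y) D2 s2"
        "\<And>b x. D2 b x = split_degree (f z) u' v y D1 b x"
        by (rule state_attachE[OF D1(1) dd(4-8), of "f z"]) (use v1 3 dd(1-3,6-10) z D1(2) in auto)
      have "obeys Z (?A u u' z y) D2 f d"
        by (rule obeysI[OF ob, where S = "{u, u', v, z, y}"])
          (use D2(2) D1(2) dd(1-3,6-11) u z in auto)
      then show ?thesis using D2(1) by blast
    qed
  next
    case False
    then obtain c where "D c v = 0" using so(2)[OF v] by (metis (full_types))
    then have "D (f z) v = 0 \<or> D (f y) v = 0" using z(4) by (cases c; cases "f z"; cases "f y") auto
    then show ?thesis
      using mono[OF u z] mono[OF u(2,1) u(3)[symmetric] z(2,1) z(3)[symmetric] z(4)[symmetric]]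
      by (auto simp: attach_attach_commute)
  qed
qed

lemma attach_twins_facts:
  assumes E: "sgraph E" and u: "dg E u = 0" "dg E u' = 0" "u \<noteq> u'"
    and v: "dg E v = 2" "dg E w = 2" "v \<noteq> w"
  shows "u \<noteq> v" "u \<noteq> w" "sgraph (attach u v w E)" "dg (attach u v w E) u' = 0" "u' \<noteq> v" "u' \<noteq> w"
    "dg (attach u' v w (attach u v w E)) x =
      (if x = u \<or> x = u' then 2 else if x = v \<or> x = w then 4 else dg E x)"
proof -
  show ne: "u \<noteq> v" "u \<noteq> w" "u' \<noteq> v" "u' \<noteq> w" using u v by auto
  note d1 = attach_facts(2)[OF E u(1) ne(1,2) v(3)]
  show s1: "sgraph (attach u v w E)" by (rule attach_facts(1)[OF E u(1) ne(1,2) v(3)])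
  show u1: "dg (attach u v w E) u' = 0" using d1 u ne by simp
  show "dg (attach u' v w (attach u v w E)) x =
      (if x = u \<or> x = u' then 2 else if x = v \<or> x = w then 4 else dg E x)"
    using attach_facts(2)[OF s1 u1 ne(3,4) v(3), of x] d1[of x] u v ne by auto
qed

text \<open>Two vertices attached with opposite colourings use up both colours at \<open>v\<close>
  and \<open>w\<close>. If \<open>v\<close> misses the colour \<open>c\<close>, then
  \<open>u\<close> takes \<open>c\<close> twice and \<open>u'\<close> takes \<open>c\<close> towards
  \<open>v\<close> and the other colour towards \<open>w\<close>; the violation passes from
  \<open>v\<close> to \<open>u\<close>.\<close>

lemma extend_twins:
  assumes E: "sgraph E" and st: "coloring_state E D s" and ob: "obeys Z E D f d"
    and u: "dg E u = 0" "dg E u' = 0" "u \<noteq> u'" and v: "dg E v = 2" "dg E w = 2" "v \<noteq> w"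
  shows "colorable Z (attach u' v w (attach u v w E)) f"
proof -
  have fin: "finite E" using E by (simp add: sgraph_def)
  note so = state_open[OF st fin]
  let ?A = "\<lambda>v w. attach u' v w (attach u v w E)"
  have mono: "colorable Z (?A v w) f"
    if v: "dg E v = 2" "dg E w = 2" "v \<noteq> w" and c: "D c v = 0" for v w c
  proof -
    note dd = attach_twins_facts[OF E u v]
    have "D (f v) v \<noteq> 1" using c so(1)[OF v(1), of "f v" c] by auto
    then have d: "d = v" "\<not> Z" using ob v by (auto simp: obeys_def)
    have w1: "D b w = 1" for b using obeys_at[OF ob, of w] v so(1)[OF v(2)] d by simp
    have "s c v \<noteq> w" using state_partner(3)[OF st, of c v] c v by simp
    then obtain D1 s1 where D1: "coloring_state (attach u v w E) D1 s1"
      "\<And>b x. D1 b x = join_degree c u v w D b x"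
      using state_attach_sameE[OF st E u(1) dd(1,2) v(3), of c] c w1 by auto
    obtain D2 s2 where D2: "coloring_state (?A v w) D2 s2"
      "\<And>b x. D2 b x = split_degree c u' v w D1 b x"
      by (rule state_attachE[OF D1(1) dd(3-6) v(3), of c]) (use c w1 dd v D1(2) in auto)
    have "obeys Z (?A v w) D2 f u"
      by (rule obeysI[OF ob, where S = "{u, u', v, w}"]) (use D2(2) D1(2) dd(1,2,5-7) u v d in auto)
    then show ?thesis using D2(1) by blast
  qed
  show ?thesis
  proof (cases "D True v = 1 \<and> D True w = 1")
    case True
    note dd = attach_twins_facts[OF E u v]
    have v1: "D b v = 1" "D b w = 1" for b using True so(1)[OF v(1)] so(1)[OF v(2)] by blast+
    obtain D1 s1 where D1: "coloring_state (attach u v w E) D1 s1"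
      "\<And>b x. D1 b x = (if x = u then 1 else if x = v then (if b = True then Suc (D b x) else D b x)
         else if x = w then (if b = True then D b x else Suc (D b x)) else D b x)"
      by (rule state_attachE[OF st E u(1) dd(1,2) v(3), of True]) (use v1 in auto)
    obtain D2 s2 where D2: "coloring_state (?A v w) D2 s2"
      "\<And>b x. D2 b x = (if x = u' then 1 else if x = v then (if b = False then Suc (D1 b x) else D1 b x)
         else if x = w then (if b = False then D1 b x else Suc (D1 b x)) else D1 b x)"
      by (rule state_attachE[OF D1(1) dd(3-6) v(3), of False]) (use v1 dd v D1(2) in auto)
    have "obeys Z (?A v w) D2 f d"
      by (rule obeysI[OF ob, where S = "{u, u', v, w}"]) (use D2(2) D1(2) dd(1,2,5-7) u v in auto)
    then show ?thesis using D2(1) by blast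
  next
    case False
    then show ?thesis
      using mono[OF v] mono[OF v(2,1) v(3)[symmetric]] so(2)[OF v(1)] so(2)[OF v(2)]
        attach_commute[of u v w E] attach_commute[of u' v w] by metis
  qed
qed

section \<open>Rewiring the matching along the extension steps\<close>

lemma flexibleI:
  assumes "matching m S" "{x. dg E x = 3} = S"
    "\<And>f. separates m S f \<Longrightarrow> colorable Z E f"
  shows "flexible Z E"
  using assms unfolding flexible_def by blast

text \<open>For steps in which one vertex enters degree 3 while another leaves it: \<open>v\<close>
  inherits the partner of \<open>z\<close>, so the colour of \<open>v\<close> is also the right one
  for \<open>z\<close> in the smaller graph.\<close>

lemma matching_replace:
  assumes m: "matching m S" and z: "z \<in> S" and v: "v \<notin> S"
  obtains m' where "matching m' (insert v (S - {z}))"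
    "\<And>f. separates m' (insert v (S - {z})) f \<Longrightarrow> separates m S (f(z := f v))"
proof -
  let ?S = "insert v (S - {z})"
  have mx: "m x \<in> S" "m x \<noteq> x" "m (m x) = x" "m x \<noteq> v" "x \<noteq> v" if "x \<in> S" for x
    using m that v unfolding matching_def by blast+
  note mz = mx[OF z]
  define m' where "m' x = (if x = v then m z else if m x = z then v else m x)" for x
  have "matching m' ?S"
    unfolding matching_def
  proof
    fix x assume "x \<in> ?S"
    then consider "x = v" | "x \<in> S" "x \<noteq> z" "x \<noteq> v" using mx(5) by blast
    then show "m' x \<in> ?S \<and> m' x \<noteq> x \<and> m' (m' x) = x"
    proof cases
      case 1 then show ?thesis using mz by (simp add: m'_def)
    next
      case 2 then show ?thesis using mx[OF 2(1)] mz by (auto simp: m'_def)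
    qed
  qed
  moreover have "separates m S (f(z := f v))" if f: "separates m' ?S f" for f
    unfolding separates_def
  proof
    have fx: "f (m' x) = (\<not> f x)" if "x \<in> ?S" for x
      using f that unfolding separates_def by blast
    fix x assume x: "x \<in> S"
    show "(f(z := f v)) (m x) = (\<not> (f(z := f v)) x)"
    proof (cases "x = z")
      case True then show ?thesis using fx[of v] mz by (simp add: m'_def)
    next
      case False then show ?thesis using fx[of x] x mx[OF x] by (auto simp: m'_def)
    qed
  qed
  ultimately show ?thesis using that by blast
qed

text \<open>For steps in which two vertices reach degree 3 together: as partners of each other they
  are prescribed different colours, which is just what the extension needs.\<close>

lemma matching_add:
  assumes m: "matching m S" and v: "v \<notin> S" "w \<notin> S" "v \<noteq> w"
  obtains m' where "matching m' (insert v (insert w S))"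
    "\<And>f. separates m' (insert v (insert w S)) f \<Longrightarrow> separates m S f \<and> f v \<noteq> f w"
proof -
  let ?S = "insert v (insert w S)" and ?m = "m(v := w, w := v)"
  have mx: "m x \<in> S" "m x \<noteq> x" "m (m x) = x" "m x \<noteq> v" "m x \<noteq> w" if "x \<in> S" for x
    using m that v unfolding matching_def by blast+
  have "matching ?m ?S"
    unfolding matching_def
  proof
    fix x assume "x \<in> ?S"
    then consider "x = v" | "x = w" | "x \<in> S" "x \<noteq> v" "x \<noteq> w" using v by blast
    then show "?m x \<in> ?S \<and> ?m x \<noteq> x \<and> ?m (?m x) = x"
    proof cases
      case 1 then show ?thesis using v(3) by simp
    next
      case 2 then show ?thesis using v(3) by simp
    next
      case 3 then show ?thesis using mx[OF 3(1)] by simp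
    qed
  qed
  moreover have "separates m S f \<and> f v \<noteq> f w" if f: "separates ?m ?S f" for f
  proof
    have fx: "f (?m x) = (\<not> f x)" if "x \<in> ?S" for x
      using f that unfolding separates_def by blast
    show "f v \<noteq> f w" using fx[of v] v(3) by simp
    show "separates m S f"
      unfolding separates_def
    proof
      fix x assume x: "x \<in> S"
      then have "x \<noteq> v" "x \<noteq> w" using v by blast+
      then show "f (m x) = (\<not> f x)" using fx[of x] x by simp
    qed
  qed
  ultimately show ?thesis using that by blast
qed

lemma flexible_double_single:
  assumes E: "sgraph E" and fl: "flexible Z E" and u: "dg E u = 0" and v: "dg E v = 2" and z: "dg E z = 3"
  shows "flexible Z (attach u v z E)"
proof -
  let ?S = "{x. dg E x = 3}"
  obtain m where m: "matching m ?S"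
    and fm: "\<And>f. separates m ?S f \<Longrightarrow> colorable Z E f"
    using fl unfolding flexible_def by blast
  have ne: "u \<noteq> v" "u \<noteq> z" "v \<noteq> z" using u v z by auto
  have "dg (attach u v z E) x = 3 \<longleftrightarrow> x = v \<or> (dg E x = 3 \<and> x \<noteq> z)" for x
    using attach_facts(2)[OF E u ne, of x] u v z ne
    by (cases "x = u"; cases "x = v"; cases "x = z"; simp)
  then have S': "{x. dg (attach u v z E) x = 3} = insert v (?S - {z})" by blast
  obtain m' where m': "matching m' (insert v (?S - {z}))"
    "\<And>f. separates m' (insert v (?S - {z})) f \<Longrightarrow> separates m ?S (f(z := f v))"
    by (rule matching_replace[OF m, of z v]) (use v z in auto)
  then show ?thesis
    using fm extend_double_single[OF E _ _ u v z] unfolding flexible_def S' by blast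
qed

lemma flexible_double_double:
  assumes E: "sgraph E" and fl: "flexible Z E" and u: "dg E u = 0" and v: "dg E v = 2" "dg E w = 2" "v \<noteq> w"
  shows "flexible Z (attach u v w E)"
proof -
  let ?S = "{x. dg E x = 3}"
  obtain m where m: "matching m ?S"
    and fm: "\<And>f. separates m ?S f \<Longrightarrow> colorable Z E f"
    using fl unfolding flexible_def by blast
  have ne: "u \<noteq> v" "u \<noteq> w" using u v by auto
  have "dg (attach u v w E) x = 3 \<longleftrightarrow> x = v \<or> x = w \<or> dg E x = 3" for x
    using attach_facts(2)[OF E u ne v(3), of x] u v ne
    by (cases "x = u"; cases "x = v"; cases "x = w"; simp)
  then have S': "{x. dg (attach u v w E) x = 3} = insert v (insert w ?S)" by blast
  obtain m' where m': "matching m' (insert v (insert w ?S))"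
    "\<And>f. separates m' (insert v (insert w ?S)) f \<Longrightarrow> separates m ?S f \<and> f v \<noteq> f w"
    by (rule matching_add[OF m, of v w]) (use v in auto)
  show ?thesis
  proof (rule flexibleI[OF m'(1) S'])
    fix f assume "separates m' (insert v (insert w ?S)) f"
    from m'(2)[OF this] obtain D s d where "coloring_state E D s" "obeys Z E D f d" "f v \<noteq> f w"
      using fm by blast
    then show "colorable Z (attach u v w E) f"
      using extend_double_double[OF E _ _ u v] by blast
  qed
qed

text \<open>Both \<open>z\<close> and \<open>y\<close> leave degree 3. If they were partners, the
  pair is dropped; otherwise their former partners are matched with each other. In either case the
  smaller graph gets a separating prescription with different colours at \<open>z\<close> and
  \<open>y\<close>.\<close>

lemma flexible_branch:
  assumes E: "sgraph E" and fl: "flexible Z E" and u: "dg E u = 0" "dg E u' = 0" "u \<noteq> u'"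
    and v: "dg E v = 2" and z: "dg E z = 3" "dg E y = 3" "z \<noteq> y"
  shows "flexible Z (attach u' v y (attach u v z E))" (is "flexible Z ?E")
proof -
  let ?S = "{x. dg E x = 3}" and ?S' = "{x. dg ?E x = 3}"
  obtain m where m: "matching m ?S"
    and fm: "\<And>f. separates m ?S f \<Longrightarrow> colorable Z E f"
    using fl unfolding flexible_def by blast
  have S': "x \<in> ?S' \<longleftrightarrow> x \<in> ?S \<and> x \<noteq> z \<and> x \<noteq> y" for x
    using attach_branch_facts(11)[OF E u v z, of x] u v
    by (cases "x = u"; cases "x = u'"; cases "x = v"; cases "x = z"; cases "x = y"; simp)
  have mx: "m x \<in> ?S" "m x \<noteq> x" "m (m x) = x" if "x \<in> ?S" for x
    using m that unfolding matching_def by blast+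
  have zy: "z \<in> ?S" "y \<in> ?S" using z by auto
  \<comment> \<open>In \<open>?E\<close> the vertices \<open>z\<close> and \<open>y\<close> have
    degree 4, so the prescription used for the smaller graph may be chosen there at will.\<close>
  have ext: "colorable Z ?E f"
    if g: "separates m ?S g" "g z \<noteq> g y" "\<And>x. x \<notin> {z, y} \<Longrightarrow> g x = f x" for f g
  proof -
    obtain D s d where "coloring_state E D s" "obeys Z E D g d" using fm[OF g(1)] by blast
    then obtain D s d where D: "coloring_state ?E D s" "obeys Z ?E D g d"
      using extend_branch[OF E _ _ u v z g(2)] by blast
    have "dg ?E z = 4" "dg ?E y = 4"
      using attach_branch_facts(11)[OF E u v z] attach_branch_facts(2,3,7-10)[OF E u v z] by simp_all
    then have "g x = f x" if "is_open ?E x" for x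
      using that by (intro g(3)) auto
    then have "obeys Z ?E D f d" using D(2) unfolding obeys_def by simp
    then show ?thesis using D(1) by blast
  qed
  show ?thesis
  proof (cases "m z = y")
    case True
    then have my: "m y = z" using mx(3)[OF zy(1)] by simp
    have mo: "m x \<noteq> z" "m x \<noteq> y" if "x \<in> ?S'" for x
      using mx(3)[of x] that S'[of x] True my by auto
    have "matching m ?S'" unfolding matching_def using mx mo S' by blast
    moreover have "colorable Z ?E f" if f: "separates m ?S' f" for f
    proof (rule ext)
      show "separates m ?S (f(z := True, y := False))"
        unfolding separates_def
      proof
        fix x assume x: "x \<in> ?S"
        show "(f(z := True, y := False)) (m x) = (\<not> (f(z := True, y := False)) x)"
        proof (cases "x = z \<or> x = y")
          case True then show ?thesis using \<open>m z = y\<close> my z(3) by auto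
        next
          case False
          then have x': "x \<in> ?S'" using S' x by blast
          then have "f (m x) = (\<not> f x)" using f unfolding separates_def by blast
          then show ?thesis using False mo[OF x'] by simp
        qed
      qed
    qed (use z in auto)
    ultimately show ?thesis unfolding flexible_def by blast
  next
    case False
    have d: "m z \<noteq> z" "m y \<noteq> y" "m z \<noteq> m y" "m y \<noteq> z" "m (m z) = z" "m (m y) = y"
      using mx zy z(3) False by metis+
    let ?m = "m(m z := m y, m y := m z)"
    have in': "m z \<in> ?S'" "m y \<in> ?S'" using S' mx(1)[OF zy(1)] mx(1)[OF zy(2)] d False by auto
    have mo: "m x \<in> ?S'" "m x \<noteq> m z" "m x \<noteq> m y" if "x \<in> ?S'" "x \<noteq> m z" "x \<noteq> m y" for x
    proof -
      have x: "x \<in> ?S" "x \<noteq> z" "x \<noteq> y" using that S' by blast+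
      then show "m x \<noteq> m z" "m x \<noteq> m y" using mx(3) zy by metis+
      have "m x \<noteq> z" "m x \<noteq> y" using that(2,3) mx(3)[OF x(1)] by auto
      then show "m x \<in> ?S'" using S' mx(1)[OF x(1)] by blast
    qed
    have "matching ?m ?S'"
      unfolding matching_def
    proof
      fix x assume x: "x \<in> ?S'"
      consider "x = m z" | "x = m y" "x \<noteq> m z" | "x \<noteq> m z" "x \<noteq> m y" by blast
      then show "?m x \<in> ?S' \<and> ?m x \<noteq> x \<and> ?m (?m x) = x"
      proof cases
        case 1 then show ?thesis using in' d(3) by simp
      next
        case 2 then show ?thesis using in' d(3) by simp
      next
        case 3
        then show ?thesis using mo[OF x] mx S' x by auto
      qed
    qed
    moreover have "colorable Z ?E f" if f: "separates ?m ?S' f" for f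
    proof -
      \<comment> \<open>Each of \<open>z\<close> and \<open>y\<close> receives the colour opposite
        to its old partner. Those partners are now matched, hence differ under \<open>f\<close>, and
        so do \<open>?g z\<close> and \<open>?g y\<close>.\<close>
      let ?g = "f(z := \<not> f (m z), y := \<not> f (m y))"
      have fx: "f (?m x) = (\<not> f x)" if "x \<in> ?S'" for x using f that unfolding separates_def by blast
      have fz: "f (m y) = (\<not> f (m z))" using fx[OF in'(1)] d(3) by simp
      have "separates m ?S ?g"
        unfolding separates_def
      proof
        fix x assume x: "x \<in> ?S"
        consider "x = z" | "x = y" | "x = m z" | "x = m y" | "x \<in> ?S'" "x \<noteq> m z" "x \<noteq> m y"
          using S' x by blast
        then show "?g (m x) = (\<not> ?g x)"
        proof cases
          case 1 then show ?thesis using d z(3) False by auto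
        next
          case 2 then show ?thesis using d z(3) False by auto
        next
          case 3 then show ?thesis using d z(3) False by auto
        next
          case 4 then show ?thesis using d z(3) False by auto
        next
          case 5
          then have "m x \<noteq> z" "m x \<noteq> y" "x \<noteq> z" "x \<noteq> y" using mo(1)[OF 5] S' by blast+
          then show ?thesis using fx[OF 5(1)] 5 by simp
        qed
      qed
      then show ?thesis by (rule ext) (use fz z(3) in auto)
    qed
    ultimately show ?thesis unfolding flexible_def by blast
  qed
qed

text \<open>For steps that leave the set of vertices of degree 3 alone, so that the old matching
  serves again.\<close>

lemma flexible_same_singles:
  assumes "flexible Z E" "\<And>x. dg E' x = 3 \<longleftrightarrow> dg E x = 3"
    "\<And>D s f d. coloring_state E D s \<Longrightarrow> obeys Z E D f d \<Longrightarrow>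
       colorable Z' E' f"
  shows "flexible Z' E'"
  using assms(1,3) unfolding flexible_def assms(2) by meson

lemma flexible_twins:
  assumes E: "sgraph E" and fl: "flexible Z E" and u: "dg E u = 0" "dg E u' = 0" "u \<noteq> u'"
    and v: "dg E v = 2" "dg E w = 2" "v \<noteq> w"
  shows "flexible Z (attach u' v w (attach u v w E))" (is "flexible Z ?E")
proof -
  have "dg ?E x = 3 \<longleftrightarrow> dg E x = 3" for x
    using attach_twins_facts(7)[OF E u v, of x] u v
    by (cases "x = u"; cases "x = u'"; cases "x = v"; cases "x = w"; simp)
  then show ?thesis
    using flexible_same_singles[OF fl] extend_twins[OF E _ _ u v] by blast
qed

section \<open>Steps that raise the defect: subdivided edges, triangles, lollipops\<close>

definition subdivide :: "'a \<Rightarrow> 'a \<Rightarrow> 'a \<Rightarrow> 'a set set \<Rightarrow> 'a set set" where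
  "subdivide u b w E = insert {u, w} (insert {w, b} (E - {{u, b}}))"

lemma subdivide_facts:
  assumes E: "sgraph E" and e: "{u, b} \<in> E" and w: "dg E w = 0"
  shows "u \<noteq> b" "w \<noteq> b" "w \<noteq> u" "sgraph (subdivide u b w E)"
    "{w, b} \<notin> E - {{u, b}}" "{u, w} \<notin> insert {w, b} (E - {{u, b}})"
    "dg E x = dg (E - {{u, b}}) x + (if x = u \<or> x = b then 1 else 0)"
    "dg (subdivide u b w E) x = (if x = w then 2 else dg E x)"
proof -
  have f: "finite E" using E by (simp add: sgraph_def)
  show ub: "u \<noteq> b" using E e by (auto simp: sgraph_def)
  have n: "{w, z} \<notin> E" "{z, w} \<notin> E" for z using w dg_eq_0_iff[OF f, of w] by blast+
  show wn: "w \<noteq> b" "w \<noteq> u" using n e by auto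
  show 1: "{w, b} \<notin> E - {{u, b}}" "{u, w} \<notin> insert {w, b} (E - {{u, b}})"
    using n ub wn by (auto simp: doubleton_eq_iff)
  show "sgraph (subdivide u b w E)" using E wn by (auto simp: sgraph_def subdivide_def)
  show 2: "dg E x = dg (E - {{u, b}}) x + (if x = u \<or> x = b then 1 else 0)" for x
    using dg_insert[of "E - {{u, b}}" u b x] f e by (simp add: insert_absorb)
  show "dg (subdivide u b w E) x = (if x = w then 2 else dg E x)"
    unfolding subdivide_def
    using dg_insert[OF _ 1(2), of x] dg_insert[OF _ 1(1), of x] 2[of x] 2[of w] f w ub wn by auto
qed

text \<open>The edge from \<open>w\<close> to \<open>b\<close> keeps the colour of the old edge, and
  the edge from \<open>u\<close> to \<open>w\<close> takes the colour that \<open>u\<close> lacks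
  after the deletion, so \<open>u\<close> always sees both colours. If \<open>u\<close> was
  monochromatic, the two colours differ and \<open>w\<close> sees both as well; otherwise
  \<open>w\<close> becomes monochromatic.\<close>

lemma state_subdivide:
  assumes E: "sgraph E" and st: "coloring_state E D s" and e: "{u, b} \<in> E" and w: "dg E w = 0" and u: "dg E u = 2"
  shows "\<exists>D' s'. coloring_state (subdivide u b w E) D' s' \<and>
    (\<forall>c x. x \<noteq> u \<longrightarrow> x \<noteq> w \<longrightarrow> D' c x = D c x) \<and> (\<forall>c. D' c u = 1) \<and> (D True u \<noteq> 1 \<longrightarrow> (\<forall>c. D' c w = 1))"
proof -
  have f: "finite E" using E by (simp add: sgraph_def)
  note ff = subdivide_facts[OF E e w]
  note z = state_zero[OF st f w]
  note so = state_open[OF st f]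
  obtain c s1 where D1: "coloring_state (E - {{u, b}}) (D(c := (D c)(u := D c u - 1, b := D c b - 1))) s1"
    "D c u \<ge> 1" "D c b \<ge> 1" using state_delete[OF st f ff(1) e] by blast
  let ?D1 = "D(c := (D c)(u := D c u - 1, b := D c b - 1))"
  have w1: "dg (E - {{u, b}}) w = 0" using ff(7)[of w] w by simp
  note z1 = state_zero(2)[OF D1(1) _ w1]
  have "coloring_state (insert {w, b} (E - {{u, b}}))
     (?D1(c := (?D1 c)(w := Suc (?D1 c w), b := Suc (?D1 c b)))) (s1(c := (s1 c)(s1 c w := s1 c b, s1 c b := s1 c w)))"
    by (rule state_add[OF D1(1)]) (use f ff z z1 state_le2[OF st, of c b] in auto)
  moreover have "?D1(c := (?D1 c)(w := Suc (?D1 c w), b := Suc (?D1 c b))) = D(c := (D c)(u := D c u - 1, w := 1))"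
    using ff(1-3) z D1(3) by (auto simp: fun_eq_iff)
  ultimately obtain s2 where D2: "coloring_state (insert {w, b} (E - {{u, b}})) (D(c := (D c)(u := D c u - 1, w := 1))) s2"
    by auto
  let ?D2 = "D(c := (D c)(u := D c u - 1, w := 1))"
  \<comment> \<open>The colour in which \<open>u\<close> has degree 0 once its edge of colour
    \<open>c\<close> is gone; being its own partner there, \<open>u\<close> cannot close a cycle
    with \<open>w\<close>.\<close>
  define c' where "c' = (if D True u = 1 then c else \<not> c)"
  have Dc: "(D True u = 1 \<and> (\<forall>b. D b u = 1)) \<or> (D True u \<noteq> 1 \<and> D c u = 2 \<and> D (\<not> c) u = 0)"
    using so(1)[OF u] so(2)[OF u, of c] D1(2) by (metis not_one_le_zero)
  have "s2 c' u \<noteq> w"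
  proof -
    have "?D2 c' u = 0" using Dc ff(3)[symmetric] by (auto simp: c'_def)
    then have "s2 c' u = u" using state_partner(3)[OF D2, of c' u] by simp
    then show ?thesis using ff(3) by auto
  qed
  then have "coloring_state (subdivide u b w E)
    (?D2(c' := (?D2 c')(u := Suc (?D2 c' u), w := Suc (?D2 c' w)))) (s2(c' := (s2 c')(s2 c' u := s2 c' w, s2 c' w := s2 c' u)))"
    unfolding subdivide_def
    by (intro state_add[OF D2]) (use f ff(3)[symmetric] ff(6) Dc z in \<open>auto simp: c'_def\<close>)
  moreover have "(?D2(c' := (?D2 c')(u := Suc (?D2 c' u), w := Suc (?D2 c' w)))) k x = D k x"
    if "x \<noteq> u" "x \<noteq> w" for k x using that by auto
  moreover have "(?D2(c' := (?D2 c')(u := Suc (?D2 c' u), w := Suc (?D2 c' w)))) k u = 1" for k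
    using Dc ff(3)[symmetric] by (auto simp: c'_def)
  moreover have "D True u \<noteq> 1 \<Longrightarrow> (?D2(c' := (?D2 c')(u := Suc (?D2 c' u), w := Suc (?D2 c' w)))) k w = 1" for k
    using Dc z ff(3)[symmetric] by (auto simp: c'_def)
  ultimately show ?thesis by blast
qed

text \<open>One more vertex with one more edge raises the defect by 1; the violation that becomes
  admissible is spent on \<open>w\<close>.\<close>

lemma flexible_subdivide:
  assumes E: "sgraph E" and fl: "flexible True E" and e: "{u, b} \<in> E" and w: "dg E w = 0" and u: "dg E u = 2"
  shows "flexible False (subdivide u b w E)"
proof -
  note ff = subdivide_facts[OF E e w]
  have S: "{x. dg (subdivide u b w E) x = 3} = {x. dg E x = 3}" using ff(8) w by auto
  have "colorable False (subdivide u b w E) f"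
    if st: "coloring_state E D s" and ob: "obeys True E D f d" for D s d f
  proof -
    obtain D' s' where D': "coloring_state (subdivide u b w E) D' s'"
      "\<And>c x. x \<noteq> u \<Longrightarrow> x \<noteq> w \<Longrightarrow> D' c x = D c x" "\<And>c. D' c u = 1"
      using state_subdivide[OF E st e w u] by blast
    have "obeys False (subdivide u b w E) D' f w"
      using ob D'(2,3) ff(8) unfolding obeys_def by (metis (full_types))
    then show ?thesis using D'(1) by blast
  qed
  then show ?thesis using flexible_same_singles[OF fl] S by blast
qed

text \<open>The form in which defect 0 is used: subdividing an edge at \<open>v\<close> or hanging a
  triangle on \<open>v\<close> repairs a violation at \<open>v\<close> and creates none. For a
  vertex of degree 2, \<open>D True v \<noteq> 1\<close> says that both its edges have one
  colour.\<close>

definition can_be_mono :: "'a set set \<Rightarrow> 'a \<Rightarrow> bool" where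
  "can_be_mono E v \<longleftrightarrow> (\<exists>m. matching m {x. dg E x = 3} \<and>
     (\<forall>f. separates m {x. dg E x = 3} f \<longrightarrow>
       (\<exists>D s. coloring_state E D s \<and> obeys False E D f v \<and> D True v \<noteq> 1)))"

lemma flexible_subdivide_mono:
  assumes E: "sgraph E" and fl: "can_be_mono E u" and e: "{u, b} \<in> E" and w: "dg E w = 0" and u: "dg E u = 2"
  shows "flexible True (subdivide u b w E)"
proof -
  note ff = subdivide_facts[OF E e w]
  have S: "{x. dg (subdivide u b w E) x = 3} = {x. dg E x = 3}" using ff(8) w by auto
  have "colorable True (subdivide u b w E) f"
    if st: "coloring_state E D s" and ob: "obeys False E D f u" "D True u \<noteq> 1" for D s f
  proof -
    obtain D' s' where D': "coloring_state (subdivide u b w E) D' s'"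
      "\<And>c x. x \<noteq> u \<Longrightarrow> x \<noteq> w \<Longrightarrow> D' c x = D c x" "\<And>c. D' c u = 1" "\<And>c. D' c w = 1"
      using state_subdivide[OF E st e w u] ob(2) by blast
    have "obeys True (subdivide u b w E) D' f u"
      using ob D'(2-4) ff(8) unfolding obeys_def by (metis (full_types))
    then show ?thesis using D'(1) by blast
  qed
  then show ?thesis using fl unfolding flexible_def can_be_mono_def S by meson
qed

lemma state_pendant:
  assumes E: "sgraph E" and st: "coloring_state E D s" and u: "dg E u = 0" "u \<noteq> p" and p: "D b p \<le> 1"
  obtains D' s' where "coloring_state (insert {u, p} E) D' s'"
    "\<And>c x. D' c x = (if x = u then (if c = b then 1 else 0)
       else if x = p then (if c = b then Suc (D c x) else D c x) else D c x)"
proof -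
  have f: "finite E" using E by (simp add: sgraph_def)
  note z = state_zero[OF st f u(1)]
  have "{u, p} \<notin> E" using u(1) dg_eq_0_iff[OF f, of u] by blast
  then have "coloring_state (insert {u, p} E) (D(b := (D b)(u := Suc (D b u), p := Suc (D b p))))
     (s(b := (s b)(s b u := s b p, s b p := s b u)))"
    by (intro state_add[OF st f]) (use u p z in auto)
  then show ?thesis by (rule that) (use z u in auto)
qed

lemma pendant_facts:
  assumes E: "sgraph E" and u: "dg E u = 0" "u \<noteq> p"
  shows "sgraph (insert {u, p} E)" "dg (insert {u, p} E) x = (if x = u then 1 else if x = p then Suc (dg E x) else dg E x)"
    "{u, p} \<notin> E"
proof -
  have f: "finite E" using E by (simp add: sgraph_def)
  show n: "{u, p} \<notin> E" using u(1) dg_eq_0_iff[OF f, of u] by blast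
  show "sgraph (insert {u, p} E)" using E u by (simp add: sgraph_def)
  show "dg (insert {u, p} E) x = (if x = u then 1 else if x = p then Suc (dg E x) else dg E x)"
    using dg_insert[OF f n, of x] u by auto
qed

definition add_triangle :: "'a \<Rightarrow> 'a \<Rightarrow> 'a \<Rightarrow> 'a set set \<Rightarrow> 'a set set" where
  "add_triangle v u w E = attach w v u (insert {u, v} E)"

lemma add_triangle_facts:
  assumes E: "sgraph E" and u: "dg E u = 0" "dg E w = 0" "u \<noteq> w" and v: "v \<noteq> u" "v \<noteq> w"
  shows "sgraph (add_triangle v u w E)"
    "dg (add_triangle v u w E) x = (if x = u \<or> x = w then 2 else if x = v then dg E x + 2 else dg E x)"
    "sgraph (insert {u, v} E)" "dg (insert {u, v} E) w = 0"
proof -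
  note p = pendant_facts[OF E u(1) v(1)[symmetric]]
  show 1: "sgraph (insert {u, v} E)" by (rule p(1))
  show 2: "dg (insert {u, v} E) w = 0" using p(2)[of w] u v by simp
  show "sgraph (add_triangle v u w E)" unfolding add_triangle_def
    by (rule attach_facts(1)[OF 1 2]) (use u v in auto)
  show "dg (add_triangle v u w E) x = (if x = u \<or> x = w then 2 else if x = v then dg E x + 2 else dg E x)"
    unfolding add_triangle_def
    using attach_facts(2)[OF 1 2 v(2)[symmetric] u(3)[symmetric] v(1), of x] p(2)[of x] u v by auto
qed

text \<open>If \<open>v\<close> is monochromatic, then both edges at \<open>v\<close> get the missing colour and the third edge of
  the triangle the other one, so no vertex of the triangle violates the prescription.\<close>

lemma state_add_triangle:
  assumes E: "sgraph E" and st: "coloring_state E D s" and u: "dg E u = 0" "dg E w = 0" "u \<noteq> w" and v: "dg E v = 2"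
  shows "\<exists>D' s'. coloring_state (add_triangle v u w E) D' s' \<and>
    (\<forall>c x. x \<noteq> u \<longrightarrow> x \<noteq> w \<longrightarrow> x \<noteq> v \<longrightarrow> D' c x = D c x) \<and> (\<forall>c. D' c w = 1) \<and> (D True v \<noteq> 1 \<longrightarrow> (\<forall>c. D' c u = 1))"
proof -
  have f: "finite E" using E by (simp add: sgraph_def)
  have ne: "v \<noteq> u" "v \<noteq> w" using u v by auto
  note ff = add_triangle_facts[OF E u ne]
  note so = state_open[OF st f]
  obtain c where c: "(D True v \<noteq> 1 \<and> D c v = 0 \<and> D (\<not> c) v = 2) \<or> (\<forall>b. D b v = 1)"
    using so(1,2)[OF v] by metis
  obtain D1 s1 where D1: "coloring_state (insert {u, v} E) D1 s1"
    "\<And>b x. D1 b x = (if x = u then (if b = c then 1 else 0)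
       else if x = v then (if b = c then Suc (D b x) else D b x) else D b x)"
    by (rule state_pendant[OF E st u(1) ne(1)[symmetric], of c]) (use c in auto)
  define b where "b = (if D True v = 1 then \<not> c else c)"
  obtain D2 s2 where D2: "coloring_state (add_triangle v u w E) D2 s2"
    "\<And>k x. D2 k x = split_degree b w v u D1 k x"
    unfolding add_triangle_def
    by (rule state_attachE[OF D1(1) ff(3,4), of v u b]) (use c u ne D1(2) in \<open>auto simp: b_def\<close>)
  have "D True v \<noteq> 1 \<Longrightarrow> D2 k u = 1" for k using D2(2) D1(2) u ne by (auto simp: b_def)
  then show ?thesis using D2 D1(2) by (intro exI[of _ D2] exI[of _ s2]) auto
qed

lemma
  assumes E: "sgraph E" and u: "dg E u = 0" "dg E w = 0" "u \<noteq> w" and v: "dg E v = 2"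
  shows flexible_triangle: "flexible True E \<Longrightarrow> flexible False (add_triangle v u w E)"
    and flexible_triangle_mono: "can_be_mono E v \<Longrightarrow> flexible True (add_triangle v u w E)"
proof -
  let ?E = "add_triangle v u w E"
  have ne: "v \<noteq> u" "v \<noteq> w" using u v by auto
  note ff = add_triangle_facts[OF E u ne]
  have S: "dg ?E x = 3 \<longleftrightarrow> dg E x = 3" for x using ff(2)[of x] u v by auto
  have 1: "\<exists>D' s'. coloring_state ?E D' s' \<and> obeys False ?E D' f u \<and> (D True v \<noteq> 1 \<longrightarrow> obeys True ?E D' f u)"
    if st: "coloring_state E D s" and ob: "obeys False E D f v" for D s f
  proof -
    obtain D' s' where D': "coloring_state ?E D' s'"
      "\<And>c x. x \<noteq> u \<Longrightarrow> x \<noteq> w \<Longrightarrow> x \<noteq> v \<Longrightarrow> D' c x = D c x" "\<And>c. D' c w = 1"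
      "D True v \<noteq> 1 \<Longrightarrow> \<forall>c. D' c u = 1"
      using state_add_triangle[OF E st u v] by blast
    have "dg ?E v = 4" using ff(2)[of v] v ne by simp
    moreover have "D' (f x) x = 1" if "is_open ?E x" "x \<noteq> u" "x \<noteq> v" for x
    proof (cases "x = w")
      case True then show ?thesis using D'(3) by simp
    next
      case False
      then have "is_open E x" using that ff(2)[of x] by auto
      then show ?thesis using obeys_at[OF ob, of x] that D'(2) False by simp
    qed
    ultimately have ob': "D' (f x) x = 1" if "is_open ?E x" "x \<noteq> u" for x
      using that by (cases "x = v") auto
    then have "obeys False ?E D' f u" by (auto simp: obeys_def)
    moreover have "obeys True ?E D' f u" if "D True v \<noteq> 1"
      using ob' D'(4)[OF that] unfolding obeys_def by metis
    ultimately show ?thesis using D'(1) by blast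
  qed
  show "flexible False ?E" if "flexible True E"
  proof (rule flexible_same_singles[OF that S])
    fix D s f d assume "coloring_state E D s" "obeys True E D f d"
    moreover from this have "obeys False E D f v" by (auto simp: obeys_def)
    ultimately show "colorable False ?E f" using 1 by blast
  qed
  show "flexible True ?E" if "can_be_mono E v"
    using that 1 unfolding flexible_def can_be_mono_def S by meson
qed

lemma lollipop_facts:
  assumes E: "sgraph E" and a: "dg E a = 0" "dg E u = 0" "dg E w = 0" "a \<noteq> u" "a \<noteq> w" "u \<noteq> w"
    and p: "dg E p \<noteq> 0"
  shows "sgraph (insert {a, p} E)" "dg (insert {a, p} E) u = 0" "dg (insert {a, p} E) w = 0"
    "a \<noteq> p" "u \<noteq> p" "w \<noteq> p"
    "dg (add_triangle a u w (insert {a, p} E)) x =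
      (if x = u \<or> x = w then 2 else if x = a then 3 else if x = p then Suc (dg E x) else dg E x)"
proof -
  show ne: "a \<noteq> p" "u \<noteq> p" "w \<noteq> p" using a p by auto
  note f = pendant_facts[OF E a(1) ne(1)]
  show 1: "sgraph (insert {a, p} E)" "dg (insert {a, p} E) u = 0" "dg (insert {a, p} E) w = 0"
    using f(1) f(2)[of u] f(2)[of w] a ne by auto
  show "dg (add_triangle a u w (insert {a, p} E)) x =
      (if x = u \<or> x = w then 2 else if x = a then 3 else if x = p then Suc (dg E x) else dg E x)"
    using add_triangle_facts(2)[OF 1 a(6,4,5), of x] f(2)[of x] by auto
qed

text \<open>The edge \<open>ap\<close> has colour \<open>e\<close>, the edges \<open>au\<close> and
  \<open>aw\<close> the other one, and \<open>uw\<close> has colour \<open>e\<close> again. Thus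
  \<open>u\<close> and \<open>w\<close> see both colours and \<open>a\<close> is left open in
  \<open>e\<close>, whatever \<open>e\<close> is.\<close>

lemma state_lollipop:
  assumes E: "sgraph E" and st: "coloring_state E D s"
    and a: "dg E a = 0" "dg E u = 0" "dg E w = 0" "a \<noteq> u" "a \<noteq> w" "u \<noteq> w"
    and p: "dg E p \<noteq> 0" "D e p \<le> 1"
  obtains D' s' where "coloring_state (add_triangle a u w (insert {a, p} E)) D' s'"
    "\<And>c x. D' c x = (if x = u \<or> x = w then 1 else if x = a then (if c = e then 1 else 2)
       else if x = p then (if c = e then Suc (D c x) else D c x) else D c x)"
proof -
  note ff = lollipop_facts[OF E a p(1)]
  obtain D1 s1 where D1: "coloring_state (insert {a, p} E) D1 s1"
    "\<And>c x. D1 c x = (if x = a then (if c = e then 1 else 0)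
       else if x = p then (if c = e then Suc (D c x) else D c x) else D c x)"
    by (rule state_pendant[OF E st a(1) ff(4), of e]) (use p in auto)
  obtain D2 s2 where D2: "coloring_state (insert {u, a} (insert {a, p} E)) D2 s2"
    "\<And>c x. D2 c x = (if x = u then (if c = (\<not> e) then 1 else 0)
       else if x = a then (if c = (\<not> e) then Suc (D1 c x) else D1 c x) else D1 c x)"
    by (rule state_pendant[OF ff(1) D1(1) ff(2) a(4)[symmetric], of "\<not> e"]) (use D1(2) in auto)
  note tf = add_triangle_facts[OF ff(1-3) a(6,4,5)]
  obtain D3 s3 where D3: "coloring_state (attach w a u (insert {u, a} (insert {a, p} E))) D3 s3"
    "\<And>c x. D3 c x = split_degree (\<not> e) w a u D2 c x"
    by (rule state_attachE[OF D2(1) tf(3,4), of a u "\<not> e"]) (use a D2(2) D1(2) in auto)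
  show ?thesis
    by (rule that[of D3 s3]) (use D1(2) D2(2) D3 a ff(4-6) in \<open>auto simp: add_triangle_def\<close>)
qed

text \<open>The vertex \<open>a\<close> arrives with degree 3 and needs a partner. If
  \<open>p\<close> had degree 3, it is closed now and \<open>a\<close> takes its place in the
  matching; if \<open>p\<close> had degree 2, it reaches degree 3 and is matched with
  \<open>a\<close>.\<close>

lemma flexible_lollipop:
  assumes E: "sgraph E" and fl: "flexible False E"
    and a: "dg E a = 0" "dg E u = 0" "dg E w = 0" "a \<noteq> u" "a \<noteq> w" "u \<noteq> w"
    and p: "is_open E p"
  shows "flexible False (add_triangle a u w (insert {a, p} E))" (is "flexible False ?E")
proof -
  let ?S = "{x. dg E x = 3}"
  have f: "finite E" using E by (simp add: sgraph_def)
  have p0: "dg E p \<noteq> 0" using p by auto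
  note ff = lollipop_facts[OF E a p0]
  obtain m where m: "matching m ?S"
    and fm: "\<And>f. separates m ?S f \<Longrightarrow> colorable False E f"
    using fl unfolding flexible_def by blast
  show ?thesis
  proof (cases "dg E p = 3")
    case p3: True
    have "dg ?E x = 3 \<longleftrightarrow> x = a \<or> (dg E x = 3 \<and> x \<noteq> p)" for x
      using ff(4-6) ff(7)[of x] a p3
      by (cases "x = u"; cases "x = w"; cases "x = a"; cases "x = p"; simp)
    then have S': "{x. dg ?E x = 3} = insert a (?S - {p})" by blast
    obtain m' where m': "matching m' (insert a (?S - {p}))"
      "\<And>f. separates m' (insert a (?S - {p})) f \<Longrightarrow> separates m ?S (f(p := f a))"
      by (rule matching_replace[OF m, of p a]) (use a p3 in auto)
    show ?thesis
    proof (rule flexibleI[OF m'(1) S'])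
      fix f assume "separates m' (insert a (?S - {p})) f"
      from m'(2)[OF this] obtain D s d where st: "coloring_state E D s" and ob: "obeys False E D (f(p := f a)) d"
        using fm by blast
      note so = state_open[OF st f]
      \<comment> \<open>The one colour still free at \<open>p\<close>, which then becomes the open
        colour of \<open>a\<close>. It differs from \<open>f a\<close> only if \<open>p\<close> was
        the violation, which then moves to \<open>a\<close>.\<close>
      define e where "e = (if D (f a) p = 1 then f a else \<not> f a)"
      have e: "D e p = 1" using so(4)[OF p3] by (auto simp: e_def)
      obtain D' s' where D': "coloring_state ?E D' s'"
        "\<And>c x. D' c x = (if x = u \<or> x = w then 1 else if x = a then (if c = e then 1 else 2)
          else if x = p then (if c = e then Suc (D c x) else D c x) else D c x)"
        by (rule state_lollipop[OF E st a p0, of e]) (use e in auto)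
      have "e = f a \<or> d = p" using ob p3 by (auto simp: e_def obeys_def)
      then have "obeys False ?E D' f (if d = p then a else d)"
        by (intro obeysI[OF ob, where S = "{a, u, w, p}"]) (use D'(2) ff(4-7) a p3 in auto)
      then show "colorable False ?E f" using D'(1) by blast
    qed
  next
    case False
    then have p2: "dg E p = 2" using p by simp
    have "dg ?E x = 3 \<longleftrightarrow> x = a \<or> x = p \<or> dg E x = 3" for x
      using ff(4-6) ff(7)[of x] a p2
      by (cases "x = u"; cases "x = w"; cases "x = a"; cases "x = p"; simp)
    then have S': "{x. dg ?E x = 3} = insert a (insert p ?S)" by blast
    obtain m' where m': "matching m' (insert a (insert p ?S))"
      "\<And>f. separates m' (insert a (insert p ?S)) f \<Longrightarrow> separates m ?S f \<and> f a \<noteq> f p"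
      by (rule matching_add[OF m, of a p]) (use a p2 ff(4) in auto)
    show ?thesis
    proof (rule flexibleI[OF m'(1) S'])
      fix f assume "separates m' (insert a (insert p ?S)) f"
      from m'(2)[OF this] obtain D s d where st: "coloring_state E D s" and ob: "obeys False E D f d"
        and fa: "f a \<noteq> f p" using fm by blast
      note so = state_open[OF st f]
      \<comment> \<open>A monochromatic \<open>p\<close> has to take the new edge in its missing
        colour \<open>e\<close>. Then \<open>p\<close> and \<open>a\<close> are both open in
        \<open>e\<close>, and as \<open>f a \<noteq> f p\<close>, just one of them is a violation. A
        \<open>p\<close> that sees both colours can take \<open>f a\<close>, which satisfies
        both.\<close>
      obtain e where e: "(D True p = 1 \<and> (\<forall>c. D c p = 1) \<and> e = f a) \<or> (d = p \<and> D e p = 0 \<and> D (\<not> e) p = 2)"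
      proof (cases "D True p = 1")
        case True then show ?thesis using that so(1)[OF p2] by blast
      next
        case False
        then have "d = p" using ob p2 so(1)[OF p2] by (auto simp: obeys_def)
        then show ?thesis using that so(2)[OF p2 False] by (metis (full_types))
      qed
      obtain D' s' where D': "coloring_state ?E D' s'"
        "\<And>c x. D' c x = (if x = u \<or> x = w then 1 else if x = a then (if c = e then 1 else 2)
          else if x = p then (if c = e then Suc (D c x) else D c x) else D c x)"
        by (rule state_lollipop[OF E st a p0, of e]) (use e in auto)
      have "obeys False ?E D' f (if D True p = 1 then d else if f p = e then a else p)"
      proof (cases "D True p = 1")
        case True
        then have "\<And>c. D c p = 1" "e = f a" using so(1)[OF p2] e by auto
        then show ?thesis
          by (intro obeysI[OF ob, where S = "{a, u, w, p}"]) (use D'(2) ff(4-7) a p2 fa True in auto)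
      next
        case False
        then have "d = p" "D e p = 0" "D (\<not> e) p = 2" using e by auto
        then show ?thesis
          by (intro obeysI[OF ob, where S = "{a, u, w, p}"]) (use D'(2) ff(4-7) a p2 fa False in auto)
      qed
      then show "colorable False ?E f" using D'(1) by blast
    qed
  qed
qed

section \<open>Graphs with \<open>2n - 3\<close> edges\<close>

definition core :: "'a set set \<Rightarrow> bool" where
  "core E \<longleftrightarrow> sgraph E \<and> (\<forall>x. dg E x \<le> 4 \<and> dg E x \<noteq> 1)"

text \<open>An end of a path of colour \<open>b\<close> has at most two edges of the other colour,
  hence degree at most 3, and degree 1 is excluded in a \<open>core\<close>. So within each colour
  the partner map pairs off open vertices.\<close>

lemma end_partner:
  assumes "core E" "coloring_state E D s" "D b x = 1"
  shows "s b x \<noteq> x" "D b (s b x) = 1" "s b (s b x) = x" "is_open E (s b x)"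
proof -
  have f: "finite E" using assms(1) by (auto simp: core_def sgraph_def)
  show 1: "s b x \<noteq> x" "D b (s b x) = 1" "s b (s b x) = x"
    using state_partner[OF assms(2), of b x] assms(3) by auto
  have "dg E (s b x) \<le> 4" "dg E (s b x) \<noteq> 1" using assms(1) by (auto simp: core_def)
  then show "is_open E (s b x)"
    using state_degree[OF assms(2) f, of b "s b x"] state_le2[OF assms(2), of "\<not> b" "s b x"] 1(2) by auto
qed

text \<open>Under such a coloring a new vertex can be joined to \<open>v\<close> and
  \<open>t\<close> in colour \<open>b\<close> without closing a cycle, provided both have degree at
  most 1 in that colour. Nothing else about the partner map has to be carried through the
  induction.\<close>

definition neutral_avoiding :: "'a set set \<Rightarrow> ('a \<Rightarrow> bool) \<Rightarrow> bool \<Rightarrow> 'a \<Rightarrow> 'a \<Rightarrow> bool" where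
  "neutral_avoiding E f b v t \<longleftrightarrow> (\<exists>D s. coloring_state E D s \<and> obeys True E D f v \<and> s b v \<noteq> t)"

text \<open>The missing colour \<open>b\<close> is specified because the next vertex attached to
  \<open>m\<close> will use it: there \<open>m\<close> is its own partner, so an edge of colour
  \<open>b\<close> at \<open>m\<close> is always safe.\<close>

definition mono_at :: "'a set set \<Rightarrow> ('a \<Rightarrow> bool) \<Rightarrow> bool \<Rightarrow> 'a \<Rightarrow> bool" where
  "mono_at E f b m \<longleftrightarrow> (\<exists>D s. coloring_state E D s \<and> obeys False E D f m \<and> D b m = 0)"

lemma neutral_avoidingE:
  assumes "neutral_avoiding E f b v t"
  obtains D s where "coloring_state E D s" "obeys True E D f v" "s b v \<noteq> t"
  using assms unfolding neutral_avoiding_def by blast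

lemma mono_atE:
  assumes "mono_at E f b m"
  obtains D s where "coloring_state E D s" "obeys False E D f m" "D b m = 0"
  using assms unfolding mono_at_def by blast

text \<open>The three possible kinds of graphs with \<open>2n - 3\<close> edges: there the degrees left open sum up to 6,
  and for each of the possible distributions the listed prescriptions are realisable.\<close>

definition profile1 :: "'a set set \<Rightarrow> 'a \<Rightarrow> bool" where
  "profile1 E v \<longleftrightarrow>
     (\<forall>x. dg E x = 2 \<longleftrightarrow> x = v) \<and> card {x. dg E x = 3} = 4 \<and> can_be_mono E v \<and>
     (\<forall>a x b. dg E a = 3 \<longrightarrow> dg E x = 3 \<longrightarrow> x \<noteq> a \<longrightarrow> neutral_avoiding E ((\<lambda>_. b)(a := \<not> b)) b v x)"

text \<open>The prescriptions are dictated by parity: in either colour the number of open vertices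
  of degree 1 is even, all vertices of degree 4 having degree 2 there. Without a violation
  \<open>z\<close> and \<open>y\<close> must therefore be prescribed the same colour, with
  \<open>v\<close> or \<open>w\<close> monochromatic different ones.\<close>

definition profile2 :: "'a set set \<Rightarrow> 'a \<Rightarrow> 'a \<Rightarrow> 'a \<Rightarrow> 'a \<Rightarrow> bool" where
  "profile2 E v w z y \<longleftrightarrow> v \<noteq> w \<and> z \<noteq> y \<and>
     (\<forall>x. dg E x = 2 \<longleftrightarrow> x = v \<or> x = w) \<and> (\<forall>x. dg E x = 3 \<longleftrightarrow> x = z \<or> x = y) \<and>
     (\<forall>t\<in>{w, z, y}. \<forall>b. neutral_avoiding E (\<lambda>_. b) b v t) \<and>
     (\<forall>m\<in>{v, w}. \<forall>q\<in>{z, y}. \<forall>b. mono_at E ((\<lambda>_. \<not> b)(q := b)) b m)"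

text \<open>If all three vertices of degree 2 saw both colours, each colour would have an odd number
  of path ends. So a violation is forced, and \<open>mono_at\<close> is all that can be asked
  for.\<close>

definition profile3 :: "'a set set \<Rightarrow> 'a \<Rightarrow> 'a \<Rightarrow> 'a \<Rightarrow> bool" where
  "profile3 E v w o' \<longleftrightarrow> v \<noteq> w \<and> v \<noteq> o' \<and> w \<noteq> o' \<and>
     (\<forall>x. dg E x = 2 \<longleftrightarrow> x = v \<or> x = w \<or> x = o') \<and> (\<forall>x. dg E x \<noteq> 3) \<and>
     (\<forall>m\<in>{v, w, o'}. \<forall>b. mono_at E (\<lambda>_. b) b m)"

lemma profile2_neutral: "profile2 E v w z y \<Longrightarrow> t = w \<or> t = z \<or> t = y \<Longrightarrow> neutral_avoiding E (\<lambda>_. b) b v t"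
  unfolding profile2_def by blast

lemma profile2_mono: "profile2 E v w z y \<Longrightarrow> m = v \<or> m = w \<Longrightarrow> q = z \<or> q = y \<Longrightarrow> mono_at E ((\<lambda>_. \<not> b)(q := b)) b m"
  unfolding profile2_def by blast

lemma profile3_mono: "profile3 E v w o' \<Longrightarrow> m = v \<or> m = w \<or> m = o' \<Longrightarrow> mono_at E (\<lambda>_. b) b m"
  unfolding profile3_def by blast

lemma profile2_distinct:
  assumes "profile2 E v w z y"
  shows "v \<noteq> w" "z \<noteq> y" "v \<noteq> z" "v \<noteq> y" "w \<noteq> z" "w \<noteq> y"
    "dg E v = 2" "dg E w = 2" "dg E z = 3" "dg E y = 3"
    "dg E x = 2 \<longleftrightarrow> x = v \<or> x = w" "dg E x = 3 \<longleftrightarrow> x = z \<or> x = y"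
proof -
  show 1: "v \<noteq> w" "z \<noteq> y" "dg E v = 2" "dg E w = 2" "dg E z = 3" "dg E y = 3"
    "dg E x = 2 \<longleftrightarrow> x = v \<or> x = w" "dg E x = 3 \<longleftrightarrow> x = z \<or> x = y" for x
    using assms unfolding profile2_def by blast+
  show "v \<noteq> z" "v \<noteq> y" "w \<noteq> z" "w \<noteq> y" using 1(3-6) by auto
qed

lemma profile2_commute: "profile2 E v w z y \<Longrightarrow> profile2 E v w y z"
  unfolding profile2_def by blast

text \<open>The four open vertices are all ends in colour \<open>b\<close>, and on them
  \<open>s b\<close> is an involution without fixed points, that is, a perfect matching of four
  points; one pair determines the other.\<close>

lemma profile2_ends:
  assumes "core E" "profile2 E v w z y" "coloring_state E D s" "obeys True E D (\<lambda>_. b) d"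
    and "distinct [x, t, x', t']" "{x, t, x', t'} = {v, w, z, y}"
  shows "s b x \<noteq> t \<longleftrightarrow> s b x' \<noteq> t'"
proof -
  have op: "is_open E r \<longleftrightarrow> r \<in> {x, t, x', t'}" for r
    unfolding assms(6) using profile2_distinct(11,12)[OF assms(2), of r] by blast
  then have D1: "D b r = 1" if "r \<in> {x, t, x', t'}" for r
    using assms(4) that unfolding obeys_def by blast
  note e = end_partner[OF assms(1,3) D1]
  have p: "s b r \<in> {x, t, x', t'}" "s b r \<noteq> r" "s b (s b r) = r" if "r \<in> {x, t, x', t'}" for r
    using e[OF that] op by blast+
  have claim: "s b q = r" if "s b p = k" "{p, k, q, r} = {x, t, x', t'}" "distinct [p, k, q, r]" for p k q r
  proof -
    have in': "p \<in> {x, t, x', t'}" "q \<in> {x, t, x', t'}" unfolding that(2)[symmetric] by blast+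
    have "s b k = p" using p(3)[OF in'(1)] that(1) by simp
    then have "s b q \<noteq> p" "s b q \<noteq> k" using p(3)[OF in'(2)] that(1,3) by auto
    then show ?thesis using p(1,2)[OF in'(2)] unfolding that(2)[symmetric] by blast
  qed
  have "{x', t', x, t} = {x, t, x', t'}" "distinct [x', t', x, t]" using assms(5) by auto
  then have "s b x = t \<Longrightarrow> s b x' = t'" "s b x' = t' \<Longrightarrow> s b x = t"
    using claim[of x t x' t'] claim[of x' t' x t] assms(5) by simp_all
  then show ?thesis by blast
qed

text \<open>Only the neutral part treats \<open>v\<close> and \<open>w\<close> differently. A
  partner to be avoided at \<open>w\<close> is translated into one to be avoided at \<open>v\<close>
  by passing to the complementary pair.\<close>

lemma profile2_swap:
  assumes "core E" "profile2 E v w z y"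
  shows "profile2 E w v z y"
proof -
  note ne = profile2_distinct[OF assms(2)]
  have "neutral_avoiding E (\<lambda>_. b) b w t" if t: "t \<in> {v, z, y}" for t b
  proof -
    \<comment> \<open>The partner of \<open>v\<close> in the pairing of the four ends that joins
      \<open>w\<close> to \<open>t\<close>.\<close>
    define t' where "t' = (if t = v then w else if t = z then y else z)"
    have "neutral_avoiding E (\<lambda>_. b) b v t'"
      by (rule profile2_neutral[OF assms(2)]) (auto simp: t'_def)
    then obtain D s where D: "coloring_state E D s" "obeys True E D (\<lambda>_. b) v" "s b v \<noteq> t'"
      by (rule neutral_avoidingE)
    have "s b w \<noteq> t"
    proof (cases "t = v")
      case True
      have "D b w = 1" using D(2) ne(8) by (simp add: obeys_def)
      then show ?thesis using end_partner(3)[OF assms(1) D(1)] D(3) True by (auto simp: t'_def)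
    next
      case False
      then have "s b v \<noteq> t' \<longleftrightarrow> s b w \<noteq> t"
        by (intro profile2_ends[OF assms D(1,2)]) (use t ne(1-6) in \<open>auto simp: t'_def\<close>)
      then show ?thesis using D(3) by simp
    qed
    moreover have "obeys True E D (\<lambda>_. b) w" using D(2) by (simp add: obeys_def)
    ultimately show ?thesis using D(1) unfolding neutral_avoiding_def by blast
  qed
  then show ?thesis using assms(2) unfolding profile2_def by blast
qed

lemma obeys_weaken: "obeys True E D f d \<Longrightarrow> obeys Z E D f d'"
  by (auto simp: obeys_def)

text \<open>The conclusion \<open>s' b u = s b v\<close> reduces a demand on the partner of the new
  vertex to one on its neighbour in the smaller graph. The premises with \<open>Suc\<close> test the
  prescription at neighbours that are open afterwards.\<close>

lemma neutral_attach:
  assumes E: "sgraph E" and st: "coloring_state E D s" and ob: "obeys Z0 E D g d"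
    and d: "d = v \<or> d = z \<or> (d = d' \<and> (Z \<longrightarrow> Z0))"
    and u: "dg E u = 0" "u \<noteq> v" "u \<noteq> z" "v \<noteq> z" and vz: "D b v \<le> 1" "D (\<not> b) z \<le> 1"
    and g: "\<And>x. x \<noteq> u \<Longrightarrow> x \<noteq> v \<Longrightarrow> x \<noteq> z \<Longrightarrow> g x = f x"
    and v: "Suc (dg E v) = 2 \<or> Suc (dg E v) = 3 \<Longrightarrow> (if f v = b then Suc (D b v) else D (\<not> b) v) = 1"
    and z: "Suc (dg E z) = 2 \<or> Suc (dg E z) = 3 \<Longrightarrow> (if f z = b then D b z else Suc (D (\<not> b) z)) = 1"
  obtains D' s' where "coloring_state (attach u v z E) D' s'" "obeys Z (attach u v z E) D' f d'"
    "s' b u = s b v" "\<And>c x. x \<noteq> u \<Longrightarrow> x \<noteq> v \<Longrightarrow> x \<noteq> z \<Longrightarrow> D' c x = D c x"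
proof -
  obtain D' s' where D': "coloring_state (attach u v z E) D' s'"
    "\<And>c x. D' c x = split_degree b u v z D c x"
    "\<And>c. s' c = (if c = b then (s c)(u := s c v, s c v := u) else (s c)(u := s c z, s c z := u))"
    using state_attachE[OF st E u vz] by blast
  have "D' (f v) v = 1" if "Suc (dg E v) = 2 \<or> Suc (dg E v) = 3"
    using v[OF that] D'(2) u by (cases "f v"; cases b) auto
  moreover have "D' (f z) z = 1" if "Suc (dg E z) = 2 \<or> Suc (dg E z) = 3"
    using z[OF that] D'(2) u by (cases "f z"; cases b) auto
  ultimately have "obeys Z (attach u v z E) D' f d'"
  proof (intro obeysI[OF ob, where S = "{u, v, z}"])
    note dg = attach_facts(2)[OF E u]
    show "d \<in> {u, v, z} \<or> (d' = d \<and> (Z \<longrightarrow> Z0))" using d by auto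
    show "dg (attach u v z E) x = dg E x" "D' c x = D c x" "g x = f x" if "x \<notin> {u, v, z}" for c x
      using that dg[of x] D'(2)[of c x] g[of x] by simp_all
    assume 1: "Suc (dg E v) = 2 \<or> Suc (dg E v) = 3 \<Longrightarrow> D' (f v) v = 1"
      "Suc (dg E z) = 2 \<or> Suc (dg E z) = 3 \<Longrightarrow> D' (f z) z = 1"
    fix x assume "x \<in> {u, v, z}" "is_open (attach u v z E) x"
    then have "D' (f x) x = 1" using 1 dg[of x] D'(2)[of "f x" x] u by (elim insertE emptyE) simp_all
    then show "D' (f x) x = 1 \<or> (\<not> Z \<and> x = d')" ..
  qed
  then show ?thesis by (rule that[OF D'(1)]) (use D'(2,3) in auto)
qed

text \<open>The counterpart in which \<open>u\<close> receives colour \<open>b\<close> twice; it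
  then lacks the other colour and carries the violation, while the neighbours come out as
  prescribed.\<close>

lemma mono_attach:
  assumes E: "sgraph E" and st: "coloring_state E D s" and ob: "obeys False E D g d" and d: "d = v \<or> d = z \<or> d = u"
    and u: "dg E u = 0" "u \<noteq> v" "u \<noteq> z" "v \<noteq> z" and vz: "D b v \<le> 1" "D b z \<le> 1" "s b v \<noteq> z"
    and g: "\<And>x. x \<noteq> u \<Longrightarrow> x \<noteq> v \<Longrightarrow> x \<noteq> z \<Longrightarrow> g x = f x"
    and v: "Suc (dg E v) = 2 \<or> Suc (dg E v) = 3 \<Longrightarrow> (if f v = b then Suc (D b v) else D (\<not> b) v) = 1"
    and z: "Suc (dg E z) = 2 \<or> Suc (dg E z) = 3 \<Longrightarrow> (if f z = b then Suc (D b z) else D (\<not> b) z) = 1"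
  shows "mono_at (attach u v z E) f (\<not> b) u"
proof -
  obtain D' s' where D': "coloring_state (attach u v z E) D' s'"
    "\<And>c x. D' c x = join_degree b u v z D c x"
    using state_attach_sameE[OF st E u vz] by blast
  have "D' (f v) v = 1" if "Suc (dg E v) = 2 \<or> Suc (dg E v) = 3"
    using v[OF that] D'(2) u by (cases "f v"; cases b) auto
  moreover have "D' (f z) z = 1" if "Suc (dg E z) = 2 \<or> Suc (dg E z) = 3"
    using z[OF that] D'(2) u by (cases "f z"; cases b) auto
  ultimately have "obeys False (attach u v z E) D' f u"
    by (intro obeysI[OF ob, where S = "{u, v, z}"])
      (use attach_facts(2)[OF E u] d g D'(2) u in auto)
  moreover have "D' (\<not> b) u = 0" using D'(2) by simp
  ultimately show "mono_at (attach u v z E) f (\<not> b) u" using D'(1) unfolding mono_at_def by blast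
qed

lemma separates_at: "separates m S f \<Longrightarrow> x \<in> S \<Longrightarrow> f (m x) = (\<not> f x)"
  by (simp add: separates_def)

lemma can_be_monoI:
  assumes "matching m S" "{x. dg E x = 3} = S"
    "\<And>f. separates m S f \<Longrightarrow> \<exists>D s b. coloring_state E D s \<and> obeys False E D f v \<and> D b v = 0"
    and v: "dg E v = 2" "finite E"
  shows "can_be_mono E v"
proof -
  have "D True v \<noteq> 1" if "coloring_state E D s" "D b v = 0" for D s b
    using state_open(1)[OF that(1) v(2) v(1), of True b] that(2) by auto
  then show ?thesis using assms unfolding can_be_mono_def by metis
qed

lemma core_sgraph: "core E \<Longrightarrow> sgraph E" "core E \<Longrightarrow> finite E"
  by (auto simp: core_def sgraph_def)

lemma profile2_step_single:
  assumes c: "core E" and P: "profile2 E v w z y" and u: "dg E u = 0"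
  shows "profile2 (attach u v z E) u w v y" (is "profile2 ?E u w v y")
proof -
  note E = core_sgraph(1)[OF c] and fin = core_sgraph(2)[OF c]
  note ne = profile2_distinct(1-10)[OF P] and iff = profile2_distinct(11,12)[OF P]
  have un: "u \<noteq> v" "u \<noteq> z" "u \<noteq> w" "u \<noteq> y" using u ne by auto
  note dg = attach_facts(2)[OF E u un(1,2) ne(3)]
  have dg2: "dg ?E x = 2 \<longleftrightarrow> x = u \<or> x = w" for x
    using dg[of x] iff(1)[of x] u ne un by (cases "x = u"; cases "x = v"; cases "x = z"; simp)
  have dg3: "dg ?E x = 3 \<longleftrightarrow> x = v \<or> x = y" for x
    using dg[of x] iff(2)[of x] u ne un by (cases "x = u"; cases "x = v"; cases "x = z"; simp)
  have neutral: "neutral_avoiding ?E (\<lambda>_. b) b u t" if t: "t \<in> {w, v, y}" for t b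
  proof -
    \<comment> \<open>The edge from \<open>u\<close> to \<open>z\<close> gets colour
      \<open>b\<close>, so \<open>u\<close> inherits the partner of \<open>z\<close>. Here
      \<open>t'\<close> is the partner of \<open>v\<close> in the pairing that joins
      \<open>z\<close> to \<open>t\<close>.\<close>
    define t' where "t' = (if t = v then z else if t = w then y else w)"
    have "neutral_avoiding E (\<lambda>_. b) b v t'"
      by (rule profile2_neutral[OF P]) (auto simp: t'_def)
    then obtain D s where D: "coloring_state E D s" "obeys True E D (\<lambda>_. b) v" "s b v \<noteq> t'"
      by (rule neutral_avoidingE)
    note so = state_open[OF D(1) fin]
    have v1: "D k v = 1" for k using D(2) ne(7) so(1)[OF ne(7), of b k] by (simp add: obeys_def)
    have z1: "D b z = 1" using D(2) ne(9) by (simp add: obeys_def)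
    have "s b z \<noteq> t"
    proof (cases "t = v")
      case True
      then show ?thesis using end_partner(3)[OF c D(1) z1] D(3) by (auto simp: t'_def)
    next
      case False
      then have "s b v \<noteq> t' \<longleftrightarrow> s b z \<noteq> t"
        by (intro profile2_ends[OF c P D(1,2)]) (use t ne(1-6) in \<open>auto simp: t'_def\<close>)
      then show ?thesis using D(3) by simp
    qed
    moreover obtain D' s' where "coloring_state (attach u z v E) D' s'" "obeys True (attach u z v E) D' (\<lambda>_. b) u" "s' b u = s b z"
      by (rule neutral_attach[OF E D(1,2), of z v u True u b "\<lambda>_. b"]) (use u un ne v1 z1 in auto)
    ultimately show ?thesis unfolding neutral_avoiding_def attach_commute[of u v z] by metis
  qed
  have mono: "mono_at ?E ((\<lambda>_. \<not> b)(q := b)) b m" if m: "m \<in> {u, w}" and q: "q \<in> {v, y}" for m q b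
  proof -
    \<comment> \<open>If \<open>w\<close> keeps the violation, \<open>u\<close> receives both
      colours, and \<open>q\<close> decides which one goes to \<open>v\<close>. If \<open>u\<close>
      is to miss \<open>b\<close>, it takes the other colour twice: for \<open>q = y\<close> from a
      coloring where \<open>v\<close> misses that colour, for \<open>q = v\<close> from a neutral
      one where \<open>v\<close> and \<open>z\<close> are not partners.\<close>
    consider "m = w" "q = y" | "m = w" "q = v" | "m = u" "q = y" | "m = u" "q = v" using m q by blast
    then show ?thesis
    proof cases
      case 1
      obtain D s where D: "coloring_state E D s" "obeys False E D ((\<lambda>_. \<not> b)(y := b)) w" "D b w = 0"
        using profile2_mono[OF P, of w y b] by (auto elim: mono_atE)
      note so = state_open[OF D(1) fin]
      have v1: "D k v = 1" for k using obeys_at[OF D(2), of v] ne so(1)[OF ne(7)] by simp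
      have z1: "D (\<not> b) z = 1" using obeys_at[OF D(2), of z] ne by simp
      obtain D' s' where "coloring_state ?E D' s'" "obeys False ?E D' ((\<lambda>_. \<not> b)(y := b)) w"
        "\<And>c x. x \<noteq> u \<Longrightarrow> x \<noteq> v \<Longrightarrow> x \<noteq> z \<Longrightarrow> D' c x = D c x"
        by (rule neutral_attach[OF E D(1,2), of v z w False u b "(\<lambda>_. \<not> b)(y := b)"]) (use u un ne v1 z1 in auto)
      then show ?thesis unfolding mono_at_def using D(3) 1 ne un by metis
    next
      case 2
      obtain D s where D: "coloring_state E D s" "obeys False E D ((\<lambda>_. \<not> b)(z := b)) w" "D b w = 0"
        using profile2_mono[OF P, of w z b] by (auto elim: mono_atE)
      note so = state_open[OF D(1) fin]
      have v1: "D k v = 1" for k using obeys_at[OF D(2), of v] ne so(1)[OF ne(7)] by simp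
      have z1: "D b z = 1" using obeys_at[OF D(2), of z] ne by simp
      obtain D' s' where "coloring_state ?E D' s'" "obeys False ?E D' ((\<lambda>_. \<not> b)(v := b)) w"
        "\<And>c x. x \<noteq> u \<Longrightarrow> x \<noteq> v \<Longrightarrow> x \<noteq> z \<Longrightarrow> D' c x = D c x"
        by (rule neutral_attach[OF E D(1,2), of v z w False u "\<not> b" "(\<lambda>_. \<not> b)(v := b)"]) (use u un ne v1 z1 in auto)
      then show ?thesis unfolding mono_at_def using D(3) 2 ne un by metis
    next
      case 3
      obtain D s where D: "coloring_state E D s" "obeys False E D ((\<lambda>_. b)(z := \<not> b)) v" "D (\<not> b) v = 0"
        using profile2_mono[OF P, of v z "\<not> b"] by (auto elim: mono_atE)
      have z1: "D (\<not> b) z = 1" using obeys_at[OF D(2), of z] ne by simp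
      have w1: "D k w = 1" for k using obeys_at[OF D(2), of w] ne state_open(1)[OF D(1) fin ne(8)] by simp
      have sv: "s (\<not> b) v \<noteq> z" using state_partner(3)[OF D(1), of "\<not> b" v] D(3) ne by simp
      have ob: "obeys False E D ((\<lambda>_. \<not> b)(y := b, z := \<not> b)) v"
        using D(2) w1 ne iff unfolding obeys_def by auto
      have "mono_at ?E ((\<lambda>_. \<not> b)(y := b)) (\<not> \<not> b) u"
        by (rule mono_attach[OF E D(1) ob, of v z u "\<not> b"]) (use u un ne z1 sv D(3) in auto)
      then show ?thesis using 3 by simp
    next
      case 4
      obtain D s where D: "coloring_state E D s" "obeys True E D (\<lambda>_. \<not> b) v" "s (\<not> b) v \<noteq> z"
        using profile2_neutral[OF P, of z "\<not> b"] by (auto elim: neutral_avoidingE)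
      note so = state_open[OF D(1) fin]
      have v1: "D k v = 1" for k using D(2) ne(7) so(1)[OF ne(7), of "\<not> b" k] by (simp add: obeys_def)
      have z1: "D (\<not> b) z = 1" using D(2) ne(9) by (simp add: obeys_def)
      have "mono_at ?E ((\<lambda>_. \<not> b)(v := b)) (\<not> \<not> b) u"
        by (rule mono_attach[OF E D(1) obeys_weaken[OF D(2)], of u v z u "\<not> b"]) (use u un ne z1 v1 D(3) in auto)
      then show ?thesis using 4 by simp
    qed
  qed
  show ?thesis
    unfolding profile2_def using un ne dg2 dg3 neutral mono by blast
qed

lemma profile2_step_double:
  assumes c: "core E" and P: "profile2 E v w z y" and u: "dg E u = 0"
  shows "profile1 (attach u v w E) u" (is "profile1 ?E u")
proof -
  note E = core_sgraph(1)[OF c] and fin = core_sgraph(2)[OF c]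
  note ne = profile2_distinct(1-10)[OF P] and iff = profile2_distinct(11,12)[OF P]
  have un: "u \<noteq> v" "u \<noteq> z" "u \<noteq> w" "u \<noteq> y" using u ne by auto
  note dg = attach_facts(2)[OF E u un(1,3) ne(1)]
  have dg2: "dg ?E x = 2 \<longleftrightarrow> x = u" for x
    using dg[of x] iff(1)[of x] u ne un by (cases "x = u"; cases "x = v"; cases "x = w"; simp)
  have dg3: "dg ?E x = 3 \<longleftrightarrow> x = v \<or> x = w \<or> x = z \<or> x = y" for x
    using dg[of x] iff(2)[of x] u ne un by (cases "x = u"; cases "x = v"; cases "x = w"; simp)
  then have S: "{x. dg ?E x = 3} = {v, w, z, y}" by auto
  \<comment> \<open>The exceptional vertex is one of the two new vertices of degree 3: its edge to
    \<open>u\<close> has colour \<open>b\<close>, so \<open>u\<close> inherits its partner.\<close>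
  have own: "neutral_avoiding (attach u v w E) ((\<lambda>_. b)(v := \<not> b)) b u x"
    if P: "profile2 E v w z y" and x: "x = w \<or> x = z \<or> x = y" for v w x b
  proof -
    note ne = profile2_distinct(1-10)[OF P]
    have un: "u \<noteq> v" "u \<noteq> z" "u \<noteq> w" "u \<noteq> y" using u ne by auto
    obtain D s where D: "coloring_state E D s" "obeys True E D (\<lambda>_. b) v" "s b v \<noteq> x"
      using profile2_neutral[OF P x, of b] by (rule neutral_avoidingE)
    note so = state_open[OF D(1) fin]
    have v1: "D k v = 1" for k using D(2) ne(7) so(1)[OF ne(7), of b k] by (simp add: obeys_def)
    have w1: "D k w = 1" for k using D(2) ne(8) so(1)[OF ne(8), of b k] by (simp add: obeys_def)
    obtain D' s' where "coloring_state (attach u v w E) D' s'"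
      "obeys True (attach u v w E) D' ((\<lambda>_. b)(v := \<not> b)) u" "s' b u = s b v"
      by (rule neutral_attach[OF E D(1,2), of v w u True u b "(\<lambda>_. b)(v := \<not> b)"]) (use u un ne v1 w1 in auto)
    then show ?thesis using D(3) unfolding neutral_avoiding_def by metis
  qed
  \<comment> \<open>The exceptional vertex is an old one. A monochromatic \<open>v\<close> misses
    \<open>b\<close>, and the new edge to \<open>u\<close> is then a whole path of colour
    \<open>b\<close>: the partner of \<open>u\<close> is \<open>v\<close>, hence no other vertex. To
    avoid \<open>v\<close> itself, the roles of \<open>v\<close> and \<open>w\<close> are
    exchanged.\<close>
  have other: "neutral_avoiding (attach u v w E) ((\<lambda>_. b)(y := \<not> b)) b u x"
    if P: "profile2 E v w z y" and x: "x \<noteq> v" for v w z y x b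
  proof -
    note ne = profile2_distinct(1-10)[OF P] and iff = profile2_distinct(11,12)[OF P]
    have un: "u \<noteq> v" "u \<noteq> z" "u \<noteq> w" "u \<noteq> y" using u ne by auto
    obtain D s where D: "coloring_state E D s" "obeys False E D ((\<lambda>_. \<not> b)(z := b)) v" "D b v = 0"
      using profile2_mono[OF P, of v z b] by (auto elim: mono_atE)
    have w1: "D k w = 1" for k using obeys_at[OF D(2), of w] ne state_open(1)[OF D(1) fin ne(8)] by simp
    have z1: "D b z = 1" using obeys_at[OF D(2), of z] ne by simp
    have y1: "D (\<not> b) y = 1" using obeys_at[OF D(2), of y] ne by simp
    have sv: "s b v = v" using state_partner(3)[OF D(1), of b v] D(3) by simp
    obtain D' s' where D': "coloring_state (attach u v w E) D' s'"
      "\<And>c x. D' c x = split_degree b u v w D c x"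
      "\<And>c. s' c = (if c = b then (s c)(u := s c v, s c v := u) else (s c)(u := s c w, s c w := u))"
      by (rule state_attachE[OF D(1) E u un(1,3) ne(1), of b]) (use D(3) w1 in auto)
    note dg = attach_facts(2)[OF E u un(1,3) ne(1)]
    have op: "is_open (attach u v w E) x \<Longrightarrow> x = u \<or> x = v \<or> x = w \<or> x = z \<or> x = y" for x
      using dg[of x] iff[of x] by (cases "x = u"; cases "x = v"; cases "x = w"; simp)
    have "obeys True (attach u v w E) D' ((\<lambda>_. b)(y := \<not> b)) u"
      unfolding obeys_def
    proof (intro allI impI disjI1)
      fix r assume "is_open (attach u v w E) r"
      from op[OF this] show "D' (((\<lambda>_. b)(y := \<not> b)) r) r = 1"
        by (elim disjE) (use D'(2) ne un D(3) w1 z1 y1 in auto)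
    qed
    moreover have "s' b u = v" using D'(3) sv by simp
    ultimately show ?thesis using D'(1) x unfolding neutral_avoiding_def by metis
  qed
  note P' = profile2_swap[OF c P]
  have neutral: "neutral_avoiding ?E ((\<lambda>_. b)(a := \<not> b)) b u x"
    if a: "dg ?E a = 3" and x: "dg ?E x = 3" and ax: "x \<noteq> a" for a x b
  proof -
    have x': "x = v \<or> x = w \<or> x = z \<or> x = y" using x dg3 by blast
    consider "a = v" | "a = w" | "a = z" | "a = y" using a dg3 by blast
    then show ?thesis
    proof cases
      case 1 then show ?thesis using own[OF P, of x b] x' ax by auto
    next
      case 2 then show ?thesis using own[OF P', of x b] x' ax attach_commute[of u v w E] by auto
    next
      case 3
      then show ?thesis
        using other[OF profile2_commute[OF P], of x b] other[OF profile2_commute[OF P'], of x b]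
          attach_commute[of u v w E] ne(1) by (cases "x = v") auto
    next
      case 4
      then show ?thesis
        using other[OF P, of x b] other[OF P', of x b] attach_commute[of u v w E] ne(1) by (cases "x = v") auto
    qed
  qed
  let ?m = "id(v := w, w := v, z := y, y := z)"
  have "can_be_mono ?E u"
  proof (rule can_be_monoI[OF _ S])
    show "matching ?m {v, w, z, y}" using ne by (auto simp: matching_def)
    show "dg ?E u = 2" using dg2 by simp
    show "finite ?E" using fin by (simp add: attach_def)
    fix f assume f: "separates ?m {v, w, z, y} f"
    have fv: "f w = (\<not> f v)" "f y = (\<not> f z)" 
      using separates_at[OF f, of v] separates_at[OF f, of z] ne by simp_all
    let ?b = "f v"
    \<comment> \<open>The partners \<open>z\<close> and \<open>y\<close> have different colours
      under \<open>f\<close>; \<open>q\<close> is the one with colour \<open>?b\<close>, the colour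
      that \<open>v\<close> misses and that \<open>u\<close> then takes twice.\<close>
    define q where "q = (if f z = ?b then z else y)"
    have qzy: "q = z \<or> q = y" by (auto simp: q_def)
    obtain D s where D: "coloring_state E D s" "obeys False E D ((\<lambda>_. \<not> ?b)(q := ?b)) v" "D ?b v = 0"
      using profile2_mono[OF P _ qzy, of v ?b] by (auto elim: mono_atE)
    have w1: "D k w = 1" for k using obeys_at[OF D(2), of w] ne state_open(1)[OF D(1) fin ne(8)] by simp
    have zy: "D (f z) z = 1" "D (f y) y = 1"
      using obeys_at[OF D(2), of z] obeys_at[OF D(2), of y] ne fv by (auto simp: q_def split: if_splits)
    have ob: "obeys False E D f v"
      unfolding obeys_def
    proof (intro allI impI)
      fix r assume "is_open E r"
      then consider "r = v" | "r = w" | "r = z" | "r = y" using iff by blast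
      then show "D (f r) r = 1 \<or> \<not> False \<and> r = v" by cases (use w1 zy in simp_all)
    qed
    have sv: "s ?b v \<noteq> w" using state_partner(3)[OF D(1), of ?b v] D(3) ne by simp
    have "mono_at ?E f (\<not> ?b) u"
      by (rule mono_attach[OF E D(1) ob, of v w u ?b]) (use u un ne w1 sv D(3) fv in auto)
    then show "\<exists>D s b. coloring_state ?E D s \<and> obeys False ?E D f u \<and> D b u = 0"
      unfolding mono_at_def by blast
  qed
  moreover have "card {x. dg ?E x = 3} = 4" unfolding S using ne by simp
  ultimately show ?thesis
    unfolding profile1_def using dg2 neutral by blast
qed

lemma card_4_fourth:
  assumes "card S = 4" "a \<in> S" "x \<in> S" "z \<in> S" "a \<noteq> x" "a \<noteq> z" "x \<noteq> z"
  obtains y where "S = {a, x, z, y}" "y \<noteq> a" "y \<noteq> x" "y \<noteq> z"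
proof -
  have f: "finite S" using assms(1) by (metis card.infinite zero_neq_numeral)
  have "card (S - {a, x, z}) = 1" using assms f by (simp add: card_Diff_subset)
  then obtain y where "S - {a, x, z} = {y}" by (auto simp: card_1_singleton_iff)
  then have "S = {a, x, z, y}" "y \<noteq> a" "y \<noteq> x" "y \<noteq> z" using assms by blast+
  then show ?thesis by (rule that)
qed

lemma profile1_neutral:
  "profile1 E v \<Longrightarrow> dg E a = 3 \<Longrightarrow> dg E x = 3 \<Longrightarrow> x \<noteq> a \<Longrightarrow> neutral_avoiding E ((\<lambda>_. b)(a := \<not> b)) b v x"
  unfolding profile1_def by blast

lemma profile1_step_single:
  assumes c: "core E" and P: "profile1 E v" and u: "dg E u = 0" and z: "dg E z = 3"
  shows "profile1 (attach u v z E) u" (is "profile1 ?E u")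
proof -
  note E = core_sgraph(1)[OF c] and fin = core_sgraph(2)[OF c]
  let ?S = "{x. dg E x = 3}"
  have v: "dg E x = 2 \<longleftrightarrow> x = v" for x using P by (simp add: profile1_def)
  then have v2: "dg E v = 2" by simp
  have S4: "card ?S = 4" using P by (simp add: profile1_def)
  have ne: "u \<noteq> v" "u \<noteq> z" "v \<noteq> z" using u v2 z by auto
  note dg = attach_facts(2)[OF E u ne]
  have dg2: "dg ?E x = 2 \<longleftrightarrow> x = u" for x
    using dg[of x] v[of x] u ne z by (cases "x = u"; cases "x = v"; cases "x = z"; simp)
  have dg3: "dg ?E x = 3 \<longleftrightarrow> x = v \<or> (dg E x = 3 \<and> x \<noteq> z)" for x
    using dg[of x] v2 u ne z by (cases "x = u"; cases "x = v"; cases "x = z"; simp)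
  have S': "{x. dg ?E x = 3} = insert v (?S - {z})" using dg3 by blast
  have fS: "finite ?S" using S4 by (metis card.infinite zero_neq_numeral)
  have card': "card {x. dg ?E x = 3} = 4" unfolding S' using S4 fS z v2 by simp
  have vals: "(\<forall>k. D k v = 1) \<and> (\<forall>x. dg E x = 3 \<longrightarrow> D (f x) x = 1)"
    if "coloring_state E D s" "obeys True E D f v" for D s f
    using that v2 state_open(1)[OF that(1) fin v2] unfolding obeys_def by blast
  \<comment> \<open>With colour \<open>b\<close> on the edge to \<open>z\<close>, the new vertex
    inherits the partner of \<open>z\<close> and \<open>v\<close> remains open in
    \<open>b\<close>.\<close>
  have shift: "neutral_avoiding ?E ((\<lambda>_. b)(a := \<not> b)) b u x"
    if a: "dg E a = 3" "a \<noteq> z" and D: "coloring_state E D s" "obeys True E D ((\<lambda>_. b)(a := \<not> b)) v" "s b z \<noteq> x"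
    for a x b D s
  proof -
    have v1: "D k v = 1" for k using vals[OF D(1,2)] by blast
    have z1: "D b z = 1" using vals[OF D(1,2)] z a(2) by fastforce
    have av: "a \<noteq> v" using a v2 by auto
    obtain D' s' where "coloring_state (attach u z v E) D' s'"
      "obeys True (attach u z v E) D' ((\<lambda>_. b)(a := \<not> b)) u" "s' b u = s b z"
      by (rule neutral_attach[OF E D(1,2), of z v u True u b "(\<lambda>_. b)(a := \<not> b)"]) (use u ne v1 z1 z v2 av in auto)
    then show ?thesis using D(3) unfolding neutral_avoiding_def attach_commute[of u v z] by metis
  qed
  have neutral: "neutral_avoiding ?E ((\<lambda>_. b)(a := \<not> b)) b u x"
    if a: "dg ?E a = 3" and x: "dg ?E x = 3" and ax: "x \<noteq> a" for a x b
  proof -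
    consider "a = v" "dg E x = 3" "x \<noteq> z" | "x = v" "dg E a = 3" "a \<noteq> z"
      | "dg E a = 3" "dg E x = 3" "a \<noteq> z" "x \<noteq> z" using a x ax dg3[of a] dg3[of x] by blast
    then show ?thesis
    proof cases
      case 1
      obtain D s where D: "coloring_state E D s" "obeys True E D ((\<lambda>_. b)(z := \<not> b)) v" "s b v \<noteq> x"
        using profile1_neutral[OF P z 1(2,3), of b] by (rule neutral_avoidingE)
      have v1: "D k v = 1" for k using vals[OF D(1,2)] by blast
      have z1: "D (\<not> b) z = 1" using vals[OF D(1,2)] z by fastforce
      obtain D' s' where "coloring_state ?E D' s'"
        "obeys True ?E D' ((\<lambda>_. b)(v := \<not> b)) u" "s' b u = s b v"
        by (rule neutral_attach[OF E D(1,2), of v z u True u b "(\<lambda>_. b)(v := \<not> b)"]) (use u ne v1 z1 z v2 in auto)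
      then show ?thesis using D(3) 1 unfolding neutral_avoiding_def by metis
    next
      case 2
      obtain D s where D: "coloring_state E D s" "obeys True E D ((\<lambda>_. b)(a := \<not> b)) v" "s b v \<noteq> z"
        using profile1_neutral[OF P 2(2) z 2(3)[symmetric], of b] by (rule neutral_avoidingE)
      have z1: "D b z = 1" using vals[OF D(1,2)] z 2(3) by fastforce
      have "s b z \<noteq> v" using end_partner(3)[OF c D(1) z1] D(3) by auto
      then show ?thesis using shift[OF 2(2,3) D(1,2)] 2 by simp
    next
      case 3
      \<comment> \<open>The ends in colour \<open>b\<close> are \<open>v\<close>, \<open>x\<close>,
        \<open>z\<close> and the remaining vertex \<open>y\<close> of degree 3. If \<open>v\<close>
        is not paired with \<open>y\<close>, it is paired with \<open>x\<close> or \<open>z\<close>,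
        and then \<open>z\<close> is not paired with \<open>x\<close>.\<close>
      obtain y where y: "?S = {a, x, z, y}" "y \<noteq> a" "y \<noteq> x" "y \<noteq> z"
        by (rule card_4_fourth[OF S4, of a x z]) (use 3 z ax in auto)
      then have y3: "dg E y = 3" by blast
      obtain D s where D: "coloring_state E D s" "obeys True E D ((\<lambda>_. b)(a := \<not> b)) v" "s b v \<noteq> y"
        using profile1_neutral[OF P 3(1) y3 y(2), of b] by (rule neutral_avoidingE)
      have ends: "D b r = 1" if "r = v \<or> r = x \<or> r = z \<or> r = y" for r
        using vals[OF D(1,2)] that 3 y3 z ax y by fastforce
      have na: "D b a \<noteq> 1"
        using vals[OF D(1,2)] state_open(3)[OF D(1) fin 3(1), of "\<not> b"] 3(1) by fastforce
      have p: "s b r \<noteq> r" "s b (s b r) = r" "s b r = v \<or> s b r = x \<or> s b r = z \<or> s b r = y"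
        if "r = v \<or> r = x \<or> r = z \<or> r = y" for r
      proof -
        note e = end_partner[OF c D(1) ends[OF that]]
        show "s b r \<noteq> r" "s b (s b r) = r" using e by blast+
        have "s b r \<noteq> a" using e(2) na by auto
        then show "s b r = v \<or> s b r = x \<or> s b r = z \<or> s b r = y" using e(4) v y(1) by blast
      qed
      have "s b z \<noteq> x"
      proof
        assume zx: "s b z = x"
        then have xz: "s b x = z" using p(2)[of z] by simp
        have "s b v = x \<or> s b v = z" using p(1)[of v] p(3)[of v] D(3) by auto
        then show False using p(2)[of v] zx xz v2 3(2) ne by auto
      qed
      then show ?thesis using shift[OF 3(1,3) D(1,2)] by simp
    qed
  qed
  have "can_be_mono ?E u"
  proof -
    have "\<not> ?S \<subseteq> {z}" using card_mono[of "{z}" ?S] S4 by auto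
    then obtain a where a: "dg E a = 3" "a \<noteq> z" by blast
    have "\<not> ?S \<subseteq> {z, a}" using card_mono[of "{z, a}" ?S] S4 a(2) by auto
    then obtain x where x: "dg E x = 3" "x \<noteq> z" "x \<noteq> a" by blast
    obtain y where y: "?S = {a, x, z, y}" "y \<noteq> a" "y \<noteq> x" "y \<noteq> z"
      by (rule card_4_fourth[OF S4, of a x z]) (use a x z in auto)
    then have y3: "dg E y = 3" by blast
    have nv: "v \<noteq> a" "v \<noteq> x" "v \<noteq> y" using a x y3 v2 by auto
    have S'': "{r. dg ?E r = 3} = {v, y, a, x}" unfolding S' using y a x by blast
    let ?m = "id(v := y, y := v, a := x, x := a)"
    show ?thesis
    proof (rule can_be_monoI[OF _ S''])
      show "matching ?m {v, y, a, x}" using nv y x by (auto simp: matching_def)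
      show "dg ?E u = 2" using dg2 by simp
      show "finite ?E" using fin by (simp add: attach_def)
      fix f assume f: "separates ?m {v, y, a, x} f"
      have fy: "f y = (\<not> f v)" "f x = (\<not> f a)" 
        using separates_at[OF f, of v] separates_at[OF f, of a] nv y x by simp_all
      let ?b = "\<not> f v"
      \<comment> \<open>Of the partners \<open>a\<close> and \<open>x\<close>, the one with colour
        \<open>f v\<close>. As \<open>y\<close> has colour \<open>?b\<close> and \<open>z\<close>
        may be prescribed \<open>?b\<close>, the vertex \<open>q\<close> is the single exception
        required by \<open>profile1_neutral\<close>.\<close>
      define q where "q = (if f a = f v then a else x)"
      have q: "dg E q = 3" "q \<noteq> z" using a x by (auto simp: q_def)
      obtain D s where D: "coloring_state E D s" "obeys True E D ((\<lambda>_. ?b)(q := \<not> ?b)) v" "s ?b v \<noteq> z"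
        using profile1_neutral[OF P q(1) z q(2)[symmetric], of ?b] by (rule neutral_avoidingE)
      have v1: "D k v = 1" for k using vals[OF D(1,2)] by blast
      have z1: "D ?b z = 1" using vals[OF D(1,2)] z q(2) by fastforce
      have agree: "((\<lambda>_. ?b)(q := \<not> ?b)) r = f r" if "dg E r = 3" "r \<noteq> z" for r
        using that y(1) fy x(3) y(2,3) by (auto simp: q_def)
      have ob: "obeys False E D (f(z := ?b)) v"
        unfolding obeys_def
      proof (intro allI impI)
        fix r assume "is_open E r"
        then show "D ((f(z := ?b)) r) r = 1 \<or> \<not> False \<and> r = v"
          using v[of r] vals[OF D(1,2)] agree[of r] z1 by (cases "r = z") auto
      qed
      have "mono_at ?E f (\<not> ?b) u"
        by (rule mono_attach[OF E D(1) ob, of v z u ?b]) (use u ne v1 z1 D(3) v2 z in auto)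
      then show "\<exists>D s b. coloring_state ?E D s \<and> obeys False ?E D f u \<and> D b u = 0"
        unfolding mono_at_def by blast
    qed
  qed
  then show ?thesis
    unfolding profile1_def using dg2 card' neutral by blast
qed

lemma profile3_step_double:
  assumes c: "core E" and P: "profile3 E v w o'" and u: "dg E u = 0"
  shows "profile2 (attach u v w E) u o' v w" (is "profile2 ?E u o' v w")
proof -
  note E = core_sgraph(1)[OF c] and fin = core_sgraph(2)[OF c]
  have ne: "v \<noteq> w" "v \<noteq> o'" "w \<noteq> o'" and iff2: "\<And>x. dg E x = 2 \<longleftrightarrow> x = v \<or> x = w \<or> x = o'"
    and no3: "\<And>x. dg E x \<noteq> 3" using P unfolding profile3_def by blast+
  then have d2: "dg E v = 2" "dg E w = 2" "dg E o' = 2" by blast+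
  have un: "u \<noteq> v" "u \<noteq> w" "u \<noteq> o'" using u d2 by auto
  note dg = attach_facts(2)[OF E u un(1,2) ne(1)]
  have dg2: "dg ?E x = 2 \<longleftrightarrow> x = u \<or> x = o'" for x
    using dg[of x] iff2[of x] no3[of x] u ne un d2 by (cases "x = u"; cases "x = v"; cases "x = w"; simp)
  have dg3: "dg ?E x = 3 \<longleftrightarrow> x = v \<or> x = w" for x
    using dg[of x] no3[of x] u ne un d2 by (cases "x = u"; cases "x = v"; cases "x = w"; simp)
  have both: "D k r = 1" if "coloring_state E D s" "obeys False E D f m" "r \<noteq> m" "dg E r = 2" for D s f m k r
    using obeys_at[OF that(2), of r] state_open(1)[OF that(1) fin that(4)] that(3,4) by blast
  \<comment> \<open>The monochromatic \<open>p\<close> misses \<open>b\<close>, so its new edge to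
    \<open>u\<close> is a complete path of colour \<open>b\<close> and the partner of
    \<open>u\<close> can only be \<open>p\<close>.\<close>
  have loop: "neutral_avoiding (attach u p q E) (\<lambda>_. b) b u t"
    if pq: "p \<noteq> q" "dg E p = 2" "dg E q = 2" "p = v \<or> p = w" and t: "t \<noteq> p" for p q t b
  proof -
    have upq: "u \<noteq> p" "u \<noteq> q" using u pq by auto
    obtain D s where D: "coloring_state E D s" "obeys False E D (\<lambda>_. b) p" "D b p = 0"
      using profile3_mono[OF P, of p b] pq(4) by (auto elim: mono_atE)
    have q1: "D k q = 1" for k using both[OF D(1,2)] pq by auto
    have sp: "s b p = p" using state_partner(3)[OF D(1), of b p] D(3) by simp
    obtain D' s' where "coloring_state (attach u p q E) D' s'"
      "obeys True (attach u p q E) D' (\<lambda>_. b) u" "s' b u = s b p"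
      by (rule neutral_attach[OF E D(1,2), of p q u True u b "\<lambda>_. b"]) (use u upq pq D(3) q1 in auto)
    then show ?thesis using sp t unfolding neutral_avoiding_def by metis
  qed
  have neutral: "neutral_avoiding ?E (\<lambda>_. b) b u t" if "t \<in> {o', v, w}" for t b
    using loop[OF ne(1) d2(1,2), of t b] loop[OF ne(1)[symmetric] d2(2,1), of t b] ne(1)
      attach_commute[of u v w E] by (cases "t = v") auto
  have third: "mono_at (attach u p q E) ((\<lambda>_. \<not> b)(p := b)) b o'"
    if pq: "p \<noteq> q" "dg E p = 2" "dg E q = 2" "p \<noteq> o'" "q \<noteq> o'" for p q b
  proof -
    have upq: "u \<noteq> p" "u \<noteq> q" using u pq by auto
    obtain D s where D: "coloring_state E D s" "obeys False E D (\<lambda>_. b) o'" "D b o' = 0"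
      using profile3_mono[OF P, of o' b] by (auto elim: mono_atE)
    have 1: "D k p = 1" "D k q = 1" for k using both[OF D(1,2)] pq by auto
    have ob: "obeys False E D ((\<lambda>_. \<not> b)(p := b)) o'"
      using both[OF D(1,2)] no3 unfolding obeys_def by blast
    obtain D' s' where "coloring_state (attach u p q E) D' s'"
      "obeys False (attach u p q E) D' ((\<lambda>_. \<not> b)(p := b)) o'"
      "\<And>c x. x \<noteq> u \<Longrightarrow> x \<noteq> p \<Longrightarrow> x \<noteq> q \<Longrightarrow> D' c x = D c x"
      by (rule neutral_attach[OF E D(1) ob, of p q o' False u "\<not> b" "(\<lambda>_. \<not> b)(p := b)"]) (use u upq pq 1 in auto)
    then show ?thesis using D(3) pq un unfolding mono_at_def by metis
  qed
  have new: "mono_at (attach u p q E) ((\<lambda>_. \<not> b)(q := b)) b u"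
    if pq: "p \<noteq> q" "dg E p = 2" "dg E q = 2" for p q b
  proof -
    have upq: "u \<noteq> p" "u \<noteq> q" using u pq by auto
    obtain D s where D: "coloring_state E D s" "obeys False E D (\<lambda>_. \<not> b) p" "D (\<not> b) p = 0"
      using profile3_mono[OF P, of p "\<not> b"] pq(2) iff2 by (auto elim: mono_atE)
    have q1: "D k q = 1" for k using both[OF D(1,2)] pq by auto
    have sp: "s (\<not> b) p \<noteq> q" using state_partner(3)[OF D(1), of "\<not> b" p] D(3) pq(1) by simp
    have ob: "obeys False E D ((\<lambda>_. \<not> b)(q := b)) p"
      using both[OF D(1,2)] no3 unfolding obeys_def by blast
    have "mono_at (attach u p q E) ((\<lambda>_. \<not> b)(q := b)) (\<not> \<not> b) u"
      by (rule mono_attach[OF E D(1) ob, of p q u "\<not> b"]) (use u upq pq q1 sp D(3) in auto)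
    then show ?thesis by simp
  qed
  have mono: "mono_at ?E ((\<lambda>_. \<not> b)(q := b)) b m" if m: "m \<in> {u, o'}" and q: "q \<in> {v, w}" for m q b
    using m q third[OF ne(1) d2(1,2) ne(2,3), of b] third[OF ne(1)[symmetric] d2(2,1) ne(3,2), of b]
      new[OF ne(1) d2(1,2), of b] new[OF ne(1)[symmetric] d2(2,1), of b] attach_commute[of u v w E] by auto
  show ?thesis
    unfolding profile2_def using un ne dg2 dg3 neutral mono by blast
qed

section \<open>Attaching two vertices at once at defect 0\<close>

lemma branch_neutral:
  assumes E: "sgraph E" and st: "coloring_state E D s" and u: "dg E u = 0" "dg E u' = 0" "u \<noteq> u'"
    and v: "dg E v = 2" and z: "dg E z = 3" "dg E y = 3" "z \<noteq> y"
    and D: "D True v = 1" "D (\<not> b) z = 1" "D b y = 1"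
  obtains D' s' where "coloring_state (attach u' v y (attach u v z E)) D' s'"
    "\<And>c. D' c u = 1" "\<And>c. D' c u' = 1"
    "\<And>c x. x \<notin> {u, u', v, z, y} \<Longrightarrow> D' c x = D c x"
    "s' b u = (if s b v = y then u' else s b v)"
proof -
  have f: "finite E" using E by (simp add: sgraph_def)
  note dd = attach_branch_facts[OF E u v z]
  have v1: "D k v = 1" for k using state_open(1)[OF st f v D(1)] .
  obtain D1 s1 where D1: "coloring_state (attach u v z E) D1 s1"
    "\<And>c x. D1 c x = split_degree b u v z D c x"
    "\<And>c. s1 c = (if c = b then (s c)(u := s c v, s c v := u) else (s c)(u := s c z, s c z := u))"
    by (rule state_attachE[OF st E u(1) dd(1-3), of b]) (use v1 D in auto)
  obtain D2 s2 where D2: "coloring_state (attach u' v y (attach u v z E)) D2 s2"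
    "\<And>c x. D2 c x = split_degree (\<not> b) u' v y D1 c x"
    "\<And>c. s2 c = (if c = (\<not> b) then (s1 c)(u' := s1 c v, s1 c v := u') else (s1 c)(u' := s1 c y, s1 c y := u'))"
    by (rule state_attachE[OF D1(1) dd(4-8), of "\<not> b"]) (use v1 D dd(1-3,6-10) z D1(2) in auto)
  have "s b y \<noteq> u"
    using state_partner(1)[OF st, of b y] state_zero(1)[OF st f u(1), of b] D(3) by auto
  \<comment> \<open>In colour \<open>b\<close> the vertex \<open>u\<close> prolongs the path at
    \<open>v\<close> and \<open>u'\<close> the path at \<open>y\<close>. If these were the two ends
    of one path, its new ends are \<open>u\<close> and \<open>u'\<close>.\<close>
  then have "s2 b u = (if s b v = y then u' else s b v)"
    using D2(3)[of b] D1(3)[of b] u(3) dd(1,2,6,7,10) by auto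
  then show ?thesis by (intro that[OF D2(1)]) (use D2(2) D1(2) u(3) dd(1-3,6-10) in auto)
qed

text \<open>Here \<open>u\<close> takes colour \<open>k\<close> towards both \<open>v\<close> and
  \<open>z\<close>, which is safe as they are not partners, and \<open>u'\<close> takes the other
  colour towards \<open>v\<close> and \<open>k\<close> towards \<open>y\<close>. All three old
  vertices are thereby used up in both colours.\<close>

lemma branch_mono:
  assumes E: "sgraph E" and st: "coloring_state E D s" and u: "dg E u = 0" "dg E u' = 0" "u \<noteq> u'"
    and v: "dg E v = 2" and z: "dg E z = 3" "dg E y = 3" "z \<noteq> y"
    and D: "D True v = 1" "D k z = 1" "D k y = 1" "s k v \<noteq> z"
    and f: "\<And>x. is_open E x \<Longrightarrow> x \<notin> {v, z, y} \<Longrightarrow> D (f x) x = 1"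
  shows "mono_at (attach u' v y (attach u v z E)) f (\<not> k) u"
proof -
  have fin: "finite E" using E by (simp add: sgraph_def)
  note dd = attach_branch_facts[OF E u v z]
  have v1: "D c v = 1" for c using state_open(1)[OF st fin v D(1)] .
  obtain D1 s1 where D1: "coloring_state (attach u v z E) D1 s1"
    "\<And>b x. D1 b x = join_degree k u v z D b x"
    using state_attach_sameE[OF st E u(1) dd(1-3), of k] v1 D by auto
  obtain D2 s2 where D2: "coloring_state (attach u' v y (attach u v z E)) D2 s2"
    "\<And>b x. D2 b x = split_degree (\<not> k) u' v y D1 b x"
    by (rule state_attachE[OF D1(1) dd(4-8), of "\<not> k"]) (use v1 D dd(1-3,6-10) z D1(2) in auto)
  have "obeys False (attach u' v y (attach u v z E)) D2 f u"
    unfolding obeys_def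
  proof (intro allI impI)
    fix x assume x: "is_open (attach u' v y (attach u v z E)) x"
    then consider "x = u" | "x = u'" | "x \<notin> {u, u', v, z, y}" "is_open E x"
      using dd(11)[of x] by (auto split: if_splits)
    then show "D2 (f x) x = 1 \<or> \<not> False \<and> x = u"
    proof cases
      case 3 then show ?thesis using f[of x] D2(2) D1(2) by simp
    qed (use D2(2) in auto)
  qed
  moreover have "D2 (\<not> k) u = 0" using D2(2) D1(2) u(3) dd(1,10) by simp
  ultimately show ?thesis using D2(1) unfolding mono_at_def by blast
qed

lemma obeys_TrueI:
  assumes "\<And>x. is_open E x \<Longrightarrow> D (f x) x = 1"
  shows "obeys Z E D f d"
  using assms by (simp add: obeys_def)

lemma profile1_branch:
  assumes c: "core E" and P: "profile1 E v" and u: "dg E u = 0" "dg E u' = 0" "u \<noteq> u'"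
    and a: "dg E a = 3" "dg E e = 3" "a \<noteq> e"
  shows "\<exists>z y. profile2 (attach u' v e (attach u v a E)) u u' z y"
proof -
  let ?E = "attach u' v e (attach u v a E)"
  note E = core_sgraph(1)[OF c] and fin = core_sgraph(2)[OF c]
  let ?S = "{x. dg E x = 3}"
  have v: "dg E x = 2 \<longleftrightarrow> x = v" for x using P by (simp add: profile1_def)
  then have v2: "dg E v = 2" by simp
  have S4: "card ?S = 4" using P by (simp add: profile1_def)
  note dd = attach_branch_facts[OF E u v2 a]
  have "\<not> ?S \<subseteq> {a, e}" using card_mono[of "{a, e}" ?S] S4 a(3) by auto
  then obtain z where z: "dg E z = 3" "z \<noteq> a" "z \<noteq> e" by blast
  obtain y where y: "?S = {a, e, z, y}" "y \<noteq> a" "y \<noteq> e" "y \<noteq> z"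
    by (rule card_4_fourth[OF S4, of a e z]) (use a z in auto)
  then have y3: "dg E y = 3" by blast
  have dg2: "dg ?E x = 2 \<longleftrightarrow> x = u \<or> x = u'" for x
    using dd(11)[of x] v[of x] by (cases "x = u"; cases "x = u'"; cases "x = v"; cases "x = a"; cases "x = e"; simp)
  have dg3: "dg ?E x = 3 \<longleftrightarrow> x = z \<or> x = y" for x
  proof -
    have "x = z \<or> x = y \<longleftrightarrow> dg E x = 3 \<and> x \<noteq> a \<and> x \<noteq> e" using y(1) z y(2-4) by blast
    then show ?thesis
      using dd(11)[of x] u v2 by (cases "x = u"; cases "x = u'"; cases "x = v"; cases "x = a"; cases "x = e"; simp)
  qed
  have uz: "u \<noteq> z" "u \<noteq> y" "u' \<noteq> z" "u' \<noteq> y" using u z y3 by auto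
  have zv: "z \<noteq> v" "y \<noteq> v" using z y3 v2 by auto
  have vals: "D True v = 1" "\<And>x. dg E x = 3 \<Longrightarrow> D (f x) x = 1"
    if "coloring_state E D s" "obeys True E D f v" for D s f
    using that v2 state_open(1)[OF that(1) fin v2] unfolding obeys_def by blast+
  have neutral: "neutral_avoiding ?E (\<lambda>_. b) b u t" if t: "t \<in> {u', z, y}" for t b
  proof -
    \<comment> \<open>The new vertex \<open>u\<close> inherits the partner of \<open>v\<close>, with
      \<open>e\<close> replaced by \<open>u'\<close>; so \<open>u'\<close> is avoided by avoiding
      \<open>e\<close>.\<close>
    define x where "x = (if t = u' then e else t)"
    have x: "dg E x = 3" "x \<noteq> a" using t a z y3 y(2) by (auto simp: x_def)
    obtain D s where D: "coloring_state E D s" "obeys True E D ((\<lambda>_. b)(a := \<not> b)) v" "s b v \<noteq> x"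
      using profile1_neutral[OF P a(1) x, of b] by (rule neutral_avoidingE)
    note vl = vals[OF D(1,2)]
    have a1: "D (\<not> b) a = 1" and e1: "D b e = 1" and z1: "D b z = 1" and y1: "D b y = 1"
      using vl(2)[of a] vl(2)[of e] vl(2)[of z] vl(2)[of y] a z y y3 by auto
    obtain D' s' where D': "coloring_state ?E D' s'" "\<And>c. D' c u = 1" "\<And>c. D' c u' = 1"
      "\<And>c x. x \<notin> {u, u', v, a, e} \<Longrightarrow> D' c x = D c x"
      "s' b u = (if s b v = e then u' else s b v)"
      using branch_neutral[OF E D(1) u v2 a vl(1) a1 e1] by metis
    have "obeys True ?E D' (\<lambda>_. b) u"
    proof (rule obeys_TrueI)
      fix r assume "is_open ?E r"
      then consider "r = u" | "r = u'" | "r = z" | "r = y" using dg2 dg3 by blast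
      then show "D' b r = 1"
        by cases (use D' z1 y1 uz z y(2-4) zv in auto)
    qed
    moreover have "s b v \<noteq> u'"
      using state_partner(1)[OF D(1), of b v] state_zero(1)[OF D(1) fin u(2), of b]
        state_open(1)[OF D(1) fin v2 vl(1), of b] by auto
    then have "s' b u \<noteq> t" using D'(5) D(3) t uz by (auto simp: x_def split: if_splits)
    ultimately show ?thesis using D'(1) unfolding neutral_avoiding_def by blast
  qed
  \<comment> \<open>The names \<open>a'\<close> and \<open>e'\<close> keep the side condition on
    \<open>z\<close> and \<open>y\<close> symmetric, so that the claim also applies with the two new
    vertices and their neighbours exchanged.\<close>
  have mono: "mono_at (attach u' v e (attach u v a E)) ((\<lambda>_. \<not> b)(q := b)) b u"
    if u: "dg E u = 0" "dg E u' = 0" "u \<noteq> u'" and a: "dg E a = 3" "dg E e = 3" "a \<noteq> e"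
      and q: "q = z \<or> q = y" and ae: "{a, e} = {a', e'}" and n: "z \<notin> {a', e'}" "y \<notin> {a', e'}" for u u' a e b q a' e'
  proof -
    have q3: "dg E q = 3" "q \<noteq> a" "q \<noteq> e" using q z y3 ae n by auto
    obtain D s where D: "coloring_state E D s" "obeys True E D ((\<lambda>_. \<not> b)(q := b)) v" "s (\<not> b) v \<noteq> a"
      using profile1_neutral[OF P q3(1) a(1) q3(2)[symmetric], of "\<not> b"] by (auto elim: neutral_avoidingE)
    note vl = vals[OF D(1,2)]
    have ob: "D (((\<lambda>_. \<not> b)(q := b)) x) x = 1" if "is_open E x" for x
      using that vl v state_open(1)[OF D(1) fin v2 vl(1)] by metis
    have a1: "D (\<not> b) a = 1" "D (\<not> b) e = 1" using ob[of a] ob[of e] a q3 by auto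
    have "mono_at (attach u' v e (attach u v a E)) ((\<lambda>_. \<not> b)(q := b)) (\<not> \<not> b) u"
      by (rule branch_mono[OF E D(1) u v2 a vl(1) a1 D(3) ob])
    then show ?thesis by simp
  qed
  have mono_any: "mono_at ?E ((\<lambda>_. \<not> b)(q := b)) b m" if "m \<in> {u, u'}" "q \<in> {z, y}" for m q b
    using that mono[OF u a, of q a e b] mono[OF u(2,1) u(3)[symmetric] a(2,1) a(3)[symmetric], of q a e b] z y
      attach_attach_commute[of u' v e u v a E] by (auto simp: insert_commute)
  have "profile2 ?E u u' z y"
    unfolding profile2_def using u(3) y(4) dg2 dg3 neutral mono_any by blast
  then show ?thesis by blast
qed

lemma profile2_branch:
  assumes c: "core E" and P: "profile2 E v w z y" and u: "dg E u = 0" "dg E u' = 0" "u \<noteq> u'"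
  shows "profile3 (attach u' v y (attach u v z E)) u u' w" (is "profile3 ?E u u' w")
proof -
  note E = core_sgraph(1)[OF c] and fin = core_sgraph(2)[OF c]
  note ne = profile2_distinct(1-10)[OF P] and iff = profile2_distinct(11,12)[OF P]
  note dd = attach_branch_facts[OF E u ne(7,9,10,2)]
  have uw: "u \<noteq> w" "u' \<noteq> w" using u ne by auto
  have dg2: "dg ?E x = 2 \<longleftrightarrow> x = u \<or> x = u' \<or> x = w" for x
    using dd(11)[of x] iff(1)[of x] ne(1-6) uw
    by (cases "x = u"; cases "x = u'"; cases "x = v"; cases "x = z"; cases "x = y"; simp)
  have dg3: "dg ?E x \<noteq> 3" for x
    using dd(11)[of x] iff(2)[of x]
    by (cases "x = u"; cases "x = u'"; cases "x = v"; cases "x = z"; cases "x = y"; simp)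
  have new: "mono_at (attach u' v y (attach u v z E)) (\<lambda>_. b) b u"
    if P: "profile2 E v w z y" and u: "dg E u = 0" "dg E u' = 0" "u \<noteq> u'" for u u' z y b
  proof -
    note ne = profile2_distinct(1-10)[OF P] and iff = profile2_distinct(11,12)[OF P]
    obtain D s where D: "coloring_state E D s" "obeys True E D (\<lambda>_. \<not> b) v" "s (\<not> b) v \<noteq> z"
      using profile2_neutral[OF P, of z "\<not> b"] by (auto elim: neutral_avoidingE)
    have ob: "D (\<not> b) x = 1" if "is_open E x" for x
      using D(2) that unfolding obeys_def by blast
    have v1: "D True v = 1" using state_open(1)[OF D(1) fin ne(7) ob] ne(7) by simp
    have w1: "D k w = 1" for k using state_open(1)[OF D(1) fin ne(8) ob] ne(8) by simp
    have "mono_at (attach u' v y (attach u v z E)) (\<lambda>_. b) (\<not> \<not> b) u"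
      by (rule branch_mono[OF E D(1) u ne(7,9,10,2) v1 ob ob D(3)]) (use ne w1 iff in auto)
    then show ?thesis by simp
  qed
  have old: "mono_at ?E (\<lambda>_. b) b w" for b
  proof -
    \<comment> \<open>The prescription is rewritten for the other colour as default: both versions
      give \<open>\<not> b\<close> to \<open>z\<close> and \<open>b\<close> to \<open>y\<close>, and
      at \<open>v\<close> either colour is fine since it sees both.\<close>
    obtain D s where D: "coloring_state E D s" "obeys False E D ((\<lambda>_. \<not> \<not> b)(z := \<not> b)) w" "D b w = 0"
    proof -
      have "mono_at E ((\<lambda>_. \<not> b)(y := b)) b w" by (rule profile2_mono[OF P]) auto
      then obtain D s where D: "coloring_state E D s" "obeys False E D ((\<lambda>_. \<not> b)(y := b)) w" "D b w = 0"
        by (rule mono_atE)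
      have v1: "D k v = 1" for k using obeys_at[OF D(2), of v] ne state_open(1)[OF D(1) fin ne(7)] by simp
      have zy: "D (\<not> b) z = 1" "D b y = 1" using obeys_at[OF D(2), of z] obeys_at[OF D(2), of y] ne by simp_all
      have "obeys False E D ((\<lambda>_. \<not> \<not> b)(z := \<not> b)) w"
        unfolding obeys_def using iff v1 zy ne by auto
      then show ?thesis using that D by blast
    qed
    have v1: "D True v = 1" using obeys_at[OF D(2), of v] ne state_open(1)[OF D(1) fin ne(7)] by simp
    have zy: "D (\<not> b) z = 1" "D b y = 1" using obeys_at[OF D(2), of z] obeys_at[OF D(2), of y] ne by simp_all
    obtain D' s' where D': "coloring_state ?E D' s'" "\<And>c. D' c u = 1" "\<And>c. D' c u' = 1"
      "\<And>c x. x \<notin> {u, u', v, z, y} \<Longrightarrow> D' c x = D c x"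
      using branch_neutral[OF E D(1) u ne(7,9,10,2) v1 zy] by metis
    have "obeys False ?E D' (\<lambda>_. b) w"
      unfolding obeys_def using dg2 dg3 D'(2)[of b] D'(3)[of b] by auto
    moreover have "D' b w = 0" using D'(4) D(3) uw ne by auto
    ultimately show ?thesis using D'(1) unfolding mono_at_def by blast
  qed
  have "mono_at ?E (\<lambda>_. b) b m" if "m \<in> {u, u', w}" for m b
    using that new[OF P u] new[OF profile2_commute[OF P] u(2,1) u(3)[symmetric]] old
      attach_attach_commute[of u' v y u v z E] by auto
  then show ?thesis unfolding profile3_def using u(3) uw dg2 dg3 by blast
qed

lemma twins_neutral:
  assumes E: "sgraph E" and st: "coloring_state E D s" and u: "dg E u = 0" "dg E u' = 0" "u \<noteq> u'"
    and v: "dg E v = 2" "dg E w = 2" "v \<noteq> w" and D: "D True v = 1" "D True w = 1"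
  obtains D' s' where "coloring_state (attach u' v w (attach u v w E)) D' s'"
    "\<And>c. D' c u = 1" "\<And>c. D' c u' = 1"
    "\<And>c x. x \<notin> {u, u', v, w} \<Longrightarrow> D' c x = D c x"
    "s' b u = (if s b v = w then u' else s b v)"
proof -
  have f: "finite E" using E by (simp add: sgraph_def)
  note dd = attach_twins_facts[OF E u v]
  have v1: "D k v = 1" "D k w = 1" for k
    using state_open(1)[OF st f v(1) D(1)] state_open(1)[OF st f v(2) D(2)] by blast+
  obtain D1 s1 where D1: "coloring_state (attach u v w E) D1 s1"
    "\<And>c x. D1 c x = split_degree b u v w D c x"
    "\<And>c. s1 c = (if c = b then (s c)(u := s c v, s c v := u) else (s c)(u := s c w, s c w := u))"
    by (rule state_attachE[OF st E u(1) dd(1,2) v(3), of b]) (use v1 in auto)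
  obtain D2 s2 where D2: "coloring_state (attach u' v w (attach u v w E)) D2 s2"
    "\<And>c x. D2 c x = split_degree (\<not> b) u' v w D1 c x"
    "\<And>c. s2 c = (if c = (\<not> b) then (s1 c)(u' := s1 c v, s1 c v := u') else (s1 c)(u' := s1 c w, s1 c w := u'))"
    by (rule state_attachE[OF D1(1) dd(3-6) v(3), of "\<not> b"]) (use v1 dd(1,2,5,6) v D1(2) in auto)
  have "s b w \<noteq> u"
    using state_partner(1)[OF st, of b w] state_zero(1)[OF st f u(1), of b] v1 by auto
  then have "s2 b u = (if s b v = w then u' else s b v)"
    using D2(3)[of b] D1(3)[of b] u(3) dd(1,2,5,6) by auto
  then show ?thesis by (intro that[OF D2(1)]) (use D2(2) D1(2) u(3) dd(1,2,5,6) in auto)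
qed

text \<open>The missing colour \<open>k\<close> of \<open>v\<close> is taken twice by
  \<open>u\<close>; the edge from \<open>u'\<close> to \<open>v\<close> has colour \<open>k\<close>
  too and the one to \<open>w\<close> the other colour. So \<open>v\<close> and \<open>w\<close> end
  with degree 2 in each colour.\<close>

lemma twins_mono:
  assumes E: "sgraph E" and st: "coloring_state E D s" and u: "dg E u = 0" "dg E u' = 0" "u \<noteq> u'"
    and v: "dg E v = 2" "dg E w = 2" "v \<noteq> w" and D: "D k v = 0" "D True w = 1"
    and f: "\<And>x. is_open E x \<Longrightarrow> x \<notin> {v, w} \<Longrightarrow> D (f x) x = 1"
  shows "mono_at (attach u' v w (attach u v w E)) f (\<not> k) u"
proof -
  have fin: "finite E" using E by (simp add: sgraph_def)
  note dd = attach_twins_facts[OF E u v]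
  have w1: "D c w = 1" for c using state_open(1)[OF st fin v(2) D(2)] .
  have sv: "s k v \<noteq> w" using state_partner(3)[OF st, of k v] D(1) v(3) by simp
  obtain D1 s1 where D1: "coloring_state (attach u v w E) D1 s1"
    "\<And>b x. D1 b x = join_degree k u v w D b x"
    using state_attach_sameE[OF st E u(1) dd(1,2) v(3), of k] w1 D sv by auto
  obtain D2 s2 where D2: "coloring_state (attach u' v w (attach u v w E)) D2 s2"
    "\<And>b x. D2 b x = split_degree k u' v w D1 b x"
    by (rule state_attachE[OF D1(1) dd(3-6) v(3), of k]) (use w1 D dd(1,2,5,6) v D1(2) in auto)
  have "obeys False (attach u' v w (attach u v w E)) D2 f u"
    unfolding obeys_def
  proof (intro allI impI)
    fix x assume x: "is_open (attach u' v w (attach u v w E)) x"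
    then consider "x = u" | "x = u'" | "x \<notin> {u, u', v, w}" "is_open E x"
      using dd(7)[of x] by (auto split: if_splits)
    then show "D2 (f x) x = 1 \<or> \<not> False \<and> x = u"
    proof cases
      case 3 then show ?thesis using f[of x] D2(2) D1(2) by simp
    qed (use D2(2) in auto)
  qed
  moreover have "D2 (\<not> k) u = 0" using D2(2) D1(2) u(3) dd(1,2) by simp
  ultimately show ?thesis using D2(1) unfolding mono_at_def by blast
qed

lemma profile2_twins:
  assumes c: "core E" and P: "profile2 E v w z y" and u: "dg E u = 0" "dg E u' = 0" "u \<noteq> u'"
  shows "profile2 (attach u' v w (attach u v w E)) u u' z y" (is "profile2 ?E u u' z y")
proof -
  note E = core_sgraph(1)[OF c] and fin = core_sgraph(2)[OF c]
  note ne = profile2_distinct(1-10)[OF P] and iff = profile2_distinct(11,12)[OF P]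
  note dd = attach_twins_facts[OF E u ne(7,8,1)]
  have uz: "u \<noteq> z" "u \<noteq> y" "u' \<noteq> z" "u' \<noteq> y" using u ne by auto
  have dg2: "dg ?E x = 2 \<longleftrightarrow> x = u \<or> x = u'" for x
    using dd(7)[of x] iff(1)[of x]
    by (cases "x = u"; cases "x = u'"; cases "x = v"; cases "x = w"; simp)
  have dg3: "dg ?E x = 3 \<longleftrightarrow> x = z \<or> x = y" for x
    using dd(7)[of x] iff(2)[of x] uz ne(1-6)
    by (cases "x = u"; cases "x = u'"; cases "x = v"; cases "x = w"; simp)
  have neutral: "neutral_avoiding ?E (\<lambda>_. b) b u t" if t: "t \<in> {u', z, y}" for t b
  proof -
    define x where "x = (if t = u' then w else t)"
    have "x = w \<or> x = z \<or> x = y" using t by (auto simp: x_def)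
    from profile2_neutral[OF P this, of b] obtain D s
      where D: "coloring_state E D s" "obeys True E D (\<lambda>_. b) v" "s b v \<noteq> x" by (rule neutral_avoidingE)
    have ob: "D b r = 1" if "is_open E r" for r
      using D(2) that unfolding obeys_def by blast
    have vw1: "D True v = 1" "D True w = 1"
      using state_open(1)[OF D(1) fin ne(7) ob] state_open(1)[OF D(1) fin ne(8) ob] ne(7,8) by simp_all
    obtain D' s' where D': "coloring_state ?E D' s'" "\<And>c. D' c u = 1" "\<And>c. D' c u' = 1"
      "\<And>c x. x \<notin> {u, u', v, w} \<Longrightarrow> D' c x = D c x" "s' b u = (if s b v = w then u' else s b v)"
      using twins_neutral[OF E D(1) u ne(7,8,1) vw1] by metis
    have "obeys True ?E D' (\<lambda>_. b) u"
    proof (rule obeys_TrueI)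
      fix r assume "is_open ?E r"
      then consider "r = u" | "r = u'" | "r = z" | "r = y" using dg2 dg3 by blast
      then show "D' b r = 1"
        by cases (use D' ob[of z] ob[of y] uz ne in auto)
    qed
    moreover have "s b v \<noteq> u'"
      using state_partner(1)[OF D(1), of b v] state_zero(1)[OF D(1) fin u(2), of b] ob[of v] ne(7) by auto
    then have "s' b u \<noteq> t" using D'(5) D(3) t uz by (auto simp: x_def split: if_splits)
    ultimately show ?thesis using D'(1) unfolding neutral_avoiding_def by blast
  qed
  have new: "mono_at (attach u' v w (attach u v w E)) ((\<lambda>_. \<not> b)(q := b)) b u"
    if u: "dg E u = 0" "dg E u' = 0" "u \<noteq> u'" and q: "q = z \<or> q = y" for u u' q b
  proof -
    \<comment> \<open>For \<open>u\<close> to miss \<open>b\<close>, the vertex \<open>v\<close>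
      must miss \<open>\<not> b\<close> in the smaller graph. Making \<open>r\<close> the exception
      with default \<open>b\<close> gives the same colours to \<open>z\<close> and \<open>y\<close>
      as making \<open>q\<close> the exception with default \<open>\<not> b\<close>.\<close>
    define r where "r = (if q = z then y else z)"
    have r: "r = z \<or> r = y" by (simp add: r_def)
    obtain D s where D: "coloring_state E D s" "obeys False E D ((\<lambda>_. \<not> \<not> b)(r := \<not> b)) v" "D (\<not> b) v = 0"
      using profile2_mono[OF P _ r, of v "\<not> b"] by (auto elim: mono_atE)
    have w1: "D True w = 1" using obeys_at[OF D(2), of w] ne state_open(1)[OF D(1) fin ne(8)] by simp
    have zy: "D (((\<lambda>_. \<not> b)(q := b)) x) x = 1" if "x = z \<or> x = y" for x
      using obeys_at[OF D(2), of x] that q ne by (auto simp: r_def split: if_splits)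
    have "mono_at (attach u' v w (attach u v w E)) ((\<lambda>_. \<not> b)(q := b)) (\<not> \<not> b) u"
      by (rule twins_mono[OF E D(1) u ne(7,8,1) D(3) w1]) (use zy iff in blast)
    then show ?thesis by simp
  qed
  have mono: "mono_at ?E ((\<lambda>_. \<not> b)(q := b)) b m" if "m \<in> {u, u'}" "q \<in> {z, y}" for m q b
    using that new[OF u, of q b] new[OF u(2,1) u(3)[symmetric], of q b]
      attach_attach_commute[of u' v w u v w E] by auto
  show ?thesis
    unfolding profile2_def using u(3) ne(2) dg2 dg3 neutral mono by blast
qed

lemma profile3_twins:
  assumes c: "core E" and P: "profile3 E v w o'" and u: "dg E u = 0" "dg E u' = 0" "u \<noteq> u'"
  shows "profile3 (attach u' v w (attach u v w E)) u u' o'" (is "profile3 ?E u u' o'")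
proof -
  note E = core_sgraph(1)[OF c] and fin = core_sgraph(2)[OF c]
  have ne: "v \<noteq> w" "v \<noteq> o'" "w \<noteq> o'" and iff2: "\<And>x. dg E x = 2 \<longleftrightarrow> x = v \<or> x = w \<or> x = o'"
    and no3: "\<And>x. dg E x \<noteq> 3" using P unfolding profile3_def by blast+
  then have d2: "dg E v = 2" "dg E w = 2" "dg E o' = 2" by blast+
  note dd = attach_twins_facts[OF E u d2(1,2) ne(1)]
  have uo: "u \<noteq> o'" "u' \<noteq> o'" using u d2 by auto
  have dg2: "dg ?E x = 2 \<longleftrightarrow> x = u \<or> x = u' \<or> x = o'" for x
    using dd(7)[of x] iff2[of x] uo ne
    by (cases "x = u"; cases "x = u'"; cases "x = v"; cases "x = w"; simp)
  have dg3: "dg ?E x \<noteq> 3" for x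
    using dd(7)[of x] no3[of x] by (cases "x = u"; cases "x = u'"; cases "x = v"; cases "x = w"; simp)
  have both: "D k r = 1" if "coloring_state E D s" "obeys False E D f m" "r \<noteq> m" "dg E r = 2" for D s f m k r
    using obeys_at[OF that(2), of r] state_open(1)[OF that(1) fin that(4)] that(3,4) by blast
  have new: "mono_at (attach u' v w (attach u v w E)) (\<lambda>_. b) b u"
    if u: "dg E u = 0" "dg E u' = 0" "u \<noteq> u'" for u u' b
  proof -
    obtain D s where D: "coloring_state E D s" "obeys False E D (\<lambda>_. \<not> b) v" "D (\<not> b) v = 0"
      using profile3_mono[OF P, of v "\<not> b"] by (auto elim: mono_atE)
    have w1: "D True w = 1" using both[OF D(1,2), of w True] ne d2 by auto
    have "mono_at (attach u' v w (attach u v w E)) (\<lambda>_. b) (\<not> \<not> b) u"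
      by (rule twins_mono[OF E D(1) u d2(1,2) ne(1) D(3) w1]) (use both[OF D(1,2)] no3 in blast)
    then show ?thesis by simp
  qed
  have old: "mono_at ?E (\<lambda>_. b) b o'" for b
  proof -
    obtain D s where D: "coloring_state E D s" "obeys False E D (\<lambda>_. b) o'" "D b o' = 0"
      using profile3_mono[OF P, of o' b] by (auto elim: mono_atE)
    have vw1: "D True v = 1" "D True w = 1"
      using both[OF D(1,2), of v True] both[OF D(1,2), of w True] ne d2 by auto
    obtain D' s' where D': "coloring_state ?E D' s'" "\<And>c. D' c u = 1" "\<And>c. D' c u' = 1"
      "\<And>c x. x \<notin> {u, u', v, w} \<Longrightarrow> D' c x = D c x"
      using twins_neutral[OF E D(1) u d2(1,2) ne(1) vw1] by metis
    have "obeys False ?E D' (\<lambda>_. b) o'"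
      unfolding obeys_def using dg2 dg3 D'(2)[of b] D'(3)[of b] by auto
    moreover have "D' b o' = 0" using D'(4) D(3) uo ne by auto
    ultimately show ?thesis using D'(1) unfolding mono_at_def by blast
  qed
  have "mono_at ?E (\<lambda>_. b) b m" if "m \<in> {u, u', o'}" for m b
    using that new[OF u, of b] new[OF u(2,1) u(3)[symmetric], of b] old[of b]
      attach_attach_commute[of u' v w u v w E] by auto
  then show ?thesis unfolding profile3_def using u(3) uo dg2 dg3 by blast
qed

section \<open>The three profiles treated together\<close>

definition tight_profile :: "'a set set \<Rightarrow> bool" where
  "tight_profile E \<longleftrightarrow> (\<exists>v. profile1 E v) \<or> (\<exists>v w z y. profile2 E v w z y) \<or> (\<exists>v w o'. profile3 E v w o')"

text \<open>Every vertex of degree 2 can play the distinguished role: it is unique in the first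
  profile, the third is symmetric by definition, and the second is so by
  \<open>profile2_swap\<close>.\<close>

lemma tight_profile_cases:
  assumes "core E" "tight_profile E" "dg E v = 2"
  obtains "profile1 E v" | w z y where "profile2 E v w z y" | w o' where "profile3 E v w o'"
proof -
  have "profile1 E v" if "profile1 E v'" for v'
    using that assms(3) unfolding profile1_def by metis
  moreover have "\<exists>w z y. profile2 E v w z y" if P: "profile2 E v' w z y" for v' w z y
    using P profile2_swap[OF assms(1) P] profile2_distinct(11)[OF P, of v] assms(3) by blast
  moreover have "\<exists>w o'. profile3 E v w o'" if P: "profile3 E v' w o'" for v' w o'
  proof -
    have "v = v' \<or> v = w \<or> v = o'" using P assms(3) unfolding profile3_def by blast
    moreover have "profile3 E w v' o'" "profile3 E o' v' w" using P unfolding profile3_def by blast+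
    ultimately show ?thesis using P by blast
  qed
  ultimately show ?thesis using assms(2) that unfolding tight_profile_def by blast
qed

lemma profile3_pair:
  assumes "profile3 E v x y" "dg E w = 2" "v \<noteq> w"
  obtains o' where "profile3 E v w o'"
proof -
  have "dg E w = 2 \<longleftrightarrow> w = v \<or> w = x \<or> w = y" using assms(1) by (simp add: profile3_def)
  then have "w = x \<or> w = y" using assms(2,3) by blast
  moreover have "profile3 E v y x" using assms(1) unfolding profile3_def by blast
  ultimately show ?thesis using assms(1) that by blast
qed

lemma tight_profile_single:
  assumes c: "core E" and P: "tight_profile E" and u: "dg E u = 0" and v: "dg E v = 2" and z: "dg E z = 3"
  shows "tight_profile (attach u v z E)"
proof (rule tight_profile_cases[OF c P v])
  assume "profile1 E v"
  then show ?thesis using profile1_step_single[OF c _ u z] unfolding tight_profile_def by blast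
next
  fix w x y assume Q: "profile2 E v w x y"
  then have "profile2 E v w y x" by (rule profile2_commute)
  moreover have "z = x \<or> z = y" using profile2_distinct(12)[OF Q, of z] z by blast
  ultimately show ?thesis using Q profile2_step_single[OF c _ u] unfolding tight_profile_def by blast
next
  fix w o' assume "profile3 E v w o'"
  then show ?thesis using z unfolding profile3_def by blast
qed

lemma tight_profile_double:
  assumes c: "core E" and P: "tight_profile E" and u: "dg E u = 0" and v: "dg E v = 2" "dg E w = 2" "v \<noteq> w"
  shows "tight_profile (attach u v w E)"
proof (rule tight_profile_cases[OF c P v(1)])
  assume "profile1 E v"
  then have "dg E w = 2 \<longleftrightarrow> w = v" by (simp add: profile1_def)
  then show ?thesis using v by blast
next
  fix w' x y assume Q: "profile2 E v w' x y"
  then have "w = w'" using profile2_distinct(11)[OF Q, of w] v by blast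
  then show ?thesis using Q profile2_step_double[OF c _ u] unfolding tight_profile_def by blast
next
  fix x y assume "profile3 E v x y"
  then obtain o' where "profile3 E v w o'" using profile3_pair v by metis
  then show ?thesis using profile3_step_double[OF c _ u] unfolding tight_profile_def by blast
qed

lemma tight_profile_branch:
  assumes c: "core E" and P: "tight_profile E" and u: "dg E u = 0" "dg E u' = 0" "u \<noteq> u'" and v: "dg E v = 2"
    and z: "dg E z = 3" "dg E y = 3" "z \<noteq> y"
  shows "tight_profile (attach u' v y (attach u v z E))"
proof (rule tight_profile_cases[OF c P v])
  assume "profile1 E v"
  then show ?thesis using profile1_branch[OF c _ u z] unfolding tight_profile_def by blast
next
  fix w x x' assume Q: "profile2 E v w x x'"
  then have "profile2 E v w z y"
    using profile2_distinct(12)[OF Q, of z] profile2_distinct(12)[OF Q, of y] z profile2_commute[OF Q] by blast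
  then show ?thesis using profile2_branch[OF c _ u] unfolding tight_profile_def by blast
next
  fix w o' assume "profile3 E v w o'"
  then show ?thesis using z unfolding profile3_def by blast
qed

lemma tight_profile_twins:
  assumes c: "core E" and P: "tight_profile E" and u: "dg E u = 0" "dg E u' = 0" "u \<noteq> u'"
    and v: "dg E v = 2" "dg E w = 2" "v \<noteq> w"
  shows "tight_profile (attach u' v w (attach u v w E))"
proof (rule tight_profile_cases[OF c P v(1)])
  assume "profile1 E v"
  then have "dg E w = 2 \<longleftrightarrow> w = v" by (simp add: profile1_def)
  then show ?thesis using v by blast
next
  fix w' x y assume Q: "profile2 E v w' x y"
  then have "w = w'" using profile2_distinct(11)[OF Q, of w] v by blast
  then show ?thesis using Q profile2_twins[OF c _ u] unfolding tight_profile_def by blast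
next
  fix x y assume "profile3 E v x y"
  then obtain o' where "profile3 E v w o'" using profile3_pair v by metis
  then show ?thesis using profile3_twins[OF c _ u] unfolding tight_profile_def by blast
qed

text \<open>With two vertices of degree 3, matching them prescribes different colours, which is the
  pattern that parity allows beside a monochromatic vertex. With none, every other open vertex has
  degree 2 and obeys any prescription as soon as it sees both colours.\<close>

lemma tight_profile_can_be_mono:
  assumes c: "core E" and P: "tight_profile E" and v: "dg E v = 2"
  shows "can_be_mono E v"
proof (rule tight_profile_cases[OF c P v])
  note fin = core_sgraph(2)[OF c]
  show ?thesis if "profile1 E v" using that unfolding profile1_def by blast
  show ?thesis if Q: "profile2 E v w z y" for w z y
  proof -
    note ne = profile2_distinct(1-10)[OF Q] and iff = profile2_distinct(11,12)[OF Q]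
    have S: "{x. dg E x = 3} = {z, y}" using iff(2) by blast
    show ?thesis
    proof (rule can_be_monoI[OF _ S _ v fin])
      show "matching (id(z := y, y := z)) {z, y}" using ne by (simp add: matching_def)
      fix f assume f: "separates (id(z := y, y := z)) {z, y} f"
      have fy: "f y = (\<not> f z)" using separates_at[OF f, of z] ne by simp
      obtain D s where D: "coloring_state E D s" "obeys False E D ((\<lambda>_. \<not> f z)(z := f z)) v" "D (f z) v = 0"
        using profile2_mono[OF Q, of v z "f z"] by (auto elim: mono_atE)
      have w1: "D k w = 1" for k using obeys_at[OF D(2), of w] ne state_open(1)[OF D(1) fin ne(8)] by simp
      have "D (f z) z = 1" "D (f y) y = 1" using obeys_at[OF D(2), of z] obeys_at[OF D(2), of y] ne fy by simp_all
      then have "obeys False E D f v" unfolding obeys_def using iff w1 by metis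
      then show "\<exists>D s b. coloring_state E D s \<and> obeys False E D f v \<and> D b v = 0" using D(1,3) by blast
    qed
  qed
  show ?thesis if Q: "profile3 E v w o'" for w o'
  proof -
    have S: "{x. dg E x = 3} = {}" using Q unfolding profile3_def by blast
    show ?thesis
    proof (rule can_be_monoI[OF _ S _ v fin])
      show "matching id {}" by (simp add: matching_def)
      fix f
      obtain D s where D: "coloring_state E D s" "obeys False E D (\<lambda>_. True) v" "D True v = 0"
        using profile3_mono[OF Q, of v True] by (auto elim: mono_atE)
      have "obeys False E D f v"
        unfolding obeys_def using obeys_at[OF D(2)] state_open(1)[OF D(1) fin] S by blast
      then show "\<exists>D s b. coloring_state E D s \<and> obeys False E D f v \<and> D b v = 0" using D(1,3) by blast
    qed
  qed
qed

lemma tight_profile_flexible: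
  assumes c: "core E" and P: "tight_profile E"
  shows "flexible False E"
proof -
  obtain v where "dg E v = 2"
    using P unfolding tight_profile_def profile1_def profile2_def profile3_def by blast
  from tight_profile_can_be_mono[OF c P this] show ?thesis
    unfolding can_be_mono_def flexible_def by blast
qed

text \<open>The base of the induction. To make a corner miss \<open>b\<close>, its two edges get the
  other colour and the opposite edge gets \<open>b\<close>; all corners are alike.\<close>

lemma triangle_tight_profile:
  assumes "x \<noteq> y" "y \<noteq> z" "x \<noteq> z"
  shows "tight_profile {{x, y}, {y, z}, {x, z}}"
proof -
  let ?T = "\<lambda>x y z. attach z x y (insert {x, y} {})"
  have e: "sgraph {}" "dg {} r = 0" for r :: 'a by (simp_all add: sgraph_def dg_def)
  have st0: "coloring_state {} (\<lambda>_ _. 0) (\<lambda>_ r. r :: 'a)"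
    unfolding coloring_state_def using path_cover_empty
    by (intro exI[of _ "\<lambda>_. {}"]) (auto simp: dg_def fun_eq_iff id_def)
  have dg: "dg (?T x y z) r = (if r \<in> {x, y, z} then 2 else 0)" "sgraph (?T x y z)"
    and m: "mono_at (?T x y z) f b x" if n: "x \<noteq> y" "y \<noteq> z" "x \<noteq> z" for x y z r :: 'a and f b
  proof -
    note p = pendant_facts[OF e(1) e(2) n(1)]
    have z0: "dg (insert {x, y} {}) z = 0" using p(2)[of z] n e(2) by simp
    note zf = attach_facts[OF p(1) z0 n(3)[symmetric] n(2)[symmetric] n(1)]
    show d: "dg (?T x y z) r = (if r \<in> {x, y, z} then 2 else 0)" "sgraph (?T x y z)" for r
      using zf(1) zf(2)[of r] p(2)[of r] e(2)[of r] n by auto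
    obtain D1 s1 where D1: "coloring_state (insert {x, y} {}) D1 s1"
      "\<And>c r. D1 c r = (if r = x then (if c = (\<not> b) then 1 else 0)
         else if r = y then (if c = (\<not> b) then Suc 0 else 0) else 0)"
      by (rule state_pendant[OF e(1) st0 e(2) n(1), of "\<not> b"]) auto
    obtain D2 s2 where D2: "coloring_state (?T x y z) D2 s2"
      "\<And>c r. D2 c r = (if r = z then 1 else if r = x then (if c = (\<not> b) then Suc (D1 c r) else D1 c r)
         else if r = y then (if c = (\<not> b) then D1 c r else Suc (D1 c r)) else D1 c r)"
      by (rule state_attachE[OF D1(1) p(1) z0 n(3)[symmetric] n(2)[symmetric] n(1), of "\<not> b"]) (use D1(2) n in auto)
    have "obeys False (?T x y z) D2 f x"
      unfolding obeys_def
    proof (intro allI impI)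
      fix r assume "is_open (?T x y z) r"
      then have "r = x \<or> r = y \<or> r = z" using d(1)[of r] by (auto split: if_splits)
      then show "D2 (f r) r = 1 \<or> \<not> False \<and> r = x" using D2(2) D1(2) n by auto
    qed
    moreover have "D2 b x = 0" using D2(2) D1(2) n by simp
    ultimately show "mono_at (?T x y z) f b x" using D2(1) unfolding mono_at_def by blast
  qed
  have eq: "?T x y z = {{x, y}, {y, z}, {x, z}}" "?T y z x = {{x, y}, {y, z}, {x, z}}" "?T z x y = {{x, y}, {y, z}, {x, z}}"
    by (auto simp: attach_def insert_commute)
  have "mono_at {{x, y}, {y, z}, {x, z}} f b k" if "k \<in> {x, y, z}" for f b k
    using that m[OF assms, of f b] m[of y z x f b] m[of z x y f b] assms unfolding eq by auto
  moreover have "dg {{x, y}, {y, z}, {x, z}} r = (if r \<in> {x, y, z} then 2 else 0)" for r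
    using dg(1)[OF assms, of r] unfolding eq by simp
  ultimately have "profile3 {{x, y}, {y, z}, {x, z}} x y z"
    unfolding profile3_def using assms by simp
  then show ?thesis unfolding tight_profile_def by blast
qed

section \<open>Peeling off vertices of degree 2\<close>

text \<open>Formulated for edge sets: the vertex is taken from \<open>\<Union>F\<close>, since a
  vertex meeting no edge of \<open>F\<close> would satisfy the degree bound trivially.\<close>

definition degenerate :: "'a set set \<Rightarrow> bool" where
  "degenerate E \<longleftrightarrow> (\<forall>F\<subseteq>E. F \<noteq> {} \<longrightarrow> (\<exists>x\<in>\<Union>F. dg F x \<le> 2))"

lemma dg_mono: "finite E \<Longrightarrow> F \<subseteq> E \<Longrightarrow> dg F x \<le> dg E x"
  unfolding dg_def by (rule card_mono) auto

lemma sgraph_subset: "sgraph E \<Longrightarrow> F \<subseteq> E \<Longrightarrow> sgraph F"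
  unfolding sgraph_def by (meson finite_subset subsetD)

lemma degenerate_subset: "degenerate E \<Longrightarrow> F \<subseteq> E \<Longrightarrow> degenerate F"
  unfolding degenerate_def by (meson order_trans)

lemma sgraph_edge: "sgraph E \<Longrightarrow> e \<in> E \<Longrightarrow> x \<in> e \<Longrightarrow> \<exists>y. e = {x, y} \<and> x \<noteq> y"
  unfolding sgraph_def by (metis card_2_iff doubleton_eq_iff insertE singletonD)

lemma sgraph_finite_Union: "sgraph E \<Longrightarrow> finite (\<Union>E)"
  unfolding sgraph_def by (metis card.infinite finite_Union zero_neq_numeral)

text \<open>A vertex of degree at most 2 is removed with its edges, so each vertex accounts for at
  most two edges. The constant 3 comes from the last step, when all remaining edges meet in one
  vertex: one edge spans two vertices, two edges span at least three. The bound makes the defect a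
  natural number.\<close>

lemma edge_bound:
  assumes "sgraph E" "degenerate E" "E \<noteq> {}"
  shows "card E + 3 \<le> 2 * card (\<Union>E)"
  using assms
proof (induction "card E" arbitrary: E rule: less_induct)
  case less
  have f: "finite E" using less.prems(1) by (simp add: sgraph_def)
  obtain x where x: "x \<in> \<Union>E" "dg E x \<le> 2" using less.prems(2,3) unfolding degenerate_def by blast
  define I where "I = {e \<in> E. x \<in> e}"
  have I: "I \<subseteq> E" "card I = dg E x" "I \<noteq> {}" using x(1) by (auto simp: I_def dg_def)
  have cI: "card I \<ge> 1" using I f by (metis One_nat_def Suc_leI card_gt_0_iff finite_subset)
  have cE: "card E = card (E - I) + card I" using I(1) f by (metis card_Diff_subset card_mono finite_subset le_add_diff_inverse2)
  have fU: "finite (\<Union>E)" by (rule sgraph_finite_Union[OF less.prems(1)])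
  show ?case
  proof (cases "E - I = {}")
    case True
    then have "E = I" using I(1) by blast
    then have c: "card E \<le> 2" using I(2) x(2) by simp
    obtain e where e: "e \<in> E" using less.prems(3) by blast
    have ce: "card e = 2" using less.prems(1) e by (simp add: sgraph_def)
    show ?thesis
    proof (cases "card E = 1")
      case True
      then have "E = {e}" using e by (metis card_1_singletonE singletonD)
      then show ?thesis using ce True by simp
    next
      case False
      then have "card E = 2" using c cI \<open>E = I\<close> by simp
      then obtain e1 e2 where "E = {e1, e2}" "e1 \<noteq> e2" by (meson card_2_iff)
      then obtain e' where e': "e' \<in> E" "e' \<noteq> e" using e by auto
      have ce': "card e' = 2" using less.prems(1) e' by (simp add: sgraph_def)
      have "finite e" "finite e'" using ce ce' by (metis card.infinite zero_neq_numeral)+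
      then have "card (e \<union> e') > 2" using ce ce' e'(2)
        by (metis Un_upper1 Un_upper2 card_seteq finite_UnI linorder_not_less)
      moreover have "card (e \<union> e') \<le> card (\<Union>E)" using e e' fU by (intro card_mono) auto
      ultimately show ?thesis using c by simp
    qed
  next
    case False
    have "card (E - I) + 3 \<le> 2 * card (\<Union>(E - I))"
      by (rule less.hyps) (use cE cI less.prems False sgraph_subset degenerate_subset in \<open>auto intro: sgraph_subset degenerate_subset\<close>)
    moreover have "\<Union>(E - I) \<subseteq> \<Union>E - {x}" by (auto simp: I_def)
    then have "card (\<Union>(E - I)) \<le> card (\<Union>E) - 1"
      using fU x(1) by (metis card_Diff_singleton card_mono finite_Diff)
    moreover have "card (\<Union>E) \<ge> 1" using fU x(1) by (metis One_nat_def Suc_leI card_gt_0_iff empty_iff)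
    ultimately show ?thesis using cE I(2) x(2) by linarith
  qed
qed

lemma detach:
  assumes E: "sgraph E" and u: "dg E u = 2"
  obtains p q E' where "p \<noteq> q" "u \<noteq> p" "u \<noteq> q" "sgraph E'" "dg E' u = 0" "E = attach u p q E'" "E' \<subseteq> E"
proof -
  obtain e1 e2 where e: "{e \<in> E. u \<in> e} = {e1, e2}" "e1 \<noteq> e2"
    using u unfolding dg_def by (meson card_2_iff)
  have "e1 \<in> E \<and> u \<in> e1" "e2 \<in> E \<and> u \<in> e2" using e(1) by blast+
  then obtain p q where pq: "e1 = {u, p}" "u \<noteq> p" "e2 = {u, q}" "u \<noteq> q" using sgraph_edge[OF E] by metis
  let ?E = "E - {e1, e2}"
  have "E = attach u p q ?E" using e(1) pq by (auto simp: attach_def)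
  moreover have "dg ?E u = 0"
  proof -
    have "{e \<in> ?E. u \<in> e} = {}" using e(1) by blast
    then show ?thesis by (simp only: dg_def card.empty)
  qed
  moreover have "p \<noteq> q" using e(2) pq by auto
  moreover have "sgraph ?E" by (rule sgraph_subset[OF E]) blast
  ultimately show ?thesis using that pq by blast
qed

lemma detach_edge:
  assumes E: "sgraph E" and u: "dg E u = 2" and p: "{u, p} \<in> E"
  obtains q E' where "p \<noteq> q" "u \<noteq> p" "u \<noteq> q" "sgraph E'" "dg E' u = 0" "E = attach u p q E'" "E' \<subseteq> E"
proof -
  obtain r q E' where 1: "r \<noteq> q" "u \<noteq> r" "u \<noteq> q" "sgraph E'" "dg E' u = 0" "E = attach u r q E'" "E' \<subseteq> E"
    by (rule detach[OF E u])
  have "{u, p} \<notin> E'" using 1(4,5) dg_eq_0_iff[of E' u] by (auto simp: sgraph_def)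
  then have "p = r \<or> p = q" using p 1(6) by (auto simp: attach_def doubleton_eq_iff)
  then show ?thesis using that 1 attach_commute[of u r q E'] by metis
qed

lemma detach_pendant:
  assumes E: "sgraph E" and u: "dg E u = 1"
  obtains p E' where "u \<noteq> p" "sgraph E'" "dg E' u = 0" "E = insert {u, p} E'" "E' \<subseteq> E"
proof -
  obtain e where e: "{e \<in> E. u \<in> e} = {e}" using u unfolding dg_def by (meson card_1_singletonE)
  then have "e \<in> E" "u \<in> e" by blast+
  then obtain p where p: "e = {u, p}" "u \<noteq> p" using sgraph_edge[OF E] by metis
  let ?E = "E - {e}"
  have "E = insert {u, p} ?E" using e p by blast
  moreover have "dg ?E u = 0"
  proof -
    have "{f \<in> ?E. u \<in> f} = {}" using e by blast
    then show ?thesis by (simp only: dg_def card.empty)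
  qed
  moreover have "sgraph ?E" by (rule sgraph_subset[OF E]) blast
  ultimately show ?thesis using that p by blast
qed

text \<open>The defect \<open>d\<close> measures how far the graph is from the maximum number \<open>2n - 3\<close> of edges.\<close>

definition defect :: "nat \<Rightarrow> 'a set set \<Rightarrow> bool" where
  "defect d E \<longleftrightarrow> card E + 3 + d = 2 * card (\<Union>E)"

text \<open>What is provable for each defect; from 3 on nothing is claimed, in accordance with the
  bound 2n - 5.\<close>

definition stage :: "nat \<Rightarrow> 'a set set \<Rightarrow> bool" where
  "stage d E \<longleftrightarrow> (d = 0 \<longrightarrow> tight_profile E) \<and> (d = 1 \<longrightarrow> flexible True E) \<and> (d = 2 \<longrightarrow> flexible False E)"

lemma pendant_cards:
  assumes E: "sgraph E" and u: "dg E u = 0" "u \<noteq> p"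
  shows "card (insert {u, p} E) = card E + 1"
    "card (\<Union>(insert {u, p} E)) = card (\<Union>E) + (if dg E p = 0 then 2 else 1)"
proof -
  have f: "finite E" "finite (\<Union>E)" using E sgraph_finite_Union by (auto simp: sgraph_def)
  have n: "u \<notin> \<Union>E" "p \<in> \<Union>E \<longleftrightarrow> dg E p \<noteq> 0" using dg_eq_0_iff[OF f(1), of u] dg_eq_0_iff[OF f(1), of p] u by (simp_all del: Union_iff)
  show "card (insert {u, p} E) = card E + 1" using pendant_facts(3)[OF E u] f(1) by simp
  have "\<Union>(insert {u, p} E) = insert u (insert p (\<Union>E))" by auto
  then show "card (\<Union>(insert {u, p} E)) = card (\<Union>E) + (if dg E p = 0 then 2 else 1)"
    using n u(2) f(2) by (simp add: card_insert_if)
qed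

lemma attach_cards:
  assumes E: "sgraph E" and u: "dg E u = 0" "u \<noteq> p" "u \<noteq> q" "p \<noteq> q" and pq: "dg E p \<noteq> 0" "dg E q \<noteq> 0"
  shows "card (attach u p q E) = card E + 2" "card (\<Union>(attach u p q E)) = card (\<Union>E) + 1"
proof -
  have f: "finite E" "finite (\<Union>E)" using E sgraph_finite_Union by (auto simp: sgraph_def)
  have n: "u \<notin> \<Union>E" "p \<in> \<Union>E" "q \<in> \<Union>E" 
    using dg_eq_0_iff[OF f(1), of u] dg_eq_0_iff[OF f(1), of p] dg_eq_0_iff[OF f(1), of q] u pq
    by (simp_all del: Union_iff)
  show "card (attach u p q E) = card E + 2"
    using attach_facts(3,4)[OF E u] f(1) by (simp add: attach_def)
  have "\<Union>(attach u p q E) = insert u (\<Union>E)" using n by (auto simp: attach_def)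
  then show "card (\<Union>(attach u p q E)) = card (\<Union>E) + 1" using n f(2) by simp
qed

lemma defect_attach:
  assumes "sgraph E" "dg E u = 0" "u \<noteq> p" "u \<noteq> q" "p \<noteq> q" "dg E p \<noteq> 0" "dg E q \<noteq> 0"
  shows "defect d (attach u p q E) \<longleftrightarrow> defect d E"
  using attach_cards[OF assms] by (auto simp: defect_def)

lemma stage_single:
  "core E \<Longrightarrow> stage d E \<Longrightarrow> dg E u = 0 \<Longrightarrow> dg E v = 2 \<Longrightarrow> dg E z = 3 \<Longrightarrow> stage d (attach u v z E)"
  unfolding stage_def using tight_profile_single flexible_double_single core_sgraph(1) by metis

lemma stage_double:
  "core E \<Longrightarrow> stage d E \<Longrightarrow> dg E u = 0 \<Longrightarrow> dg E v = 2 \<Longrightarrow> dg E w = 2 \<Longrightarrow> v \<noteq> w \<Longrightarrow> stage d (attach u v w E)"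
  unfolding stage_def using tight_profile_double flexible_double_double core_sgraph(1) by metis

lemma stage_branch:
  assumes "core E" "stage d E" "dg E u = 0" "dg E u' = 0" "u \<noteq> u'" "dg E v = 2" "dg E z = 3" "dg E y = 3" "z \<noteq> y"
  shows "stage d (attach u' v y (attach u v z E))"
  using assms(2) tight_profile_branch[OF assms(1) _ assms(3-9)]
    flexible_branch[OF core_sgraph(1)[OF assms(1)] _ assms(3-9)] unfolding stage_def by blast

lemma stage_twins:
  assumes "core E" "stage d E" "dg E u = 0" "dg E u' = 0" "u \<noteq> u'" "dg E v = 2" "dg E w = 2" "v \<noteq> w"
  shows "stage d (attach u' v w (attach u v w E))"
  using assms(2) tight_profile_twins[OF assms(1) _ assms(3-8)]
    flexible_twins[OF core_sgraph(1)[OF assms(1)] _ assms(3-8)] unfolding stage_def by blast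

text \<open>Going from defect 0 to 1 uses up the freedom to place the violation, going from 1 to 2
  uses up its absence.\<close>

lemma stage_subdivide:
  assumes "core E" "stage d E" "{u, b} \<in> E" "dg E w = 0" "dg E u = 2"
  shows "stage (Suc d) (subdivide u b w E)"
  using assms(2) tight_profile_can_be_mono[OF assms(1) _ assms(5)]
    flexible_subdivide_mono[OF core_sgraph(1)[OF assms(1)] _ assms(3-5)]
    flexible_subdivide[OF core_sgraph(1)[OF assms(1)] _ assms(3-5)] unfolding stage_def
  by (metis One_nat_def Suc_1 nat.inject nat.simps(3))

lemma stage_triangle:
  assumes "core E" "stage d E" "dg E u = 0" "dg E w = 0" "u \<noteq> w" "dg E v = 2"
  shows "stage (Suc d) (add_triangle v u w E)"
  using assms(2) tight_profile_can_be_mono[OF assms(1) _ assms(6)]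
    flexible_triangle_mono[OF core_sgraph(1)[OF assms(1)] assms(3-6)]
    flexible_triangle[OF core_sgraph(1)[OF assms(1)] assms(3-6)] unfolding stage_def
  by (metis One_nat_def Suc_1 nat.inject nat.simps(3))

text \<open>Four edges on three new vertices raise the defect from 0 directly to 2, so it is enough
  that the violation tolerated at defect 0 is carried along.\<close>

lemma stage_lollipop:
  assumes "core E" "stage 0 E" "dg E a = 0" "dg E u = 0" "dg E w = 0" "a \<noteq> u" "a \<noteq> w" "u \<noteq> w"
    "is_open E p"
  shows "stage 2 (add_triangle a u w (insert {a, p} E))"
  using assms(2) tight_profile_flexible[OF assms(1)]
    flexible_lollipop[OF core_sgraph(1)[OF assms(1)] _ assms(3-9)] unfolding stage_def by simp

lemma core_dg: "core E \<Longrightarrow> dg E x = 0 \<or> dg E x = 2 \<or> dg E x = 3 \<or> dg E x = 4"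
proof -
  assume "core E"
  then have "dg E x \<le> 4" "dg E x \<noteq> 1" by (auto simp: core_def)
  then show ?thesis by arith
qed

text \<open>Peeling off a suitable piece at a vertex of degree 2 never leaves a vertex of degree 1,
  so the induction stays within the class \<open>core\<close>.\<close>

theorem stage_core:
  fixes E :: "'a set set"
  assumes "core E" "degenerate E" "E \<noteq> {}" "defect d E"
  shows "stage d E"
  using assms
proof (induction "card E" arbitrary: E d rule: less_induct)
  case less
  note c = less.prems(1) and deg = less.prems(2) and d = less.prems(4)
  note E = core_sgraph(1)[OF c] and fin = core_sgraph(2)[OF c]
  note cd = core_dg[OF c]
  have IH: "stage d' E'" if "core E'" "E' \<noteq> {}" "degenerate E'" "card E' < card E" "defect d' E'"
    for d' and E' :: "'a set set"
    using less.hyps[OF that(4,1,3,2,5)] .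
  show ?case
  \<comment> \<open>If two vertices of degree 2 are adjacent, removing one of them would leave the
    other with degree 1. They are treated as a pair, and the piece taken away lowers the
    defect.\<close>
  proof (cases "\<exists>u w. dg E u = 2 \<and> dg E w = 2 \<and> {u, w} \<in> E")
    case True
    then obtain u w where uw: "dg E u = 2" "dg E w = 2" "{u, w} \<in> E" by blast
    have une: "u \<noteq> w" using E uw(3) by (auto simp: sgraph_def)
    obtain a E1 where a: "w \<noteq> a" "u \<noteq> a" "E = attach u w a E1" and 1: "sgraph E1" "dg E1 u = 0" "E1 \<subseteq> E"
      by (rule detach_edge[OF E uw(1,3)])
    note at1 = attach_facts[OF 1(1,2) une a(2,1)]
    note d1 = at1(2)[folded a(3)]
    have "dg E1 w = 1" using d1[of w] uw une by simp
    then obtain b E2 where 2: "w \<noteq> b" "sgraph E2" "dg E2 w = 0" "E1 = insert {w, b} E2" "E2 \<subseteq> E1"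
      by (rule detach_pendant[OF 1(1)])
    note pf = pendant_facts[OF 2(2,3,1)]
    note d2 = pf(2)[folded 2(4)]
    have ub: "u \<noteq> b" "dg E2 u = 0" using d2[of u] 1(2) une by (auto split: if_splits)
    have E2sub: "E2 \<subseteq> E" using 1(3) 2(5) by blast
    have deg2: "degenerate E2" by (rule degenerate_subset[OF deg E2sub])
    have dE: "dg E x = (if x = u \<or> x = w then 2 else dg E2 x + (if x = a then 1 else 0) + (if x = b then 1 else 0))" for x
      using d1[of x] d2[of x] uw a ub 2(1) une by auto
    have fin2: "finite E2" "finite (\<Union>E2)" using 2(2) sgraph_finite_Union[OF 2(2)] by (auto simp: sgraph_def)
    have cE: "card E = card E2 + 3"
    proof -
      have "finite E1" using 1(1) by (simp add: sgraph_def)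
      then have "card E = card E1 + 2" unfolding a(3) attach_def using at1(3,4) by simp
      moreover have "card E1 = card E2 + 1" unfolding 2(4) using pf(3) fin2(1) by simp
      ultimately show ?thesis by simp
    qed
    have uE: "\<Union>E = {u, w, a, b} \<union> \<Union>E2" unfolding a(3) 2(4) attach_def by auto
    have nU: "u \<notin> \<Union>E2" "w \<notin> \<Union>E2"
      using dg_eq_0_iff[OF fin2(1), of u] dg_eq_0_iff[OF fin2(1), of w] ub(2) 2(3) by (simp_all del: Union_iff)
    show ?thesis
    proof (cases "a = b")
      case False
      \<comment> \<open>The path from \<open>u\<close> over \<open>w\<close> to \<open>b\<close> is
        contracted to a single edge. The result is simple because \<open>a\<close> and
        \<open>b\<close> differ and \<open>u\<close> meets no edge of \<open>E2\<close>.\<close>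
      let ?E = "attach u a b E2"
      note af = attach_facts[OF 2(2) ub(2) a(2) ub(1) False]
      have eq: "E = subdivide u b w ?E"
      proof -
        have "{u, b} \<notin> E2" "{u, b} \<noteq> {u, a}" using af(4) False by (auto simp: doubleton_eq_iff)
        then have "?E - {{u, b}} = insert {u, a} E2" by (auto simp: attach_def)
        then show ?thesis unfolding subdivide_def a(3) 2(4) by (auto simp: attach_def)
      qed
      have w0: "dg ?E w = 0" using af(2)[of w] 2(1,3) a(1) une by simp
      have sf: "dg E x = (if x = w then 2 else dg ?E x)" for x
        using subdivide_facts(8)[OF af(1) _ w0, of u b x] eq by (simp add: attach_def)
      have core: "core ?E" unfolding core_def using af(1) c sf w0 by (metis core_def zero_le zero_neq_one)
      have u2: "dg ?E u = 2" using af(2)[of u] by simp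
      \<comment> \<open>The contracted graph is not a subgraph of \<open>E\<close>, so degeneracy is
        not inherited; but an edge set outside \<open>E2\<close> contains \<open>u\<close>, whose
        degree is 2.\<close>
      have dgn: "degenerate ?E"
        unfolding degenerate_def
      proof (intro allI impI)
        fix F assume F: "F \<subseteq> ?E" "F \<noteq> {}"
        show "\<exists>x\<in>\<Union>F. dg F x \<le> 2"
        proof (cases "F \<subseteq> E2")
          case True then show ?thesis using deg2 F(2) unfolding degenerate_def by blast
        next
          case False
          then have "u \<in> \<Union>F" using F(1) by (auto simp: attach_def)
          moreover have "dg F u \<le> 2" using dg_mono[OF _ F(1), of u] u2 fin2 by (simp add: attach_def)
          ultimately show ?thesis by blast
        qed
      qed
      have ne: "?E \<noteq> {}" by (simp add: attach_def)
      have c1: "card ?E = card E2 + 2" using af(3,4) fin2(1) by (simp add: attach_def)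
      have "\<Union>E = insert w (\<Union>?E)" unfolding uE by (auto simp: attach_def)
      moreover have "w \<notin> \<Union>?E" using nU(2) une a(1) 2(1) by (auto simp: attach_def)
      ultimately have c2: "card (\<Union>E) = card (\<Union>?E) + 1" using sgraph_finite_Union[OF af(1)] by simp
      have "card ?E + 3 \<le> 2 * card (\<Union>?E)" by (rule edge_bound[OF af(1) dgn ne])
      then have "d = Suc (d - 1)" "defect (d - 1) ?E" using d cE c1 c2 by (auto simp: defect_def)
      then obtain d' where d': "d = Suc d'" "defect d' ?E" by blast
      have "stage d' ?E" by (rule IH[OF core ne dgn _ d'(2)]) (use c1 cE in simp)
      then show ?thesis unfolding d'(1) by (subst eq) (rule stage_subdivide[OF core _ _ w0 u2], auto simp: attach_def)
    next
      case True
      have eq: "E = add_triangle a u w E2"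
        unfolding a(3) 2(4) True add_triangle_def attach_def by (auto simp: insert_commute)
      have "dg E a = dg E2 a + 2" using dE[of a] a True by simp
      \<comment> \<open>Now \<open>a\<close>, \<open>u\<close>, \<open>w\<close> form a triangle;
        the cases count the further edges at \<open>a\<close>.\<close>
      then consider (0) "dg E2 a = 0" | (1) "dg E2 a = 1" | (2) "dg E2 a = 2" using cd[of a] by arith
      then show ?thesis
      proof cases
        case 0
        have aU: "a \<notin> \<Union>E2" using dg_eq_0_iff[OF fin2(1), of a] 0 by (simp del: Union_iff)
        have "\<Union>E = insert u (insert w (insert a (\<Union>E2)))" unfolding uE True by auto
        then have cU: "card (\<Union>E) = card (\<Union>E2) + 3" using nU aU une a(1,2) fin2(2) by simp
        show ?thesis
        proof (cases "E2 = {}")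
          case True
          then have "d = 0" using d cE cU by (simp add: defect_def)
          moreover have "E = {{u, a}, {a, w}, {u, w}}"
            unfolding eq add_triangle_def attach_def True by (auto simp: insert_commute)
          then have "tight_profile E" using triangle_tight_profile[of u a w] a(1,2) une by metis
          ultimately show ?thesis by (simp add: stage_def)
        next
          case False
          \<comment> \<open>A separate triangle adds 3 edges on 3 vertices, which costs 2 * 3 - 3 =
            3 on top of the nonnegative slack of the rest.\<close>
          have "d \<ge> 3" using edge_bound[OF 2(2) deg2 False] d cE cU by (simp add: defect_def)
          then show ?thesis by (simp add: stage_def)
        qed
      next
        case 1
        then obtain s E3 where 3: "a \<noteq> s" "sgraph E3" "dg E3 a = 0" "E2 = insert {a, s} E3" "E3 \<subseteq> E2"
          by (rule detach_pendant[OF 2(2)])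
        note qf = pendant_facts[OF 3(2,3,1)]
        note d3 = qf(2)[folded 3(4)]
        have deg3: "degenerate E3" by (rule degenerate_subset[OF deg2 3(5)])
        have s: "u \<noteq> s" "w \<noteq> s" "dg E3 u = 0" "dg E3 w = 0"
          using d3[of u] d3[of w] ub(2) 2(3) a(1,2) by (auto split: if_splits)
        have dE3: "dg E x = (if x = u \<or> x = w then 2 else if x = a then 3 else if x = s then Suc (dg E3 x) else dg E3 x)" for x
          using dE[of x] d3[of x] True 1 by auto
        have s1: "dg E3 s \<noteq> 0" "dg E3 s \<le> 3" using dE3[of s] s(1,2) 3(1) cd[of s] by auto
        have fin3: "finite E3" "finite (\<Union>E3)" using 3(2) sgraph_finite_Union[OF 3(2)] by (auto simp: sgraph_def)
        have ne3: "E3 \<noteq> {}" using s1(1) by (auto simp: dg_def)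
        have cE3: "card E = card E3 + 4" using cE qf(3) fin3(1) unfolding 3(4) by simp
        have U3: "x \<in> \<Union>E3 \<longleftrightarrow> dg E3 x \<noteq> 0" for x using dg_eq_0_iff[OF fin3(1), of x] by (simp del: Union_iff)
        have "\<Union>E2 = insert a (\<Union>E3)" unfolding 3(4) using U3[of s] s1(1) by auto
        then have "\<Union>E = insert u (insert w (insert a (\<Union>E3)))" unfolding uE True by auto
        moreover have "u \<notin> \<Union>E3" "w \<notin> \<Union>E3" "a \<notin> \<Union>E3" using U3 s 3(3) by metis+
        ultimately have cU3: "card (\<Union>E) = card (\<Union>E3) + 3" using une a(1,2) fin3(2) by simp
        \<comment> \<open>The triangle with its stalk has 4 edges on 3 new vertices, at the cost 2 *
          3 - 4 = 2.\<close>
        have "d \<ge> 2" using edge_bound[OF 3(2) deg3 ne3] d cE3 cU3 by (simp add: defect_def)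
        show ?thesis
        proof (cases "d = 2")
          case False
          then show ?thesis using \<open>d \<ge> 2\<close> by (simp add: stage_def)
        next
          case d_two: True
          have d0: "defect 0 E3" using d cE3 cU3 unfolding d_two by (simp add: defect_def)
          \<comment> \<open>Deleting a pendant vertex loses only one edge, so from defect 0 it would
            lead beyond \<open>edge_bound\<close>. The neighbour \<open>r\<close> still meets an
            edge afterwards, since in \<open>E\<close> it does not have degree 1.\<close>
          have "dg E3 s \<noteq> 1"
          proof
            assume "dg E3 s = 1"
            then obtain r E4 where 4: "s \<noteq> r" "sgraph E4" "dg E4 s = 0" "E3 = insert {s, r} E4" "E4 \<subseteq> E3"
              by (rule detach_pendant[OF 3(2)])
            note rf = pendant_facts(2)[OF 4(2,3,1), folded 4(4)]
            have "dg E3 r = Suc (dg E4 r)" using rf[of r] 4(1) by simp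
            moreover from this have "dg E r = dg E3 r" using dE3[of r] s(3,4) 3(3) 4(1) by auto
            ultimately have r: "dg E4 r \<noteq> 0" using cd[of r] by auto
            then have "E4 \<noteq> {}" by (auto simp: dg_def)
            then have "card E4 + 3 \<le> 2 * card (\<Union>E4)"
              by (rule edge_bound[OF 4(2) degenerate_subset[OF deg3 4(5)]])
            then show False
              using pendant_cards[OF 4(2,3,1), folded 4(4)] d0 r by (simp add: defect_def)
          qed
          then have s23: "is_open E3 s" using s1 by arith
          have core3: "core E3" unfolding core_def
          proof (intro conjI allI)
            fix x
            have "dg E3 x = 0 \<or> dg E3 x = 2 \<or> dg E3 x = 3 \<or> dg E3 x = dg E x"
              using dE3[of x] s23 s(3,4) 3(3) by auto
            then show "dg E3 x \<le> 4" "dg E3 x \<noteq> 1" using cd[of x] by auto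
          qed (rule 3(2))
          have "stage 0 E3" by (rule IH[OF core3 ne3 deg3 _ d0]) (simp add: cE3)
          then show ?thesis unfolding d_two eq 3(4)
            by (rule stage_lollipop[OF core3 _ 3(3) s(3,4) a(2)[symmetric] a(1)[symmetric] une s23])
        qed
      next
        case 2: 2
        note a2 = this
        have core2: "core E2" unfolding core_def
        proof (intro conjI allI)
          fix x
          have "dg E2 x = 0 \<or> dg E2 x = 2 \<or> dg E2 x = dg E x"
            using dE[of x] True a2 ub(2) \<open>dg E2 w = 0\<close> by auto
          then show "dg E2 x \<le> 4" "dg E2 x \<noteq> 1" using cd[of x] by auto
        qed (rule \<open>sgraph E2\<close>)
        have ne2: "E2 \<noteq> {}" using a2 by (auto simp: dg_def)
        have "a \<in> \<Union>E2" using dg_eq_0_iff[OF fin2(1), of a] a2 by (simp del: Union_iff)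
        then have "\<Union>E = insert u (insert w (\<Union>E2))" unfolding uE True by blast
        then have cU: "card (\<Union>E) = card (\<Union>E2) + 2" using nU une fin2(2) by simp
        have "card E2 + 3 \<le> 2 * card (\<Union>E2)" by (rule edge_bound[OF \<open>sgraph E2\<close> deg2 ne2])
        then have "d = Suc (d - 1)" "defect (d - 1) E2" using d cE cU by (auto simp: defect_def)
        then obtain d' where d': "d = Suc d'" "defect d' E2" by blast
        have "stage d' E2" by (rule IH[OF core2 ne2 deg2 _ d'(2)]) (simp add: cE)
        then show ?thesis unfolding d'(1) eq
          by (rule stage_triangle[OF core2 _ ub(2) \<open>dg E2 w = 0\<close> une a2])
      qed
    qed
  next
    case nadj: False
    show ?thesis
    proof (cases "\<exists>u p. dg E u = 2 \<and> dg E p = 3 \<and> {u, p} \<in> E")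
      case True
      then obtain u p where u: "dg E u = 2" and p: "dg E p = 3" and up: "{u, p} \<in> E" by blast
      obtain q E' where 1: "p \<noteq> q" "u \<noteq> p" "u \<noteq> q" "sgraph E'" "dg E' u = 0" "E = attach u p q E'" "E' \<subseteq> E"
        by (rule detach_edge[OF E u up])
      note af = attach_facts[OF 1(4,5,2,3,1)]
      note dE = af(2)[folded 1(6)]
      have p2: "dg E' p = 2" using dE[of p] p 1(2) by simp
      \<comment> \<open>Vertices of degree 2 are not adjacent in this case, so the second neighbour
        of \<open>u\<close> does not drop to degree 1.\<close>
      have "dg E q \<noteq> 2" using nadj u 1(6) by (auto simp: attach_def)
      moreover have "dg E q = Suc (dg E' q)" using dE[of q] 1(1,3) by simp
      ultimately have q: "is_open E' q" using cd[of q] by auto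
      have core: "core E'" unfolding core_def
      proof (intro conjI allI)
        fix x
        have "dg E' x = 0 \<or> dg E' x = 2 \<or> dg E' x = 3 \<or> dg E' x = dg E x"
          using dE[of x] q p2 1(5) by auto
        then show "dg E' x \<le> 4" "dg E' x \<noteq> 1" using cd[of x] by auto
      qed (rule 1(4))
      have pq0: "dg E' p \<noteq> 0" "dg E' q \<noteq> 0" using p2 q by auto
      have ne: "E' \<noteq> {}" using p2 by (auto simp: dg_def)
      have "defect d E'" using d defect_attach[OF 1(4,5,2,3,1) pq0, of d] 1(6) by simp
      moreover have "card E' < card E" using attach_cards(1)[OF 1(4,5,2,3,1) pq0] 1(6) by simp
      ultimately have st: "stage d E'" using IH[OF core ne degenerate_subset[OF deg 1(7)]] by blast
      show ?thesis
        using q stage_double[OF core st 1(5) p2 _ 1(1)] stage_single[OF core st 1(5) p2] 1(6) by metis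
    next
      case nthree: False
      have nb4: "dg E y = 4" if "dg E v = 2" "{v, y} \<in> E" for v y
      proof -
        have "dg E y \<noteq> 0" using that(2) dg_eq_0_iff[OF fin, of y] by blast
        moreover have "dg E y \<noteq> 2" using nadj that by blast
        moreover have "dg E y \<noteq> 3" using nthree that by blast
        ultimately show ?thesis using cd[of y] by simp
      qed
      \<comment> \<open>All neighbours of vertices of degree 2 have degree 4 now. Degeneracy is
        applied to what remains without the edges at vertices of degree 2: a vertex of degree at
        most 2 there must have lost edges, hence has degree 4 in \<open>E\<close> and at least two
        neighbours of degree 2.\<close>
      define F where "F = {e \<in> E. \<forall>y\<in>e. dg E y \<noteq> 2}"
      have FE: "F \<subseteq> E" by (auto simp: F_def)
      obtain x where x: "dg E x = 4" "dg F x \<le> 2"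
      proof (cases "F = {}")
        case True
        obtain v where v: "v \<in> \<Union>E" "dg E v \<le> 2" using deg less.prems(3) unfolding degenerate_def by blast
        then have "dg E v = 2" using cd[of v] dg_eq_0_iff[OF fin, of v] by auto
        moreover from v(1) obtain e where "e \<in> E" "v \<in> e" by blast
        then obtain y where "{v, y} \<in> E" using sgraph_edge[OF E] by metis
        ultimately have "dg E y = 4" by (rule nb4)
        then show ?thesis using that True by (simp add: dg_def)
      next
        case False
        then obtain x where x: "x \<in> \<Union>F" "dg F x \<le> 2" using deg FE unfolding degenerate_def by blast
        have "dg E x \<noteq> 2" "dg E x \<noteq> 0" using x(1) dg_eq_0_iff[OF fin, of x] by (auto simp: F_def)
        moreover have "dg E x \<noteq> 3"
        proof
          assume x3: "dg E x = 3"
          have "e \<in> F" if e: "e \<in> E" "x \<in> e" for e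
          proof -
            obtain y where y: "e = {y, x}" using sgraph_edge[OF E e] by (metis insert_commute)
            have "dg E y \<noteq> 2" using nthree x3 e(1) y by blast
            then show ?thesis using e(1) y x3 by (simp add: F_def)
          qed
          then have "{e \<in> F. x \<in> e} = {e \<in> E. x \<in> e}" using FE by blast
          then have "dg F x = dg E x" by (simp only: dg_def)
          then show False using x3 x(2) by simp
        qed
        ultimately show ?thesis using that[of x] x(2) cd[of x] by simp
      qed
      let ?I = "{e \<in> E. x \<in> e} - {e \<in> F. x \<in> e}"
      have "card ?I = dg E x - dg F x" unfolding dg_def using fin FE
        by (intro card_Diff_subset) (auto intro: finite_subset)
      then have "card ?I \<ge> 2" using x by simp
      then obtain J where J: "J \<subseteq> ?I" "card J = 2" by (meson obtain_subset_with_card_n)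
      then obtain e1 e2 where "J = {e1, e2}" "e1 \<noteq> e2" by (meson card_2_iff)
      then have e12: "e1 \<in> ?I" "e2 \<in> ?I" "e1 \<noteq> e2" using J(1) by auto
      have dbl: "\<exists>v. e = {v, x} \<and> dg E v = 2" if e: "e \<in> ?I" for e
      proof -
        obtain v where v: "v \<in> e" "dg E v = 2" using e by (auto simp: F_def)
        moreover have "v \<noteq> x" using v(2) x(1) by auto
        moreover have "e \<in> E" "x \<in> e" using e by auto
        ultimately show ?thesis using sgraph_edge[OF E, of e v] by auto
      qed
      obtain u where u: "e1 = {u, x}" "dg E u = 2" using dbl[OF e12(1)] by blast
      obtain w where w: "e2 = {w, x}" "dg E w = 2" using dbl[OF e12(2)] by blast
      have uw: "u \<noteq> w" "{u, x} \<in> E" "{w, x} \<in> E" using e12 u w by auto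
      obtain a E1 where a: "x \<noteq> a" "u \<noteq> x" "u \<noteq> a" "sgraph E1" "dg E1 u = 0" "E = attach u x a E1" "E1 \<subseteq> E"
        by (rule detach_edge[OF E u(2) uw(2)])
      note d1 = attach_facts(2)[OF a(4,5,2,3,1), folded a(6)]
      have "{u, a} \<in> E" by (subst a(6)) (simp add: attach_def)
      then have a4: "dg E a = 4" by (rule nb4[OF u(2)])
      have wE1: "{w, x} \<in> E1" using uw(1,3) a(2) unfolding a(6) by (auto simp: attach_def doubleton_eq_iff)
      have wne: "w \<noteq> x" "w \<noteq> a" using w(2) x(1) a4 by auto
      have w1: "dg E1 w = 2" using d1[of w] uw(1) wne w(2) by simp
      obtain b E2 where b: "x \<noteq> b" "w \<noteq> x" "w \<noteq> b" "sgraph E2" "dg E2 w = 0" "E1 = attach w x b E2" "E2 \<subseteq> E1"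
        by (rule detach_edge[OF a(4) w1 wE1])
      note d2 = attach_facts(2)[OF b(4,5,2,3,1), folded b(6)]
      have "{w, b} \<in> E1" by (subst b(6)) (simp add: attach_def)
      then have "{w, b} \<in> E" using a(7) by blast
      then have b4: "dg E b = 4" by (rule nb4[OF w(2)])
      have ub: "u \<noteq> b" using b4 u(2) by auto
      have u0: "dg E2 u = 0" using d2[of u] a(2,5) uw(1) ub by simp
      have x2: "dg E1 x = 3" "dg E2 x = 2" using d1[of x] d2[of x] x(1) a(2) b(2) by simp_all
      have a3: "dg E1 a = 3" using d1[of a] a4 a(1,3) by simp
      have a2: "dg E2 a = (if a = b then 2 else 3)" using d2[of a] a3 a(1) wne(2) by (cases "a = b") auto
      have b3: "dg E2 b = (if a = b then 2 else 3)" using d1[of b] d2[of b] b4 ub b(1,3) by (cases "a = b") auto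
      have core: "core E2" unfolding core_def
      proof (intro conjI allI)
        fix y
        have "dg E2 y = 0 \<or> dg E2 y = 2 \<or> dg E2 y = 3 \<or> dg E2 y = dg E y"
          using d1[of y] d2[of y] u0 x2(2) a2 b3 b(5) by auto
        then show "dg E2 y \<le> 4" "dg E2 y \<noteq> 1" using cd[of y] by auto
      qed (rule b(4))
      have ne: "E2 \<noteq> {}" using x2(2) by (auto simp: dg_def)
      have nz: "dg E1 x \<noteq> 0" "dg E1 a \<noteq> 0" "dg E2 x \<noteq> 0" "dg E2 b \<noteq> 0" using x2 a3 b3 by auto
      have "defect d E2"
        using d defect_attach[OF a(4,5,2,3,1) nz(1,2), of d] defect_attach[OF b(4,5,2,3,1) nz(3,4), of d]
          a(6) b(6) by simp
      moreover have "card E2 < card E"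
        using attach_cards(1)[OF a(4,5,2,3,1) nz(1,2)] attach_cards(1)[OF b(4,5,2,3,1) nz(3,4)] a(6) b(6) by simp
      moreover have "degenerate E2" by (rule degenerate_subset[OF deg]) (use a(7) b(7) in blast)
      ultimately have st: "stage d E2" using IH[OF core ne] by blast
      \<comment> \<open>In \<open>E2\<close> the vertex \<open>x\<close> has degree 2. Its two
        removed neighbours \<open>u\<close> and \<open>w\<close> are twins if their second
        neighbours coincide, and otherwise form a branch at \<open>x\<close>.\<close>
      show ?thesis
      proof (cases "a = b")
        case True
        have "dg E2 a = 2" using a2 True by simp
        then show ?thesis using stage_twins[OF core st b(5) u0 uw(1)[symmetric] x2(2) _ a(1)] a(6) b(6) True by metis
      next
        case False
        then have "dg E2 a = 3" "dg E2 b = 3" using a2 b3 by simp_all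
        then show ?thesis
          using stage_branch[OF core st b(5) u0 uw(1)[symmetric] x2(2) _ _ False[symmetric]] a(6) b(6) by metis
      qed
    qed
  qed
qed

section \<open>From flexible graphs to colorings of all sparse graphs\<close>

lemma separates_exists:
  assumes "matching m S"
  obtains f where "separates m S f"
proof
  \<comment> \<open>A representative of the pair of \<open>x\<close>; the choice depends on the set
    only, so both partners have the same one.\<close>
  let ?r = "\<lambda>x. SOME y. y \<in> {x, m x}"
  show "separates m S (\<lambda>x. x = ?r x)"
    unfolding separates_def
  proof
    fix x assume x: "x \<in> S"
    then have m: "m x \<noteq> x" "m (m x) = x" using assms by (auto simp: matching_def)
    then have "?r (m x) = ?r x" by (simp add: insert_commute)
    moreover have "?r x \<in> {x, m x}" by (rule someI[of _ x]) simp
    ultimately show "(m x = ?r (m x)) = (\<not> x = ?r x)" using m(1) by auto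
  qed
qed

text \<open>At a vertex of degree 2, degree 1 in the prescribed colour means degree 1 in both, so
  the prescription can be forgotten.\<close>

lemma flexible_state:
  assumes "flexible Z E" and fin: "finite E"
  obtains D s d where "coloring_state E D s" "\<forall>x. dg E x = 2 \<longrightarrow> D True x = 1 \<or> x = d"
proof -
  obtain m where m: "matching m {x. dg E x = 3}"
    "\<And>f. separates m {x. dg E x = 3} f \<Longrightarrow> colorable Z E f"
    using assms(1) unfolding flexible_def by blast
  obtain f where "separates m {x. dg E x = 3} f" by (rule separates_exists[OF m(1)])
  then obtain D s d where st: "coloring_state E D s" "obeys Z E D f d" using m(2) by blast
  have "D True x = 1 \<or> x = d" if x: "dg E x = 2" for x
  proof (cases "x = d")
    case False
    show ?thesis using obeys_at[OF st(2) _ False] x state_open(1)[OF st(1) fin] by blast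
  qed simp
  then show ?thesis using that[OF st(1)] by blast
qed

text \<open>Vertices of degree 1 are peeled off until a \<open>core\<close> is left. Losing one edge
  together with at least one vertex preserves the sparsity bound, and the pendant edge can be put
  back without a new violation.\<close>

theorem sparse_state:
  fixes E :: "'a set set"
  assumes "sgraph E" "\<forall>x. dg E x \<le> 4" "degenerate E" "2 * card (\<Union>E) \<le> card E + 5"
  obtains D s d where "coloring_state E D s" "\<forall>x. dg E x = 2 \<longrightarrow> D True x = 1 \<or> x = d"
proof -
  have "\<exists>D s d. coloring_state E D s \<and> (\<forall>x. dg E x = 2 \<longrightarrow> D True x = 1 \<or> x = d)"
    using assms
  proof (induction "card E" arbitrary: E rule: less_induct)
    case less
    note E = less.prems(1)
    have f: "finite E" using E by (simp add: sgraph_def)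
    show ?case
    proof (cases "\<exists>u. dg E u = 1")
      case True
      then obtain u where "dg E u = 1" by blast
      then obtain p F where F: "u \<noteq> p" "sgraph F" "dg F u = 0" "E = insert {u, p} F" "F \<subseteq> E"
        by (rule detach_pendant[OF E])
      note c = pendant_cards[OF F(2,3,1), folded F(4)]
      note dE = pendant_facts(2)[OF F(2,3,1), folded F(4)]
      have fF: "finite F" using F(2) by (simp add: sgraph_def)
      have "\<exists>D s d. coloring_state F D s \<and> (\<forall>x. dg F x = 2 \<longrightarrow> D True x = 1 \<or> x = d)"
      proof (rule less.hyps)
        show "card F < card E" "2 * card (\<Union>F) \<le> card F + 5" using c less.prems(4) by (auto split: if_splits)
        show "\<forall>x. dg F x \<le> 4" using dg_mono[OF f F(5)] less.prems(2) order_trans by blast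
      qed (use F degenerate_subset less.prems(3) in auto)
      then obtain D s d where st: "coloring_state F D s" "\<forall>x. dg F x = 2 \<longrightarrow> D True x = 1 \<or> x = d" by blast
      have p3: "dg F p \<le> 3" using dE[of p] less.prems(2) F(1) by (auto dest: spec[of _ p])
      \<comment> \<open>The colour used less at \<open>p\<close>: it occurs at most once there, as
        \<open>p\<close> had degree at most 3, and if \<open>p\<close> comes to degree 2, it sees
        both colours.\<close>
      define b where "b = (D True p \<le> D False p)"
      have b: "D b p \<le> D (\<not> b) p" by (cases b) (auto simp: b_def)
      have sb: "D b p + D (\<not> b) p = dg F p" by (rule state_degree[OF st(1) fF])
      then have b1: "D b p \<le> 1" using p3 b by simp
      obtain D' s' where st': "coloring_state (insert {u, p} F) D' s'"
        "\<And>c x. D' c x = (if x = u then (if c = b then 1 else 0)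
           else if x = p then (if c = b then Suc (D c x) else D c x) else D c x)"
        by (rule state_pendant[where b = b, OF F(2) st(1) F(3,1) b1]) blast
      have "D' True x = 1 \<or> x = d" if x: "dg E x = 2" for x
      proof (cases "x = p")
        case True
        then have "dg F p = 1" using dE[of p] x F(1) by simp
        then have "D b p = 0" "D (\<not> b) p = 1" using sb b by simp_all
        then show ?thesis using st'(2)[of True p] True F(1) by (cases b) auto
      next
        case False
        then show ?thesis using dE[of x] x st(2) st'(2)[of True x] by (auto split: if_splits)
      qed
      then show ?thesis using st'(1) F(4) by blast
    next
      case False
      then have c: "core E" using E less.prems(2) by (auto simp: core_def)
      show ?thesis
      proof (cases "E = {}")
        case True
        have "coloring_state {} (\<lambda>_. dg {}) (\<lambda>_. id)"
          unfolding coloring_state_def using path_cover_empty by (intro exI[of _ "\<lambda>_. {}"]) auto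
        then show ?thesis unfolding True by (auto simp: dg_def intro!: exI)
      next
        case ne: False
        have "card E + 3 \<le> 2 * card (\<Union>E)" by (rule edge_bound[OF E less.prems(3) ne])
        then obtain d where d: "2 * card (\<Union>E) = card E + 3 + d" by (metis le_Suc_ex)
        then have "d \<le> 2" using less.prems(4) by simp
        then have d012: "d = 0 \<or> d = 1 \<or> d = 2" by arith
        have st: "stage d E" by (rule stage_core[OF c less.prems(3) ne]) (simp add: defect_def d)
        have "\<exists>Z. flexible Z E" using st d012 tight_profile_flexible[OF c] unfolding stage_def by blast
        then show ?thesis using flexible_state[OF _ f] by metis
      qed
    qed
  qed
  then show ?thesis using that by blast
qed

theorem theorem3:
  fixes G :: "'a ugraph"
  assumes "finite_simple_graph G"
    and "two_degenerate G"
    and "\<forall>v\<in>verts G. degree G v \<le> 4"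
    and "int (card (edges G)) \<ge> 2 * int (card (verts G)) - 5"
  shows "\<exists>c. two_linear_coloring G c \<and> card {v \<in> verts G. monochromatic G c v} \<le> 1"
proof -
  let ?E = "edges G"
  have fV: "finite (verts G)" and ed: "\<And>e. e \<in> ?E \<Longrightarrow> e \<subseteq> verts G \<and> card e = 2"
    using assms(1) by (auto simp: finite_simple_graph_def)
  have UV: "\<Union>?E \<subseteq> verts G" using ed by blast
  have fE: "finite ?E" by (rule finite_subset[of _ "Pow (verts G)"]) (use ed fV in auto)
  have E: "sgraph ?E" using ed fE by (simp add: sgraph_def)
  have dg: "degree G v = dg ?E v" for v by (simp add: degree_def incident_edges_def dg_def)
  have d4: "\<forall>x. dg ?E x \<le> 4"
  proof
    fix x
    show "dg ?E x \<le> 4"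
    proof (cases "x \<in> verts G")
      case False
      then have "dg ?E x = 0" using dg_eq_0_iff[OF fE, of x] UV by blast
      then show ?thesis by simp
    qed (use assms(3) dg in metis)
  qed
  have deg: "degenerate ?E"
    unfolding degenerate_def
  proof (intro allI impI)
    fix F assume F: "F \<subseteq> ?E" "F \<noteq> {}"
    let ?H = "\<lparr>verts = \<Union>F, edges = F\<rparr>"
    have "finite (\<Union>F)" using UV F(1) fV by (meson Union_mono finite_subset order_trans)
    then have "subgraph ?H G" using F(1) UV ed by (auto simp: subgraph_def finite_simple_graph_def)
    moreover obtain e where "e \<in> F" using F(2) by blast
    then have "\<Union>F \<noteq> {}" using ed F(1) by (metis Sup_bot_conv(1) card.empty subsetD zero_neq_numeral)
    ultimately obtain v where "v \<in> \<Union>F" "degree ?H v \<le> 2"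
      using assms(2) unfolding two_degenerate_def by (metis select_convs(1))
    then show "\<exists>x\<in>\<Union>F. dg F x \<le> 2" by (auto simp: degree_def incident_edges_def dg_def)
  qed
  \<comment> \<open>The count in \<open>sparse_state\<close> covers only vertices that meet an edge;
    isolated vertices of \<open>G\<close> make its hypothesis easier to satisfy.\<close>
  have "card (\<Union>?E) \<le> card (verts G)" by (rule card_mono[OF fV UV])
  then have sparse: "2 * card (\<Union>?E) \<le> card ?E + 5" using assms(4) by linarith
  obtain D s d where st: "coloring_state ?E D s" and bal: "\<forall>x. dg ?E x = 2 \<longrightarrow> D True x = 1 \<or> x = d"
    by (rule sparse_state[OF E d4 deg sparse])
  obtain K where K: "?E = K True \<union> K False" "K True \<inter> K False = {}"
      "\<And>b. path_cover (K b) (s b)" "\<And>b. D b = dg (K b)"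
    using st unfolding coloring_state_def by blast
  define c where "c e = (if e \<in> K True then 1 else 2 :: nat)" for e
  have lf: "linear_forest \<lparr>verts = verts G, edges = K b\<rparr>" for b
    by (rule path_cover_linear_forest[OF K(3)]) (cases b; use K(1) ed in auto)
  have "{e \<in> ?E. c e = 1} = K True" "{e \<in> ?E. c e = 2} = K False"
    using K(1,2) by (auto simp: c_def)
  then have col: "two_linear_coloring G c"
    unfolding two_linear_coloring_def color_class_def using lf by (auto simp: c_def)
  have "v = d" if v: "monochromatic G c v" for v
  proof (rule ccontr)
    assume "v \<noteq> d"
    have dv: "dg ?E v = 2" using v dg by (simp add: monochromatic_def)
    then have "D True v = 1" using bal \<open>v \<noteq> d\<close> by blast
    moreover from this have "D False v = 1" using state_degree[OF st fE, of True v] dv by simp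
    ultimately have "dg (K True) v = 1" "dg (K False) v = 1" using K(4) by simp_all
    then obtain e f where e: "e \<in> K True" "v \<in> e" and f: "f \<in> K False" "v \<in> f"
      unfolding dg_def by (metis (no_types, lifting) One_nat_def card_1_singletonE mem_Collect_eq singletonI)
    then have "e \<in> incident_edges G v" "f \<in> incident_edges G v" using K(1) by (auto simp: incident_edges_def)
    then have "c e = c f" using v unfolding monochromatic_def by blast
    then show False using e f K(2) by (auto simp: c_def split: if_splits)
  qed
  then have "{v \<in> verts G. monochromatic G c v} \<subseteq> {d}" by blast
  then have "card {v \<in> verts G. monochromatic G c v} \<le> 1"
    using card_mono[of "{d}"] by simp
  then show ?thesis using col by blast
qed

end
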